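(* Fix an integer $k\ge2$ and let $\alpha(n)=\operatorname{polylog}(n)$ with $\alpha(n)=\omega(1)$. If there exists an algorithm that solves the planted decision $k\text{-OV}^\alpha$ problem with success probability at least $1-\delta(n)$ in time $T(n)$, then there exists an algorithm that solves the planted search $k\text{-OV}^\alpha$ problem with success probability at least $1-13k\cdot\delta(n)-\frac{1}{n^k}$ in expected time $O\!\left(\big(T(n)+n\operatorname{polylog}(n)\big)\log\frac{n}{\delta(n)}\right)$.
   Context: Let $d=\alpha(n)\log_2 n$ and $p=\left(1-2^{-2k/\alpha(n)}\right)^{1/k}$ ($n$ large enough that $p\le1/2$). Vectors $u_1,\dots,u_k\in\{0,1\}^d$ are orthogonal if for every $j\in[d]$, $\prod_{\ell}u_\ell[j]=0$. A $k$-OV instance is a tuple of matrices $U_1,\dots,U_k\in\{0,1\}^{n\times d}$, $U_{\ell,i}$ the $i$-th row of $U_\ell$. The model distribution $k\text{-OV}_0^\alpha(n)$ samples all entries independently, each $1$ with probability $p$. $\mathsf{Plant}(U_1,\dots,U_k,s_1,\dots,s_k)$: for each coordinate $j\in[d]$ independently, let $m$ be the number of ones among $U_{1,s_1}[j],\dots,U_{k,s_k}[j]$; if $k-m$ is even, flip $U_{k,s_k}[j]$ with probability $(p/(1-p))^{k-m}$; return the instance. The planted distribution $k\text{-OV}_1^\alpha(n)$ samples from $k\text{-OV}_0^\alpha(n)$, picks $(s_1,\dots,s_k)$ uniformly in $[n]^k$, and applies $\mathsf{Plant}$. An algorithm $\mathcal{A}$ outputting a bit solves the planted decision $k\text{-OV}^\alpha$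 problem with success probability $\delta(n)$ if for both $b\in\{0,1\}$ and all large enough $n$, $\Pr_{U\sim k\text{-OV}_b^\alpha(n)}[\mathcal{A}(U)=b]\ge\delta(n)$ (over the instance and $\mathcal{A}$'s coins). An algorithm $\mathcal{A}$ outputting $(s_1,\dots,s_k)\in[n]^k$ solves the planted search $k\text{-OV}^\alpha$ problem with success probability $\delta(n)$ if for large enough $n$, $\Pr_{U\sim k\text{-OV}_1^\alpha(n)}[U_{1,s_1},\dots,U_{k,s_k}\text{ are orthogonal}]\ge\delta(n)$ where $(s_1,\dots,s_k)=\mathcal{A}(U)$. *)

theory Defs
  imports "HOL-Probability.Probability" "HOL-Library.Landau_Symbols" "HOL-Library.Log_Nat"
begin

text \<open>
  Algorithms are structured programs for a randomised word RAM. A program has finitely many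
  registers and finitely many random-access arrays, each holding words of w bits; arithmetic is
  modulo 2 to the power w. Each executed instruction, including the evaluation of a guard, takes
  one time step. The only source of randomness is the unbiased coin \<open>Coin\<close>.
\<close>

type_synonym reg = nat
type_synonym arr = nat

datatype binop =
  Add | Sub | Mul | Div | Mod | Less | Equal | And | Or | Xor | ShiftL | ShiftR

datatype com =
    Const reg nat
  | Binop binop reg reg reg
  | Load reg arr reg
  | Store arr reg reg
  | Coin reg
  | Seq com com
  | If reg com com
  | While reg com

record state =
  regs :: "reg \<Rightarrow> nat"
  mem :: "arr \<Rightarrow> nat \<Rightarrow> nat"

definition set_reg :: "reg \<Rightarrow> nat \<Rightarrow> state \<Rightarrow> state" where
  "set_reg r v s = s\<lparr>regs := (regs s)(r := v)\<rparr>"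

definition set_mem :: "arr \<Rightarrow> nat \<Rightarrow> nat \<Rightarrow> state \<Rightarrow> state" where
  "set_mem a i v s = s\<lparr>mem := (mem s)(a := (mem s a)(i := v))\<rparr>"

text \<open>Words are represented by the naturals below \<open>2 ^ w\<close>, and \<open>take_bit w x = x mod 2 ^ w\<close>.\<close>

context
  includes bit_operations_syntax
begin

fun eval_binop :: "nat \<Rightarrow> binop \<Rightarrow> nat \<Rightarrow> nat \<Rightarrow> nat" where
  "eval_binop w Add x y = take_bit w (x + y)"
| "eval_binop w Sub x y = take_bit w (x + 2 ^ w - y)"
| "eval_binop w Mul x y = take_bit w (x * y)"
| "eval_binop w Div x y = x div y"
| "eval_binop w Mod x y = x mod y"
| "eval_binop w Less x y = of_bool (x < y)"
| "eval_binop w Equal x y = of_bool (x = y)"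
| "eval_binop w And x y = x AND y"
| "eval_binop w Or x y = x OR y"
| "eval_binop w Xor x y = x XOR y"
| "eval_binop w ShiftL x y = take_bit w (push_bit y x)"
| "eval_binop w ShiftR x y = drop_bit y x"

end

text \<open>
  The distribution of the final state together with the number of steps. The mass missing
  from the subprobability distribution is the probability of non-termination.
\<close>

partial_function (spmf) exec :: "nat \<Rightarrow> com \<Rightarrow> state \<Rightarrow> (state \<times> nat) spmf" where
  "exec w c s = (case c of
      Const r v \<Rightarrow> return_spmf (set_reg r (take_bit w v) s, 1)
    | Binop f r x y \<Rightarrow> return_spmf (set_reg r (eval_binop w f (regs s x) (regs s y)) s, 1)
    | Load r a x \<Rightarrow> return_spmf (set_reg r (mem s a (regs s x)) s, 1)
    | Store a x y \<Rightarrow> return_spmf (set_mem a (regs s x) (regs s y) s, 1)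
    | Coin r \<Rightarrow> bind_spmf coin_spmf (\<lambda>b. return_spmf (set_reg r (of_bool b) s, 1))
    | Seq c1 c2 \<Rightarrow>
        bind_spmf (exec w c1 s) (\<lambda>(s1, t1).
        bind_spmf (exec w c2 s1) (\<lambda>(s2, t2). return_spmf (s2, t1 + t2)))
    | If r c1 c2 \<Rightarrow>
        bind_spmf (exec w (if regs s r \<noteq> 0 then c1 else c2) s)
          (\<lambda>(s1, t1). return_spmf (s1, t1 + 1))
    | While r c1 \<Rightarrow>
        if regs s r = 0 then return_spmf (s, 1)
        else
          bind_spmf (exec w c1 s) (\<lambda>(s1, t1).
          bind_spmf (exec w (While r c1) s1) (\<lambda>(s2, t2). return_spmf (s2, t1 + t2 + 1))))"

definition expected_steps :: "(state \<times> nat) spmf \<Rightarrow> ennreal" where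
  "expected_steps r =
     (if lossless_spmf r then \<integral>\<^sup>+ x. of_nat (snd x) \<partial>measure_spmf r else \<infinity>)"

text \<open>
  \<open>U (l, i, j)\<close> is entry \<open>j\<close> of row \<open>i\<close> of the matrix \<open>l\<close>. All three indices
  count from 0, so \<open>l < k\<close>, \<open>i < n\<close> and \<open>j < d\<close>.
\<close>

type_synonym ov_instance = "nat \<times> nat \<times> nat \<Rightarrow> bool"

text \<open>The rounding has no effect if \<open>\<alpha> n * log 2 n\<close> is an integer.\<close>

definition ov_dim :: "(nat \<Rightarrow> real) \<Rightarrow> nat \<Rightarrow> nat" where
  "ov_dim \<alpha> n = nat \<lceil>\<alpha> n * log 2 (real n)\<rceil>"

definition ov_prob :: "nat \<Rightarrow> (nat \<Rightarrow> real) \<Rightarrow> nat \<Rightarrow> real" where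
  "ov_prob k \<alpha> n = (1 - 2 powr (- (2 * real k / \<alpha> n))) powr (1 / real k)"

definition orthogonal_rows :: "nat \<Rightarrow> nat \<Rightarrow> ov_instance \<Rightarrow> (nat \<Rightarrow> nat) \<Rightarrow> bool" where
  "orthogonal_rows k d U s \<longleftrightarrow>
     (\<forall>j<d. (\<Prod>l<k. of_bool (U (l, s l, j))) = (0 :: nat))"

definition model_dist :: "nat \<Rightarrow> (nat \<Rightarrow> real) \<Rightarrow> nat \<Rightarrow> ov_instance pmf" where
  "model_dist k \<alpha> n =
     Pi_pmf ({..<k} \<times> {..<n} \<times> {..<ov_dim \<alpha> n}) False (\<lambda>_. bernoulli_pmf (ov_prob k \<alpha> n))"

text \<open>\<open>F j\<close> says whether coordinate \<open>j\<close> of the row \<open>s (k - 1)\<close> of the last matrix is flipped.\<close>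

definition plant :: "nat \<Rightarrow> nat \<Rightarrow> real \<Rightarrow> ov_instance \<Rightarrow> (nat \<Rightarrow> nat) \<Rightarrow> ov_instance pmf" where
  "plant k d p U s =
     map_pmf
       (\<lambda>F (l, i, j).
          if l = k - 1 \<and> i = s (k - 1) \<and> j < d \<and> F j then \<not> U (l, i, j) else U (l, i, j))
       (Pi_pmf {..<d} False (\<lambda>j.
          let m = card {l \<in> {..<k}. U (l, s l, j)}
          in if even (k - m) then bernoulli_pmf ((p / (1 - p)) ^ (k - m)) else return_pmf False))"

definition planted_dist :: "nat \<Rightarrow> (nat \<Rightarrow> real) \<Rightarrow> nat \<Rightarrow> ov_instance pmf" where
  "planted_dist k \<alpha> n =
     bind_pmf (model_dist k \<alpha> n) (\<lambda>U.
     bind_pmf (pmf_of_set ({..<k} \<rightarrow>\<^sub>E {..<n})) (\<lambda>s.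
     plant k (ov_dim \<alpha> n) (ov_prob k \<alpha> n) U s))"

definition ov_dist :: "nat \<Rightarrow> (nat \<Rightarrow> real) \<Rightarrow> nat \<Rightarrow> nat \<Rightarrow> ov_instance pmf" where
  "ov_dist k \<alpha> b n = (if b = 0 then model_dist k \<alpha> n else planted_dist k \<alpha> n)"

text \<open>
  \<open>floorlog 2 n\<close> is the length of the binary representation of \<open>n\<close>, so an algorithm with
  word-size factor \<open>c\<close> uses words of about \<open>c * log 2 n\<close> bits.
\<close>

definition word_size :: "nat \<Rightarrow> nat \<Rightarrow> nat" where
  "word_size c n = c * floorlog 2 n"

text \<open>
  Array \<open>l < k\<close> initially holds the matrix \<open>l\<close> in row-major order, one entry per word.
  Registers 0, 1 and 2 hold the parameters of the problem: \<open>n\<close>, \<open>d\<close>, and the first \<open>w\<close> binary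
  digits of \<open>p\<close>. Everything else is 0. No computability assumption on \<open>\<alpha>\<close> is made, so the
  parameters \<open>d\<close> and \<open>p\<close> cannot be computed from \<open>n\<close> and have to be given.
\<close>

definition input_state ::
  "nat \<Rightarrow> (nat \<Rightarrow> real) \<Rightarrow> nat \<Rightarrow> nat \<Rightarrow> ov_instance \<Rightarrow> state" where
  "input_state k \<alpha> w n U = (let d = ov_dim \<alpha> n in
     \<lparr>regs = (\<lambda>_. 0)(0 := n, 1 := d, 2 := nat \<lfloor>ov_prob k \<alpha> n * 2 ^ w\<rfloor>),
      mem = (\<lambda>l x. of_bool (l < k \<and> x < n * d \<and> U (l, x div d, x mod d)))\<rparr>)"

definition run_ov ::
  "nat \<Rightarrow> (nat \<Rightarrow> real) \<Rightarrow> com \<Rightarrow> nat \<Rightarrow> nat \<Rightarrow> ov_instance \<Rightarrow> (state \<times> nat) spmf" where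
  "run_ov k \<alpha> A c n U =
     exec (word_size c n) A (input_state k \<alpha> (word_size c n) n U)"

text \<open>
  The output bit is the final content of register 0; the output tuple is the final content of
  the registers \<open>0, \<dots>, k - 1\<close>.
\<close>

definition solves_decision ::
  "nat \<Rightarrow> (nat \<Rightarrow> real) \<Rightarrow> com \<Rightarrow> nat \<Rightarrow> (nat \<Rightarrow> real) \<Rightarrow> bool" where
  "solves_decision k \<alpha> A c \<sigma> \<longleftrightarrow>
     (\<forall>b\<in>{0, 1}. \<forall>\<^sub>F n in sequentially.
        measure (measure_spmf
          (bind_spmf (spmf_of_pmf (ov_dist k \<alpha> b n)) (run_ov k \<alpha> A c n)))
          {(s, t). regs s 0 = b} \<ge> \<sigma> n)"

definition solves_search ::
  "nat \<Rightarrow> (nat \<Rightarrow> real) \<Rightarrow> com \<Rightarrow> nat \<Rightarrow> (nat \<Rightarrow> real) \<Rightarrow> bool" where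
  "solves_search k \<alpha> A c \<sigma> \<longleftrightarrow>
     (\<forall>\<^sub>F n in sequentially.
        measure (measure_spmf
          (bind_spmf (spmf_of_pmf (ov_dist k \<alpha> 1 n)) (\<lambda>U.
             map_spmf (\<lambda>(s, t). (U, s)) (run_ov k \<alpha> A c n U))))
          {(U, s). (\<forall>l<k. regs s l < n) \<and> orthogonal_rows k (ov_dim \<alpha> n) U (regs s)} \<ge> \<sigma> n)"

definition runs_in_time ::
  "nat \<Rightarrow> (nat \<Rightarrow> real) \<Rightarrow> com \<Rightarrow> nat \<Rightarrow> (nat \<Rightarrow> real) \<Rightarrow> bool" where
  "runs_in_time k \<alpha> A c T \<longleftrightarrow>
     (\<forall>\<^sub>F n in sequentially. \<forall>U.
        lossless_spmf (run_ov k \<alpha> A c n U) \<and>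
        (\<forall>(s, t) \<in> set_spmf (run_ov k \<alpha> A c n U). real t \<le> T n))"

definition runs_in_expected_time ::
  "nat \<Rightarrow> (nat \<Rightarrow> real) \<Rightarrow> com \<Rightarrow> nat \<Rightarrow> (nat \<Rightarrow> real) \<Rightarrow> bool" where
  "runs_in_expected_time k \<alpha> A c T \<longleftrightarrow>
     (\<forall>\<^sub>F n in sequentially. \<forall>U.
        expected_steps (run_ov k \<alpha> A c n U) \<le> ennreal (T n))"

definition polylog :: "(nat \<Rightarrow> real) \<Rightarrow> bool" where
  "polylog f \<longleftrightarrow> (\<exists>e :: nat. f \<in> O(\<lambda>n. log 2 (real n) ^ e))"

end

theory Submission
  imports Defs "HOL-Real_Asymp.Real_Asymp"
begin

text \<open>
  Planting changes the mass of a column with m ones by plus or minus \<open>p ^ k\<close>, the sign depending on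
  the parity of \<open>k - m\<close>, so any \<open>k - 1\<close> of the planted rows are distributed as in the model. Resample
  a random set S of rows of the matrix l of a planted instance. If S contains the planted row, the
  result follows the model distribution, otherwise the planted one; either way a decider tells with
  error at most \<open>\<delta>\<close>, on average over instances, whether the planted row belongs to S. By Markov's
  inequality the error given the instance exceeds \<open>1/13\<close> with probability at most \<open>13 * \<delta>\<close>; otherwise
  the planted row is, after order of log n rounds, the only one that agrees with at least 3/4 of
  the answers, up to a failure probability that is polynomially small by an exponential moment bound.

  The search runs with larger words than the decider, since the entries have to be sampled from
  sufficiently many digits of p.
\<close>

subsection \<open>Refinement of programs by probability distributions\<close>

text \<open>The constants fit together as follows. Given a good instance, the planted row disagrees
  with the answer with probability below 1/13, plus 1/50 because entries are drawn with a truncated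
  p; the sum is below 1/10, so this row agrees with probability at least 9/10. Any other row agrees
  only if the answer is wrong or if its membership in S coincides with that of the planted row,
  which has probability 1/2; this gives at most 1/10 + 1/2 = 3/5, and 3/4 separates the two.
  Markov's inequality is used for each of the k matrices, hence 13 * k * \<delta>.

  All rounds share one instance, so they are independent only given that instance. This is why the
  average error is first turned into an error given the instance and only then amplified.

  The decider is correct only for its own word size and only when started from a clean memory, and
  that memory may have far more cells than a round has steps. Hence the masking of words and the
  time stamps.\<close>

lemma exec_basic [simp]:
  "exec w (Const r v) s = return_spmf (set_reg r (take_bit w v) s, 1)"
  "exec w (Binop f r x y) s = return_spmf (set_reg r (eval_binop w f (regs s x) (regs s y)) s, 1)"
  "exec w (Load r a x) s = return_spmf (set_reg r (mem s a (regs s x)) s, 1)"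
  "exec w (Store a x y) s = return_spmf (set_mem a (regs s x) (regs s y) s, 1)"
  "exec w (Coin r) s = bind_spmf coin_spmf (\<lambda>b. return_spmf (set_reg r (of_bool b) s, 1))"
  by (subst exec.simps; simp)+

lemma exec_Seq:
  "exec w (Seq c1 c2) s =
     bind_spmf (exec w c1 s) (\<lambda>(s1, t1).
     bind_spmf (exec w c2 s1) (\<lambda>(s2, t2). return_spmf (s2, t1 + t2)))"
  by (subst exec.simps) simp

lemma exec_If:
  "exec w (If r c1 c2) s =
     bind_spmf (exec w (if regs s r \<noteq> 0 then c1 else c2) s)
       (\<lambda>(s1, t1). return_spmf (s1, t1 + 1))"
  by (subst exec.simps) simp

lemma exec_While:
  "exec w (While r c) s =
     (if regs s r = 0 then return_spmf (s, 1)
      else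
        bind_spmf (exec w c s) (\<lambda>(s1, t1).
        bind_spmf (exec w (While r c) s1) (\<lambda>(s2, t2). return_spmf (s2, t1 + t2 + 1))))"
  by (subst exec.simps) simp

lemma regs_set_reg [simp]: "regs (set_reg r v s) = (regs s)(r := v)"
  and mem_set_reg [simp]: "mem (set_reg r v s) = mem s"
  and regs_set_mem [simp]: "regs (set_mem a i v s) = regs s"
  and mem_set_mem [simp]: "mem (set_mem a i v s) = (mem s)(a := (mem s a)(i := v))"
  by (simp_all add: set_reg_def set_mem_def)

text \<open>A coupling of the run with a distribution \<open>D\<close>, where \<open>Q\<close>
  relates the final state, the number of steps and the abstract outcome. As \<open>D\<close> has
  mass 1, the coupling also forces termination with probability one, and a bound on the steps inside
  \<open>Q\<close> is a worst-case bound.\<close>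

definition refines ::
  "nat \<Rightarrow> com \<Rightarrow> state \<Rightarrow> 'x pmf \<Rightarrow> (state \<Rightarrow> nat \<Rightarrow> 'x \<Rightarrow> bool) \<Rightarrow> bool" where
  "refines w c s D Q \<longleftrightarrow> rel_spmf (\<lambda>(s', t) x. Q s' t x) (exec w c s) (spmf_of_pmf D)"

lemma refines_mono:
  assumes "refines w c s D Q" and "\<And>s' t x. Q s' t x \<Longrightarrow> Q' s' t x"
  shows "refines w c s D Q'"
  using assms unfolding refines_def by (auto elim!: rel_spmf_mono)

lemma refines_Seq:
  assumes "refines w c1 s D1 Q1"
    and "\<And>s1 t1 x1. Q1 s1 t1 x1 \<Longrightarrow> refines w c2 s1 (D2 x1) (\<lambda>s2 t2 x2. Q s2 (t1 + t2) x2)"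
  shows "refines w (Seq c1 c2) s (bind_pmf D1 D2) Q"
  unfolding refines_def exec_Seq spmf_of_pmf_bind bind_spmf_of_pmf[symmetric]
proof (rule rel_spmf_bindI[OF assms(1)[unfolded refines_def]])
  fix x y assume *: "(case x of (s', t) \<Rightarrow> Q1 s' t) y"
  obtain s1 t1 where x: "x = (s1, t1)" by (cases x)
  have "rel_spmf (\<lambda>(s2, t2) x2. Q s2 (t1 + t2) x2) (exec w c2 s1) (spmf_of_pmf (D2 y))"
    using assms(2)[of s1 t1 y] * unfolding x refines_def by simp
  then show "rel_spmf (\<lambda>(s', t) x. Q s' t x) (case x of (s1, t1) \<Rightarrow>
      bind_spmf (exec w c2 s1) (\<lambda>(s2, t2). return_spmf (s2, t1 + t2))) (spmf_of_pmf (D2 y))"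
    unfolding x
    by (simp add: case_prod_unfold bind_spmf_const map_spmf_conv_bind_spmf[symmetric] spmf_rel_map)
qed

lemma refines_Seq_eq:
  assumes "D = bind_pmf D1 D2" and "refines w c1 s D1 Q1"
    and "\<And>s1 t1 x1. Q1 s1 t1 x1 \<Longrightarrow> refines w c2 s1 (D2 x1) (\<lambda>s2 t2 x2. Q s2 (t1 + t2) x2)"
  shows "refines w (Seq c1 c2) s D Q"
  using refines_Seq[OF assms(2,3)] assms(1) by simp

lemma refines_Seq_return:
  assumes "refines w c1 s (return_pmf ()) Q1"
    and "\<And>s1 t1. Q1 s1 t1 () \<Longrightarrow> refines w c2 s1 D (\<lambda>s2 t2 x2. Q s2 (t1 + t2) x2)"
  shows "refines w (Seq c1 c2) s D Q"
  by (rule refines_Seq_eq[OF _ assms(1), of _ "\<lambda>_. D"]) (auto simp: bind_return_pmf assms(2))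

text \<open>Elapsed steps move into the postcondition, so that straight-line code can be executed
  symbolically by rewriting.\<close>

lemma refines_det:
  assumes "exec w c1 s = return_spmf (s1, t1)"
  shows "refines w (Seq c1 c2) s D Q \<longleftrightarrow> refines w c2 s1 D (\<lambda>s' t x. Q s' (t1 + t) x)"
  unfolding refines_def exec_Seq assms
  by (simp add: case_prod_unfold map_spmf_conv_bind_spmf[symmetric] spmf_rel_map)

lemma refines_Seq_basic [simp]:
  "refines w (Seq (Const r v) c) s D Q \<longleftrightarrow>
     refines w c (set_reg r (take_bit w v) s) D (\<lambda>s' t. Q s' (Suc t))"
  "refines w (Seq (Binop f r x y) c) s D Q \<longleftrightarrow>
     refines w c (set_reg r (eval_binop w f (regs s x) (regs s y)) s) D (\<lambda>s' t. Q s' (Suc t))"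
  "refines w (Seq (Load r a x) c) s D Q \<longleftrightarrow>
     refines w c (set_reg r (mem s a (regs s x)) s) D (\<lambda>s' t. Q s' (Suc t))"
  "refines w (Seq (Store a x y) c) s D Q \<longleftrightarrow>
     refines w c (set_mem a (regs s x) (regs s y) s) D (\<lambda>s' t. Q s' (Suc t))"
  by (subst refines_det, rule exec_basic, simp)+

lemma refines_basic [simp]:
  "refines w (Const r v) s D Q \<longleftrightarrow>
     (\<forall>x\<in>set_pmf D. Q (set_reg r (take_bit w v) s) 1 x)"
  "refines w (Binop f r x y) s D Q \<longleftrightarrow>
     (\<forall>z\<in>set_pmf D. Q (set_reg r (eval_binop w f (regs s x) (regs s y)) s) 1 z)"
  "refines w (Load r a x) s D Q \<longleftrightarrow>
     (\<forall>z\<in>set_pmf D. Q (set_reg r (mem s a (regs s x)) s) 1 z)"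
  "refines w (Store a x y) s D Q \<longleftrightarrow>
     (\<forall>z\<in>set_pmf D. Q (set_mem a (regs s x) (regs s y) s) 1 z)"
  by (simp_all add: refines_def rel_spmf_return_spmf1)

text \<open>Reassociation to the right brings the next instruction to the head, where the rules for
  single instructions apply.\<close>

lemma refines_Seq_assoc [simp]:
  "refines w (Seq (Seq c1 c2) c3) s D Q \<longleftrightarrow> refines w (Seq c1 (Seq c2 c3)) s D Q"
  unfolding refines_def exec_Seq by (simp add: case_prod_unfold add.assoc)

lemma refines_If:
  "refines w (If r c1 c2) s D Q \<longleftrightarrow>
     refines w (if regs s r \<noteq> 0 then c1 else c2) s D (\<lambda>s' t. Q s' (Suc t))"
  unfolding refines_def exec_If
  by (simp add: case_prod_unfold map_spmf_conv_bind_spmf[symmetric] spmf_rel_map)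

lemma refines_Seq_If:
  "refines w (Seq (If r c1 c2) c) s D Q \<longleftrightarrow>
     refines w (Seq (if regs s r \<noteq> 0 then c1 else c2) c) s D (\<lambda>s' t. Q s' (Suc t))"
proof -
  have "exec w (Seq (If r c1 c2) c) s =
      map_spmf (\<lambda>(s', t). (s', Suc t)) (exec w (Seq (if regs s r \<noteq> 0 then c1 else c2) c) s)"
    unfolding exec_Seq exec_If
    by (simp add: map_spmf_bind_spmf case_prod_unfold o_def)
  then show ?thesis
    by (simp add: refines_def spmf_rel_map case_prod_unfold)
qed

text \<open>A coupling with a point mass carries no information about the abstract value. A
  deterministic program verified with outcome \<open>()\<close> may therefore be given any
  outcome.\<close>

lemma refines_return:
  "refines w c s (return_pmf x) Q \<longleftrightarrow> refines w c s (return_pmf y) (\<lambda>s' t _. Q s' t x)"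
  unfolding refines_def by (simp add: rel_spmf_return_spmf2 split_beta)

lemma refines_map_pmf:
  "refines w c s (map_pmf f D) Q \<longleftrightarrow> refines w c s D (\<lambda>s' t x. Q s' t (f x))"
  unfolding refines_def by (simp add: spmf_rel_map case_prod_unfold flip: map_spmf_of_pmf)

lemma refines_Coin:
  assumes "\<And>b. Q (set_reg r (of_bool b) s) 1 b"
  shows "refines w (Coin r) s (bernoulli_pmf (1/2)) Q"
proof -
  have coin: "coin_spmf = spmf_of_pmf (bernoulli_pmf (1/2))"
    by (simp add: bernoulli_pmf_half_conv_pmf_of_set)
  show ?thesis
    unfolding refines_def exec_basic coin
    by (simp add: map_spmf_conv_bind_spmf[symmetric] pmf.rel_map assms[simplified] rel_pmf_reflI)
qed

lemma refines_Seq_Coin: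
  assumes "D = bind_pmf (bernoulli_pmf (1/2)) D2"
    and "\<And>b. refines w c (set_reg r (of_bool b) s) (D2 b) (\<lambda>s' t. Q s' (Suc t))"
  shows "refines w (Seq (Coin r) c) s D Q"
  by (rule refines_Seq_eq[OF assms(1)
        refines_Coin[of "\<lambda>s' t b. s' = set_reg r (of_bool b) s \<and> t = 1"]])
     (use assms(2) in auto)

text \<open>Register 3 holds the constant 1. The decrement precedes the body, so the body sees N -
  1, ..., 0, exactly the indices of an array of length N.\<close>

definition downto0 :: "reg \<Rightarrow> com \<Rightarrow> com" where
  "downto0 r c = While r (Seq (Binop Sub r r 3) c)"

primrec iterate :: "(nat \<Rightarrow> 'x \<Rightarrow> 'x pmf) \<Rightarrow> nat \<Rightarrow> 'x \<Rightarrow> 'x pmf" where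
  "iterate f 0 x = return_pmf x"
| "iterate f (Suc j) x = bind_pmf (f j x) (iterate f j)"

lemma refines_While_0:
  assumes "regs s r = 0" "Q s 1 x"
  shows "refines w (While r c) s (return_pmf x) Q"
  unfolding refines_def by (subst exec_While) (use assms in simp)

lemma refines_While_Suc:
  assumes "regs s r \<noteq> 0"
    and "refines w (Seq c (While r c)) s D (\<lambda>s' t. Q s' (Suc t))"
  shows "refines w (While r c) s D Q"
proof -
  have "exec w (While r c) s = map_spmf (\<lambda>(s', t). (s', Suc t)) (exec w (Seq c (While r c)) s)"
    unfolding exec_Seq using assms(1)
    by (subst exec_While) (simp add: map_spmf_bind_spmf case_prod_unfold o_def)
  then show ?thesis using assms(2) unfolding refines_def
    by (simp add: spmf_rel_map case_prod_unfold)
qed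

text \<open>\<open>I j\<close> is the invariant when \<open>j\<close> iterations remain. Each
  iteration pays for the guard, the decrement and at most \<open>B\<close> steps of the body; the
  failing guard at the end contributes the summand 1.\<close>

lemma refines_downto0:
  assumes body: "\<And>j s x. j < N \<Longrightarrow> I (Suc j) s x \<Longrightarrow> regs s r = Suc j \<Longrightarrow> regs s 3 = 1 \<Longrightarrow>
       refines w c (set_reg r j s) (f j x)
         (\<lambda>s' t x'. I j s' x' \<and> regs s' r = j \<and> regs s' 3 = 1 \<and> t \<le> B)"
    and "N < 2 ^ w" "I N s x" "regs s r = N" "regs s 3 = 1"
  shows "refines w (downto0 r c) s (iterate f N x)
     (\<lambda>s' t x'. I 0 s' x' \<and> regs s' r = 0 \<and> regs s' 3 = 1 \<and> t \<le> N * (B + 2) + 1)"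
proof -
  have "M \<le> N \<Longrightarrow> I M s x \<Longrightarrow> regs s r = M \<Longrightarrow> regs s 3 = 1 \<Longrightarrow>
    refines w (downto0 r c) s (iterate f M x)
     (\<lambda>s' t x'. I 0 s' x' \<and> regs s' r = 0 \<and> regs s' 3 = 1 \<and> t \<le> M * (B + 2) + 1)" for M
  proof (induction M arbitrary: s x)
    case 0
    then show ?case by (simp add: downto0_def refines_While_0)
  next
    case (Suc j)
    have sub: "eval_binop w Sub (Suc j) (Suc 0) = j"
      using Suc.prems(1) \<open>N < 2 ^ w\<close> by (simp add: take_bit_nat_def)
    have "refines w (Seq c (downto0 r c)) (set_reg r j s) (iterate f (Suc j) x)
       (\<lambda>s' t x'. I 0 s' x' \<and> regs s' r = 0 \<and> regs s' 3 = 1 \<and> Suc (Suc t) \<le> Suc j * (B + 2) + 1)"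
      unfolding iterate.simps
    proof (rule refines_Seq[OF body])
      fix s1 t1 x1
      assume *: "I j s1 x1 \<and> regs s1 r = j \<and> regs s1 3 = 1 \<and> t1 \<le> B"
      then show "refines w (downto0 r c) s1 (iterate f j x1)
          (\<lambda>s2 t2 x2. I 0 s2 x2 \<and> regs s2 r = 0 \<and> regs s2 3 = 1 \<and>
             Suc (Suc (t1 + t2)) \<le> Suc j * (B + 2) + 1)"
        using Suc.prems(1) by (intro refines_mono[OF Suc.IH]) simp_all
    qed (use Suc.prems in simp_all)
    then show ?case unfolding downto0_def
      using Suc.prems(2-) sub by (intro refines_While_Suc) simp_all
  qed
  from this[of N] assms(3-) show ?thesis by simp
qed

subsection \<open>Simulation with a larger word size\<close>

text \<open>A bound on these registers tells how many have to be cleared before the decider is run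
  again.\<close>

primrec regs_of :: "com \<Rightarrow> reg set" where
  "regs_of (Const r v) = {r}"
| "regs_of (Binop f r x y) = {r, x, y}"
| "regs_of (Load r a x) = {r, x}"
| "regs_of (Store a x y) = {x, y}"
| "regs_of (Coin r) = {r}"
| "regs_of (Seq c1 c2) = regs_of c1 \<union> regs_of c2"
| "regs_of (If r c1 c2) = insert r (regs_of c1 \<union> regs_of c2)"
| "regs_of (While r c) = insert r (regs_of c)"

lemma finite_regs_of: "finite (regs_of c)"
  by (induction c) auto

text \<open>
  Register 6 holds the bit mask of the smaller word size. Cell \<open>x\<close> of array \<open>a\<close> is valid only if its
  time stamp, in array \<open>ao + 2 * a + 1\<close>, equals register 10, and counts as 0 otherwise. Increasing
  register 10 thus erases the whole memory of the simulated program in one step.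
\<close>

primrec embed :: "nat \<Rightarrow> nat \<Rightarrow> com \<Rightarrow> com" where
  "embed ro ao (Const r v) = Seq (Const (ro + r) v) (Binop And (ro + r) (ro + r) 6)"
| "embed ro ao (Binop f r x y) =
     Seq (Binop f (ro + r) (ro + x) (ro + y)) (Binop And (ro + r) (ro + r) 6)"
| "embed ro ao (Load r a x) =
     Seq (Load 18 (ao + 2 * a + 1) (ro + x))
       (Seq (Binop Equal 18 18 10)
         (If 18 (Load (ro + r) (ao + 2 * a) (ro + x)) (Const (ro + r) 0)))"
| "embed ro ao (Store a x y) =
     Seq (Store (ao + 2 * a) (ro + x) (ro + y)) (Store (ao + 2 * a + 1) (ro + x) 10)"
| "embed ro ao (Coin r) = Coin (ro + r)"
| "embed ro ao (Seq c1 c2) = Seq (embed ro ao c1) (embed ro ao c2)"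
| "embed ro ao (If r c1 c2) = If (ro + r) (embed ro ao c1) (embed ro ao c2)"
| "embed ro ao (While r c) = While (ro + r) (embed ro ao c)"

definition stamped :: "nat \<Rightarrow> nat \<Rightarrow> state \<Rightarrow> arr \<Rightarrow> nat \<Rightarrow> nat" where
  "stamped ao \<tau> s a x = (if mem s (ao + 2 * a + 1) x = \<tau> then mem s (ao + 2 * a) x else 0)"

lemma stamped_cong: "mem s' = mem s \<Longrightarrow> stamped ao \<tau> s' = stamped ao \<tau> s"
  by (simp add: stamped_def fun_eq_iff)

text \<open>\<open>\<sigma>\<close> is the state of the host at the call: outside its own registers
  and arrays, the embedded program touches only the scratch register 18. Words below
  \<open>2 ^ w0\<close> are what the masking argument needs; stamps not exceeding register 10 are
  what the next erasure needs.\<close>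

definition simulates ::
  "nat \<Rightarrow> nat \<Rightarrow> nat \<Rightarrow> nat \<Rightarrow> state \<Rightarrow> state \<Rightarrow> state \<Rightarrow> bool" where
  "simulates R ro ao w0 \<sigma> s s' \<longleftrightarrow>
     (\<forall>r<R. regs s' (ro + r) = regs s r \<and> regs s r < 2 ^ w0) \<and>
     stamped ao (regs \<sigma> 10) s' = mem s \<and> (\<forall>a x. mem s a x < 2 ^ w0) \<and>
     (\<forall>a x. mem s' (ao + 2 * a + 1) x \<le> regs \<sigma> 10) \<and>
     (\<forall>r<ro. r \<noteq> 18 \<longrightarrow> regs s' r = regs \<sigma> r) \<and>
     (\<forall>a<ao. mem s' a = mem \<sigma> a)"

text \<open>Sums, products and left shifts are compatible with reduction modulo
  \<open>2 ^ w0\<close>, and so is the difference because \<open>2 ^ w\<close> is a multiple of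
  \<open>2 ^ w0\<close>. The other operations stay below \<open>2 ^ w0\<close> on operands that
  do.\<close>

lemma take_bit_eval_binop:
  assumes "w0 \<le> w" "x < 2 ^ w0" "y < 2 ^ w0" "0 < w0"
  shows "take_bit w0 (eval_binop w f x y) = eval_binop w0 f x y"
proof (cases f)
  case Sub
  have "(2::nat) ^ w = 2 ^ w0 * 2 ^ (w - w0)"
    using assms(1) by (simp flip: power_add)
  moreover have "(1::nat) \<le> 2 ^ (w - w0)" by simp
  ultimately have "x + 2 ^ w - y = (x + 2 ^ w0 - y) + 2 ^ w0 * (2 ^ (w - w0) - 1)"
    using assms(2,3) by (simp add: diff_mult_distrib2)
  then have "take_bit w0 (x + 2 ^ w - y) = take_bit w0 (x + 2 ^ w0 - y)"
    by (simp add: take_bit_eq_mod)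
  then show ?thesis using Sub assms(1) by (simp add: min_def)
qed (use assms one_less_power[of "2::nat" w0] le_less_trans[OF div_le_dividend, of x "2 ^ w0"]
     in \<open>auto simp: take_bit_nat_eq_self_iff take_bit_nat_eq_self drop_bit_eq_div
       min_def le_less_trans[OF mod_less_eq_dividend, of x "2 ^ w0"]
       of_bool_def\<close>)

lemma eval_binop_And_mask:
  assumes "w0 \<le> w" "x < 2 ^ w0" "y < 2 ^ w0" "0 < w0"
  shows "eval_binop w And (eval_binop w f x y) (2 ^ w0 - 1) = eval_binop w0 f x y"
  using take_bit_eval_binop[OF assms, of f] by (simp add: take_bit_eq_mask mask_eq_exp_minus_1)

lemma eval_binop_less: "0 < w0 \<Longrightarrow> x < 2 ^ w0 \<Longrightarrow> y < 2 ^ w0 \<Longrightarrow> eval_binop w0 f x y < 2 ^ w0"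
  using take_bit_eval_binop[OF order.refl, of x w0 y f] take_bit_nat_less_exp by metis

lemma simulates_reg:
  "simulates R ro ao w0 \<sigma> s s' \<Longrightarrow> r < R \<Longrightarrow> regs s' (ro + r) = regs s r"
  "simulates R ro ao w0 \<sigma> s s' \<Longrightarrow> r < R \<Longrightarrow> regs s r < 2 ^ w0"
  "simulates R ro ao w0 \<sigma> s s' \<Longrightarrow> r < ro \<Longrightarrow> r \<noteq> 18 \<Longrightarrow> regs s' r = regs \<sigma> r"
  by (auto simp: simulates_def)

text \<open>Contents and stamps alternate in parity, so an update of one array of the simulated
  program cannot hit the stamps or contents of another.\<close>

lemma stamped_set_mem:
  "stamped ao \<tau> (set_mem (ao + 2 * a + 1) i \<tau> (set_mem (ao + 2 * a) i v s)) =
    (stamped ao \<tau> s)(a := (stamped ao \<tau> s a)(i := v))"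
proof -
  have "Suc (2 * a) \<noteq> 2 * b" "2 * b \<noteq> Suc (2 * a)" for b :: nat by presburger+
  then show ?thesis by (auto simp: stamped_def fun_eq_iff)
qed

lemma simulates_set_reg:
  assumes "simulates R ro ao w0 \<sigma> s s'" "r < R" "v < 2 ^ w0"
    and "\<forall>i. i \<noteq> 18 \<and> i \<noteq> ro + r \<longrightarrow> regs s'' i = regs s' i" "ro \<ge> 19"
    "regs s'' (ro + r) = v" "mem s'' = mem s'"
  shows "simulates R ro ao w0 \<sigma> (set_reg r v s) s''"
proof -
  have "stamped ao \<tau> s'' = stamped ao \<tau> s'" for \<tau>
    using assms(7) by (simp add: stamped_def fun_eq_iff)
  then show ?thesis using assms unfolding simulates_def by auto
qed

lemma simulates_set_mem:
  assumes "simulates R ro ao w0 \<sigma> s s'" "v < 2 ^ w0"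
  shows "simulates R ro ao w0 \<sigma> (set_mem a i v s)
    (set_mem (ao + 2 * a + 1) i (regs \<sigma> 10) (set_mem (ao + 2 * a) i v s'))"
proof -
  have "Suc (2 * a) \<noteq> 2 * b" "2 * b \<noteq> Suc (2 * a)" for b :: nat by presburger+
  then show ?thesis using assms unfolding simulates_def stamped_set_mem by auto
qed

lemma exec_Seq_return:
  assumes "exec w c1 s = return_spmf (s1, t1)"
  shows "exec w (Seq c1 c2) s = map_spmf (\<lambda>(s2, t2). (s2, t1 + t2)) (exec w c2 s1)"
  unfolding exec_Seq assms by (simp add: map_spmf_conv_bind_spmf case_prod_unfold)

lemma lossless_spmf_nonempty: "lossless_spmf p \<Longrightarrow> \<exists>x. x \<in> set_spmf p"
  using set_pmf_not_empty by (fastforce simp: lossless_spmf_conv_spmf_of_pmf)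

text \<open>The outer induction is on the time bound \<open>T\<close>, which handles loops; the
  inner one is on the program. The factor 4 is attained by a load: fetch the stamp, compare it, test
  the result, fetch the content.\<close>

lemma exec_embed:
  assumes "0 < w0" "w0 \<le> w" "19 \<le> ro" "regs \<sigma> 6 = 2 ^ w0 - 1"
    and "simulates R ro ao w0 \<sigma> s s'" "regs_of c \<subseteq> {..<R}"
    and "lossless_spmf (exec w0 c s)" "\<forall>(s1, t)\<in>set_spmf (exec w0 c s). t \<le> T"
  shows "rel_spmf (\<lambda>(s1, t) (s1', t'). simulates R ro ao w0 \<sigma> s1 s1' \<and> t' \<le> 4 * t)
     (exec w0 c s) (exec w (embed ro ao c) s')"
  using assms(5-)
proof (induction T arbitrary: c s s' rule: less_induct)
  case (less T)
  show ?case using less.prems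
  proof (induction c arbitrary: s s')
    case (Const r v)
    have "eval_binop w And (take_bit w v) (2 ^ w0 - 1) = take_bit w0 (take_bit w v)"
      by (simp add: take_bit_eq_mask mask_eq_exp_minus_1)
    also have "\<dots> = take_bit w0 v"
      using assms(2) by (simp add: min_def)
    finally have "eval_binop w And (take_bit w v) (2 ^ w0 - 1) = take_bit w0 v" .
    then show ?case
      using Const.prems assms(3,4)
      by (auto simp: exec_Seq_return rel_spmf_return_spmf1 simulates_reg(3)
          intro!: simulates_set_reg)
  next
    case (Binop f r x y)
    have xy: "regs s x < 2 ^ w0" "regs s y < 2 ^ w0"
      "regs s' (ro + x) = regs s x" "regs s' (ro + y) = regs s y"
      using Binop.prems simulates_reg by auto
    have "eval_binop w And (eval_binop w f (regs s x) (regs s y)) (2 ^ w0 - 1) =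
        eval_binop w0 f (regs s x) (regs s y)"
      by (rule eval_binop_And_mask[OF assms(2) xy(1,2) assms(1)])
    then show ?case
      using Binop.prems assms(3,4) xy eval_binop_less[OF assms(1) xy(1,2), of f]
      by (auto simp: exec_Seq_return rel_spmf_return_spmf1 simulates_reg(3) simp del: eval_binop.simps
          intro!: simulates_set_reg)
  next
    case (Load r a x)
    have "regs s' (ro + x) = regs s x" "regs s' 10 = regs \<sigma> 10"
      and v: "stamped ao (regs \<sigma> 10) s' a (regs s x) = mem s a (regs s x)"
        "mem s a (regs s x) < 2 ^ w0"
      using Load.prems assms(3) by (auto simp: simulates_def)
    then show ?case
      using Load.prems assms(3)
      by (auto simp: exec_Seq_return exec_If rel_spmf_return_spmf1 stamped_def split: if_splits
          intro!: simulates_set_reg)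
  next
    case (Store a x y)
    have "regs s' (ro + x) = regs s x" "regs s' (ro + y) = regs s y" "regs s' 10 = regs \<sigma> 10"
      "regs s y < 2 ^ w0"
      using Store.prems assms(3) by (auto simp: simulates_def)
    then show ?case
      using Store.prems(1)
      by (auto simp: exec_Seq_return rel_spmf_return_spmf1
          simp del: One_nat_def intro!: simulates_set_mem)
  next
    case (Coin r)
    have "of_bool b < (2::nat) ^ w0" for b
      using assms(1) one_less_power[of "2::nat" w0] by (cases b) simp_all
    then show ?case using Coin.prems assms(3)
      by (auto simp: map_spmf_conv_bind_spmf[symmetric] spmf_rel_map
          intro!: rel_spmf_reflI simulates_set_reg)
  next
    case (Seq c1 c2)
    have lossless: "lossless_spmf (exec w0 c1 s)"
      "\<And>s1 t1. (s1, t1) \<in> set_spmf (exec w0 c1 s) \<Longrightarrow> lossless_spmf (exec w0 c2 s1)"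
      using Seq.prems(3) by (auto simp: exec_Seq split_beta)
    have time: "t1 + t2 \<le> T"
      if "(s1, t1) \<in> set_spmf (exec w0 c1 s)" "(s2, t2) \<in> set_spmf (exec w0 c2 s1)" for s1 t1 s2 t2
      using Seq.prems(4) that by (fastforce simp: exec_Seq set_bind_spmf)
    \<comment> \<open>Losslessness extends every run of \<open>c1\<close> by some run of
      \<open>c2\<close>, so the time bound for the sequence bounds \<open>c1\<close> alone.\<close>
    have "\<exists>x. x \<in> set_spmf (exec w0 c2 s1)" if "(s1, t1) \<in> set_spmf (exec w0 c1 s)" for s1 t1
      using lossless(2)[OF that] by (rule lossless_spmf_nonempty)
    then have time1: "\<forall>(s1, t1)\<in>set_spmf (exec w0 c1 s). t1 \<le> T"
      using time by fastforce
    have "rel_spmf (\<lambda>(s1, t) (s1', t'). simulates R ro ao w0 \<sigma> s1 s1' \<and> t' \<le> 4 * t)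
        (exec w0 c1 s) (exec w (embed ro ao c1) s')"
      using Seq.prems lossless time1 by (intro Seq.IH) auto
    then have 1: "rel_spmf (\<lambda>(s1, t) (s1', t'). simulates R ro ao w0 \<sigma> s1 s1' \<and> t' \<le> 4 * t
          \<and> (s1, t) \<in> set_spmf (exec w0 c1 s))
        (exec w0 c1 s) (exec w (embed ro ao c1) s')"
      by (rule rel_spmf_mono_strong) auto
    have 2: "rel_spmf (\<lambda>(s1, t) (s1', t'). simulates R ro ao w0 \<sigma> s1 s1' \<and> t' \<le> 4 * t)
        (exec w0 c2 s1) (exec w (embed ro ao c2) s1')"
      if "simulates R ro ao w0 \<sigma> s1 s1'" "(s1, t1) \<in> set_spmf (exec w0 c1 s)" for s1 t1 s1'
      using Seq.prems(2) lossless(2) time that by (intro Seq.IH) fastforce+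
    show ?case unfolding exec_Seq embed.simps
      by (rule rel_spmf_bindI[OF 1]) (auto intro!: rel_spmf_bindI[OF 2])
  next
    case (If r c1 c2)
    let ?c = "if regs s r \<noteq> 0 then c1 else c2"
    have "(if regs s' (ro + r) \<noteq> 0 then embed ro ao c1 else embed ro ao c2) = embed ro ao ?c"
      using If.prems(1,2) by (simp add: simulates_reg)
    moreover have "rel_spmf (\<lambda>(s1, t) (s1', t'). simulates R ro ao w0 \<sigma> s1 s1' \<and> t' \<le> 4 * t)
        (exec w0 ?c s) (exec w (embed ro ao ?c) s')"
    proof -
      have "exec w0 (If r c1 c2) s = map_spmf (\<lambda>(s1, t). (s1, t + 1)) (exec w0 ?c s)"
        unfolding exec_If by (simp add: map_spmf_conv_bind_spmf case_prod_unfold)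
      then have "lossless_spmf (exec w0 ?c s)" "\<forall>(s1, t)\<in>set_spmf (exec w0 ?c s). t \<le> T"
        using If.prems(3,4) by (auto simp: split_beta Suc_le_eq intro: less_imp_le)
      with If.prems(1,2) show ?thesis
        using If.IH(1)[OF If.prems(1)] If.IH(2)[OF If.prems(1)]
        by (cases "regs s r = 0") simp_all
    qed
    ultimately show ?case unfolding exec_If embed.simps
      by (auto intro!: rel_spmf_bindI)
  next
    case (While r c)
    have r: "regs s' (ro + r) = regs s r"
      using While.prems(1,2) by (simp add: simulates_reg)
    show ?case
    proof (cases "regs s r = 0")
      case True
      then show ?thesis using r While.prems(1)
        unfolding embed.simps by (subst (1 2) exec_While) simp
    next
      case False
      let ?W = "While r c"
      have eq: "exec w0 ?W s = bind_spmf (exec w0 c s) (\<lambda>(s1, t1).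
          bind_spmf (exec w0 ?W s1) (\<lambda>(s2, t2). return_spmf (s2, t1 + t2 + 1)))"
        using False by (subst exec_While) simp
      have eq': "exec w (embed ro ao ?W) s' = bind_spmf (exec w (embed ro ao c) s') (\<lambda>(s1, t1).
          bind_spmf (exec w (embed ro ao ?W) s1) (\<lambda>(s2, t2). return_spmf (s2, t1 + t2 + 1)))"
        using False r unfolding embed.simps by (subst exec_While) simp
      have lossless: "lossless_spmf (exec w0 c s)"
        "\<And>s1 t1. (s1, t1) \<in> set_spmf (exec w0 c s) \<Longrightarrow> lossless_spmf (exec w0 ?W s1)"
        using While.prems(3) by (auto simp: eq split_beta)
      have time: "t1 + t2 + 1 \<le> T"
        if "(s1, t1) \<in> set_spmf (exec w0 c s)" "(s2, t2) \<in> set_spmf (exec w0 ?W s1)" for s1 t1 s2 t2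
        using While.prems(4) that by (fastforce simp: eq set_bind_spmf)
      have "\<exists>x. x \<in> set_spmf (exec w0 ?W s1)" if "(s1, t1) \<in> set_spmf (exec w0 c s)" for s1 t1
        using lossless(2)[OF that] by (rule lossless_spmf_nonempty)
      then have time1: "\<forall>(s1, t1)\<in>set_spmf (exec w0 c s). t1 < T"
        using time by fastforce
      have "rel_spmf (\<lambda>(s1, t) (s1', t'). simulates R ro ao w0 \<sigma> s1 s1' \<and> t' \<le> 4 * t)
          (exec w0 c s) (exec w (embed ro ao c) s')"
        using While.prems lossless time1 by (intro While.IH) auto
      then have 1: "rel_spmf (\<lambda>(s1, t) (s1', t'). simulates R ro ao w0 \<sigma> s1 s1' \<and> t' \<le> 4 * t
            \<and> (s1, t) \<in> set_spmf (exec w0 c s))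
          (exec w0 c s) (exec w (embed ro ao c) s')"
        by (rule rel_spmf_mono_strong) auto
      have 2: "rel_spmf (\<lambda>(s1, t) (s1', t'). simulates R ro ao w0 \<sigma> s1 s1' \<and> t' \<le> 4 * t)
          (exec w0 ?W s1) (exec w (embed ro ao ?W) s1')"
        if "simulates R ro ao w0 \<sigma> s1 s1'" "(s1, t1) \<in> set_spmf (exec w0 c s)" for s1 t1 s1'
      \<comment> \<open>The remaining iterations are a run of the same program; what shrinks is the
        time budget, by \<open>t1\<close> and by the step of the guard.\<close>
      proof (rule less.IH[of "T - t1 - 1"])
        show "T - t1 - 1 < T" using time1 that(2) by fastforce
        show "\<forall>(s1, t)\<in>set_spmf (exec w0 ?W s1). t \<le> T - t1 - 1"
          using time[OF that(2)] by fastforce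
      qed (use While.prems(2) that lossless(2) in auto)
      show ?thesis unfolding eq eq'
        by (rule rel_spmf_bindI[OF 1]) (auto intro!: rel_spmf_bindI[OF 2[unfolded embed.simps]])
    qed
  qed
qed

subsection \<open>Loops and sampling\<close>

text \<open>Loops over the k matrices and over the registers of the decider have constant length and
  are unrolled in the program text. Clearing the scratch register 16 stands in for a skip
  instruction.\<close>

primrec seqs :: "(nat \<Rightarrow> com) \<Rightarrow> nat \<Rightarrow> com" where
  "seqs f 0 = Const 16 0"
| "seqs f (Suc i) = Seq (seqs f i) (f i)"

primrec iterate_up :: "(nat \<Rightarrow> 'x \<Rightarrow> 'x pmf) \<Rightarrow> nat \<Rightarrow> 'x \<Rightarrow> 'x pmf" where
  "iterate_up f 0 x = return_pmf x"
| "iterate_up f (Suc i) x = bind_pmf (iterate_up f i x) (f i)"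

lemma refines_seqs:
  assumes "I 0 (set_reg 16 0 s) x"
    and step: "\<And>i s x. i < N \<Longrightarrow> I i s x \<Longrightarrow>
       refines w (f i) s (g i x) (\<lambda>s' t x'. I (Suc i) s' x' \<and> t \<le> B)"
  shows "refines w (seqs f N) s (iterate_up g N x) (\<lambda>s' t x'. I N s' x' \<and> t \<le> N * B + 1)"
proof -
  have "M \<le> N \<Longrightarrow>
    refines w (seqs f M) s (iterate_up g M x) (\<lambda>s' t x'. I M s' x' \<and> t \<le> M * B + 1)" for M
  proof (induction M)
    case 0
    then show ?case using assms(1) by simp
  next
    case (Suc i)
    show ?case unfolding seqs.simps iterate_up.simps
    proof (rule refines_Seq[OF Suc.IH])
      fix s1 t1 x1
      assume *: "I i s1 x1 \<and> t1 \<le> i * B + 1"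
      show "refines w (f i) s1 (g i x1) (\<lambda>s2 t2 x2. I (Suc i) s2 x2 \<and> t1 + t2 \<le> Suc i * B + 1)"
        by (rule refines_mono[OF step]) (use * Suc.prems in auto)
    qed (use Suc.prems in simp)
  qed
  from this[of N] show ?thesis by simp
qed

lemma iterate_return [simp]: "iterate (\<lambda>_. return_pmf) j x = return_pmf x"
  by (induction j) (auto simp: bind_return_pmf)

lemma iterate_up_return [simp]: "iterate_up (\<lambda>_. return_pmf) j x = return_pmf x"
  by (induction j) (auto simp: bind_return_pmf)

section \<open>Bernoulli variables from fair coins\<close>

lemma prob_bind_pmf:
  "measure_pmf.prob (bind_pmf D K) X = measure_pmf.expectation D (\<lambda>x. measure_pmf.prob (K x) X)"
proof -
  have "measure_pmf.prob (bind_pmf D K) X = pmf (map_pmf (\<lambda>x. x \<in> X) (bind_pmf D K)) True"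
    by (simp add: pmf_map vimage_def)
  also have "\<dots> = measure_pmf.expectation D (\<lambda>x. measure_pmf.prob (K x) X)"
    by (simp add: map_bind_pmf pmf_bind pmf_map vimage_def)
  finally show ?thesis .
qed

lemma prob_bind_bernoulli:
  assumes "0 \<le> p" "p \<le> 1"
  shows "measure_pmf.prob (bind_pmf (bernoulli_pmf p) K) X =
    p * measure_pmf.prob (K True) X + (1 - p) * measure_pmf.prob (K False) X"
  unfolding prob_bind_pmf using assms
  by (subst integral_measure_pmf[of UNIV]) (auto simp: UNIV_bool)

lemma map_pmf_bool: "map_pmf f D = bernoulli_pmf (measure_pmf.prob D {x. f x})"
proof (rule pmf_eqI)
  fix b :: bool
  have "measure_pmf.prob D {x. \<not> f x} = 1 - measure_pmf.prob D {x. f x}"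
    using measure_pmf.prob_compl[of "{x. f x}" D] by (simp add: Collect_neg_eq Compl_eq_Diff_UNIV)
  then show "pmf (map_pmf f D) b = pmf (bernoulli_pmf (measure_pmf.prob D {x. f x})) b"
    by (cases b) (simp_all add: pmf_map vimage_def)
qed

definition append_bit :: "nat \<Rightarrow> nat \<Rightarrow> nat pmf" where
  "append_bit j x = map_pmf (\<lambda>b. 2 * x + of_bool b) (bernoulli_pmf (1/2))"

text \<open>After j more tosses the word is \<open>2 ^ j * x + u\<close> with u uniform below
  \<open>2 ^ j\<close>. The first toss is the leading digit of u and splits the count into its lower
  and upper half, which is why x has to be arbitrary in the induction.\<close>

lemma prob_iterate_append_bit:
  "measure_pmf.prob (iterate append_bit j x) {..<P} =
     card {u. u < 2 ^ j \<and> 2 ^ j * x + u < P} / 2 ^ j"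
proof (induction j arbitrary: x)
  case 0
  have "{u. u < 2 ^ 0 \<and> 2 ^ 0 * x + u < P} = (if x < P then {0} else {})" by auto
  then show ?case by simp
next
  case (Suc j)
  let ?A = "\<lambda>x. {u. u < 2 ^ j \<and> 2 ^ j * x + u < P}"
  have "{u. u < 2 ^ Suc j \<and> 2 ^ Suc j * x + u < P} =
      ?A (2 * x) \<union> (+) (2 ^ j) ` ?A (2 * x + 1)" (is "?L = ?B \<union> ?C")
  proof -
    have "u \<in> ?C \<longleftrightarrow> 2 ^ j \<le> u \<and> u < 2 ^ Suc j \<and> 2 ^ Suc j * x + u < P" for u
      by (auto simp: image_iff algebra_simps intro!: exI[of _ "u - 2 ^ j"])
    then show ?thesis by (auto simp: algebra_simps)
  qed
  moreover have "card (?B \<union> ?C) = card ?B + card ?C"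
    by (rule card_Un_disjoint) auto
  moreover have "card ?C = card (?A (2 * x + 1))"
    by (rule card_image) simp
  moreover have "iterate append_bit (Suc j) x =
      bind_pmf (bernoulli_pmf (1/2)) (\<lambda>b. iterate append_bit j (2 * x + of_bool b))"
    by (simp add: append_bit_def bind_map_pmf)
  ultimately show ?case
    by (simp add: prob_bind_bernoulli Suc.IH field_simps)
qed

text \<open>A uniform word of j digits lies below P with probability exactly
  \<open>P / 2 ^ j\<close>, so the only deviation from p comes from rounding p to that many
  digits.\<close>

lemma bernoulli_iterate_append_bit:
  assumes "P \<le> 2 ^ j"
  shows "map_pmf (\<lambda>x. x < P) (iterate append_bit j 0) = bernoulli_pmf (real P / 2 ^ j)"
proof -
  have "{u. u < 2 ^ j \<and> u < P} = {..<P}" using assms by auto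
  then show ?thesis
    using prob_iterate_append_bit[of j 0 P] by (simp add: map_pmf_bool lessThan_def)
qed

text \<open>A loop that fills an array with independent samples produces the product distribution;
  the induction needs arbitrary previous contents f.\<close>

lemma iterate_fun_upd:
  "iterate (\<lambda>j g. map_pmf (\<lambda>b. g(j := b)) q) N f =
     map_pmf (\<lambda>g i. if i < N then g i else f i) (Pi_pmf {..<N} dflt (\<lambda>_. q))"
proof (induction N arbitrary: f)
  case 0
  then show ?case by simp
next
  case (Suc N)
  have "(\<lambda>i. if i < N then g i else (f(N := b)) i) =
      (\<lambda>i. if i < Suc N then (g(N := b)) i else f i)" for g b
    by (auto simp: fun_eq_iff less_Suc_eq)
  then show ?case
    by (simp add: Suc.IH lessThan_Suc Pi_pmf_insert' bind_map_pmf map_bind_pmf map_pmf_comp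
        map_pmf_def[symmetric] del: fun_upd_apply)
qed

definition keeps :: "reg set \<Rightarrow> arr set \<Rightarrow> state \<Rightarrow> state \<Rightarrow> bool" where
  "keeps Rs As s s' \<longleftrightarrow> (\<forall>r\<in>Rs. regs s' r = regs s r) \<and> (\<forall>a\<in>As. mem s' a = mem s a)"

lemma keeps_subset: "keeps Rs As s s' \<Longrightarrow> Rs' \<subseteq> Rs \<Longrightarrow> As' \<subseteq> As \<Longrightarrow> keeps Rs' As' s s'"
  by (auto simp: keeps_def)

definition sample_bit :: com where
  "sample_bit =
     Seq (Binop Or 14 5 5) (Seq (Const 15 0)
       (Seq (downto0 14 (Seq (Coin 16) (Seq (Binop Add 15 15 15) (Binop Add 15 15 16))))
         (Binop Less 16 15 2)))"

lemma less_two_power: "x < (2::nat) ^ i \<Longrightarrow> i < w \<Longrightarrow> 2 * x + of_bool b < 2 ^ w"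
proof -
  assume "x < 2 ^ i" "i < w"
  then have "2 * x + of_bool b < 2 * 2 ^ i" by (auto simp: of_bool_def)
  also have "\<dots> \<le> 2 ^ w" using \<open>i < w\<close> power_increasing[of "Suc i" w "2::nat"] by simp
  finally show ?thesis .
qed

lemma refines_sample_bit:
  assumes "regs s 3 = 1" "regs s 5 = w" "regs s 2 = P" "P \<le> 2 ^ w"
  shows "refines w sample_bit s (bernoulli_pmf (real P / 2 ^ w))
    (\<lambda>s' t b. keeps (- {14, 15, 16}) UNIV s s' \<and> regs s' 16 = of_bool b \<and> t \<le> 5 * w + 4)"
proof -
  let ?s = "set_reg 15 0 (set_reg 14 w s)"
  \<comment> \<open>With j tosses still to come the word has at most w - j digits, so doubling it
    never overflows.\<close>
  let ?I = "\<lambda>j s' x. keeps (- {14, 15, 16}) UNIV s s' \<and> regs s' 15 = x \<and> x < 2 ^ (w - j)"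
  have body: "refines w (Seq (Coin 16) (Seq (Binop Add 15 15 15) (Binop Add 15 15 16)))
      (set_reg 14 j s1) (append_bit j x)
      (\<lambda>s' t x'. ?I j s' x' \<and> regs s' 14 = j \<and> regs s' 3 = 1 \<and> t \<le> 3)"
    if "j < w" "?I (Suc j) s1 x" "regs s1 3 = 1" for j s1 x
  proof (rule refines_Seq_Coin)
    show "append_bit j x = bernoulli_pmf (1/2) \<bind> (\<lambda>b. return_pmf (2 * x + of_bool b))"
      by (simp add: append_bit_def map_pmf_def)
    have "w - j = Suc (w - Suc j)" using that(1) by simp
    then have "2 * x + of_bool b < 2 ^ (w - j)" for b
      using less_two_power[of x "w - Suc j" "w - j" b] that(2) by simp
    moreover have "2 * x + of_bool b < 2 ^ w" "2 * x < 2 ^ w" for b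
      using less_two_power[of x "w - Suc j" w b] less_two_power[of x "w - Suc j" w False] that by auto
    ultimately show "refines w (Seq (Binop Add 15 15 15) (Binop Add 15 15 16))
        (set_reg 16 (of_bool b) (set_reg 14 j s1)) (return_pmf (2 * x + of_bool b))
        (\<lambda>s' t x'. ?I j s' x' \<and> regs s' 14 = j \<and> regs s' 3 = 1 \<and> Suc t \<le> 3)" for b
      using that by (simp add: keeps_def take_bit_nat_eq_self flip: mult_2)
  qed
  have loop: "refines w (downto0 14 (Seq (Coin 16) (Seq (Binop Add 15 15 15) (Binop Add 15 15 16))))
      ?s (iterate append_bit w 0)
      (\<lambda>s' t x'. ?I 0 s' x' \<and> regs s' 14 = 0 \<and> regs s' 3 = 1 \<and> t \<le> w * (3 + 2) + 1)"
    by (rule refines_downto0) (use body assms in \<open>auto simp: keeps_def\<close>)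
  have "refines w (Seq (downto0 14 (Seq (Coin 16) (Seq (Binop Add 15 15 15) (Binop Add 15 15 16))))
         (Binop Less 16 15 2)) ?s (bernoulli_pmf (real P / 2 ^ w))
     (\<lambda>s' t b. keeps (- {14, 15, 16}) UNIV s s' \<and> regs s' 16 = of_bool b \<and> Suc (Suc t) \<le> 5 * w + 4)"
    unfolding bernoulli_iterate_append_bit[OF assms(4), symmetric] map_pmf_def
    by (rule refines_Seq[OF loop]) (use assms in \<open>auto simp: keeps_def\<close>)
  then show ?thesis unfolding sample_bit_def using assms by simp
qed

subsection \<open>A single round of the search\<close>

abbreviation copy :: "reg \<Rightarrow> reg \<Rightarrow> com" where
  "copy r x \<equiv> Binop Or r x x"

text \<open>
  Registers 0 to 11 hold constants of the search, except for the time stamp in register 10. Registers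
  12 to 19 are scratch, register \<open>30 + l\<close> receives the row found for the matrix l, and the registers
  from \<open>30 + k\<close> on belong to the decider. Array \<open>k + l\<close> counts for each row of the matrix l the
  rounds that point to it, array \<open>2 * k\<close> holds the set S of rows to be resampled, and the arrays from
  \<open>2 * k + 1\<close> on are the stamped memory of the decider.
\<close>

definition choose_rows :: "nat \<Rightarrow> com" where
  "choose_rows k = Seq (copy 13 0) (downto0 13 (Seq (Coin 16) (Store (2 * k) 13 16)))"

definition copy_input :: "nat \<Rightarrow> nat \<Rightarrow> com" where
  "copy_input k l = Seq (copy 13 11) (downto0 13 (Seq (Load 16 l 13)
     (Seq (Store (2 * k + 1 + 2 * l) 13 16) (Store (2 * k + 1 + 2 * l + 1) 13 10))))"

text \<open>A bit is drawn for every position but stored only if its row belongs to S. The draws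
  thus form a product over all n * d positions, independent of S.\<close>

definition resample :: "nat \<Rightarrow> nat \<Rightarrow> com" where
  "resample k l = Seq (copy 13 11) (downto0 13 (Seq sample_bit
     (Seq (Binop Div 17 13 1) (Seq (Load 17 (2 * k) 17)
       (If 17 (Seq (Store (2 * k + 1 + 2 * l) 13 16) (Store (2 * k + 1 + 2 * l + 1) 13 10))
         (Const 17 0))))))"

text \<open>Register 7 has the digits of p at the precision of the decider, whereas register 2 has
  the longer expansion used by the host.\<close>

definition reset_regs :: "nat \<Rightarrow> nat \<Rightarrow> com" where
  "reset_regs k R = Seq (seqs (\<lambda>r. Const (30 + k + r) 0) R)
     (Seq (copy (30 + k) 0) (Seq (copy (30 + k + 1) 1) (copy (30 + k + 2) 7)))"

text \<open>The answer 1 in register 19 claims that the planted row survived, hence lies outside S.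
  A row therefore agrees with the answer when its membership bit differs from it.\<close>

definition count :: "nat \<Rightarrow> nat \<Rightarrow> com" where
  "count k l = Seq (copy 13 0) (downto0 13 (Seq (Load 16 (2 * k) 13) (Seq (Binop Equal 16 16 19)
     (If 16 (Const 17 0)
       (Seq (Load 16 (k + l) 13) (Seq (Binop Add 16 16 3) (Store (k + l) 13 16)))))))"

definition select :: "nat \<Rightarrow> nat \<Rightarrow> com" where
  "select k l = Seq (copy 13 0) (downto0 13 (Seq (Load 16 (k + l) 13) (Seq (Binop Less 16 16 9)
     (If 16 (Const 17 0) (copy (30 + l) 13)))))"

text \<open>The input state with the digits of p as a parameter, so that host (with
  \<open>P\<close>) and decider (with \<open>P0\<close>) are described alike.\<close>

definition initial :: "nat \<Rightarrow> nat \<Rightarrow> nat \<Rightarrow> nat \<Rightarrow> ov_instance \<Rightarrow> state" where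
  "initial k n d P U =
     \<lparr>regs = (\<lambda>_. 0)(0 := n, 1 := d, 2 := P),
      mem = (\<lambda>l x. of_bool (l < k \<and> x < n * d \<and> U (l, x div d, x mod d)))\<rparr>"

text \<open>The fresh bits W are indexed by positions in the row-major array, which is the order in
  which the sampling loop draws them.\<close>

definition replace_rows :: "nat \<Rightarrow> nat \<Rightarrow> nat \<Rightarrow> (nat \<Rightarrow> bool) \<Rightarrow> (nat \<Rightarrow> bool) \<Rightarrow> ov_instance \<Rightarrow> ov_instance"
  where "replace_rows n d l S W U =
     (\<lambda>(l', i, j). if l' = l \<and> i < n \<and> j < d \<and> S i then W (i * d + j) else U (l', i, j))"

lemma Pi_pmf_iterate:
  "Pi_pmf {..<N} False (\<lambda>_. q) = iterate (\<lambda>j g. map_pmf (\<lambda>b. g(j := b)) q) N (\<lambda>_. False)"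
proof -
  have "map_pmf (\<lambda>g i. if i < N then g i else False) (Pi_pmf {..<N} False (\<lambda>_. q)) =
      map_pmf id (Pi_pmf {..<N} False (\<lambda>_. q))"
    using set_Pi_pmf_subset[of "{..<N}" False "\<lambda>_. q"]
    by (intro map_pmf_cong) (auto simp: fun_eq_iff)
  then show ?thesis by (simp add: iterate_fun_upd[of _ _ _ False] pmf.map_id)
qed

text \<open>One size n and one instance \<open>U\<close> are fixed; the decider, however, is assumed
  to halt within \<open>T\<close> steps on every instance, as it is run on resampled ones. There are
  \<open>m\<close> rounds for each matrix, and \<open>k * m < 2 ^ w\<close> keeps the time stamp,
  which grows once per round, from overflowing.\<close>

locale search_reduction =
  fixes k n d P P0 w w0 m thr R T :: nat and A :: com and U :: ov_instance
  assumes k: "0 < k"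
    and w0: "0 < w0" "w0 \<le> w"
    and bounds: "n < 2 ^ w0" "d < 2 ^ w0" "P0 < 2 ^ w0" "P \<le> 2 ^ w" "n * d < 2 ^ w"
      "k * m < 2 ^ w"
    and R: "3 \<le> R" "regs_of A \<subseteq> {..<R}"
    and lossless: "\<And>V. lossless_spmf (exec w0 A (initial k n d P0 V))"
    and time: "\<And>V s t. (s, t) \<in> set_spmf (exec w0 A (initial k n d P0 V)) \<Longrightarrow> t \<le> T"
begin

abbreviation "N \<equiv> n * d"
abbreviation "ro \<equiv> 30 + k"
abbreviation "ao \<equiv> 2 * k + 1"

definition base :: "state \<Rightarrow> bool" where
  "base s \<longleftrightarrow> regs s 0 = n \<and> regs s 1 = d \<and> regs s 2 = P \<and> regs s 3 = 1 \<and> regs s 5 = w \<and>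
     regs s 6 = 2 ^ w0 - 1 \<and> regs s 7 = P0 \<and> regs s 8 = m \<and> regs s 9 = thr \<and> regs s 11 = N \<and>
     (\<forall>l<k. mem s l = mem (initial k n d P0 U) l)"

lemma base_keeps:
  "base s \<Longrightarrow> keeps Rs As s s' \<Longrightarrow> insert 11 {..<10} \<subseteq> Rs \<Longrightarrow> {..<k} \<subseteq> As \<Longrightarrow> base s'"
  unfolding base_def keeps_def subset_iff by simp

lemma n_less: "n < 2 ^ w"
  using less_le_trans[OF bounds(1) power_increasing[of w0 w "2::nat"]] w0(2) by simp

lemma m_less: "m < 2 ^ w"
proof -
  have "m \<le> k * m" using k by (cases k) auto
  then show ?thesis using bounds(6) by (rule le_less_trans)
qed

lemma refines_choose_rows:
  assumes "base s"
  shows "refines w (choose_rows k) s (Pi_pmf {..<n} False (\<lambda>_. bernoulli_pmf (1/2)))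
    (\<lambda>s' t S. keeps (- {13, 16}) (- {2 * k}) s s' \<and>
       (\<forall>i<n. mem s' (2 * k) i = of_bool (S i)) \<and> t \<le> 4 * n + 2)"
proof -
  let ?I = "\<lambda>j s' S. keeps (- {13, 16}) (- {2 * k}) s s' \<and>
       (\<forall>i<n. j \<le> i \<longrightarrow> mem s' (2 * k) i = of_bool (S i))"
  let ?s = "set_reg 13 n s"
  have "refines w (downto0 13 (Seq (Coin 16) (Store (2 * k) 13 16))) ?s
      (iterate (\<lambda>j g. map_pmf (\<lambda>b. g(j := b)) (bernoulli_pmf (1/2))) n (\<lambda>_. False))
      (\<lambda>s' t x'. ?I 0 s' x' \<and> regs s' 13 = 0 \<and> regs s' 3 = 1 \<and> t \<le> n * (2 + 2) + 1)"
  proof (rule refines_downto0[where I = ?I])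
    fix j s1 x
    assume "j < n" "?I (Suc j) s1 x" "regs s1 3 = 1"
    then show "refines w (Seq (Coin 16) (Store (2 * k) 13 16)) (set_reg 13 j s1)
         (map_pmf (\<lambda>b. x(j := b)) (bernoulli_pmf (1/2)))
         (\<lambda>s' t x'. ?I j s' x' \<and> regs s' 13 = j \<and> regs s' 3 = 1 \<and> t \<le> 2)"
      unfolding map_pmf_def
      by (intro refines_Seq_Coin[OF refl]) (auto simp: keeps_def)
  qed (use assms n_less in \<open>auto simp: keeps_def base_def\<close>)
  then show ?thesis
    unfolding choose_rows_def Pi_pmf_iterate using assms
    by (auto simp: base_def elim: refines_mono)
qed

lemma refines_copy_inputs:
  assumes "base s" "regs s 10 = \<tau>" "\<And>a x. mem s (ao + 2 * a + 1) x < \<tau>"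
  shows "refines w (seqs (copy_input k) k) s (return_pmf ())
    (\<lambda>s' t _. keeps (- {13, 16}) {..<ao} s s' \<and>
       stamped ao \<tau> s' = mem (initial k n d P0 U) \<and>
       (\<forall>a x. mem s' (ao + 2 * a + 1) x \<le> \<tau>) \<and> t \<le> k * (5 * N + 2) + 1)"
proof -
  let ?I = "\<lambda>i s' (_ :: unit). keeps (- {13, 16}) {..<ao} s s' \<and>
       stamped ao \<tau> s' = (\<lambda>a x. if a < i then mem (initial k n d P0 U) a x else 0) \<and>
       (\<forall>a x. mem s' (ao + 2 * a + 1) x \<le> \<tau>)"
  have "refines w (seqs (copy_input k) k) s (iterate_up (\<lambda>_. return_pmf) k ())
      (\<lambda>s' t x'. ?I k s' x' \<and> t \<le> k * (5 * N + 2) + 1)"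
  proof (rule refines_seqs[where I = ?I])
    \<comment> \<open>All stamps are older than \<tau>, so the simulated memory starts out as
      zero.\<close>
    show "?I 0 (set_reg 16 0 s) ()"
      using assms by (auto simp: keeps_def stamped_def fun_eq_iff less_imp_le dest: less_imp_neq)
  next
    fix i s1 and x :: unit
    assume i: "i < k" and I: "?I i s1 x"
    let ?J = "\<lambda>j s' (_ :: unit). keeps (- {13, 16}) {..<ao} s s' \<and>
       stamped ao \<tau> s' = (\<lambda>a x. if a < i \<or> a = i \<and> j \<le> x then mem (initial k n d P0 U) a x else 0) \<and>
       (\<forall>a x. mem s' (ao + 2 * a + 1) x \<le> \<tau>)"
    \<comment> \<open>Beyond the matrix the intended contents are 0, which is also how an outdated
      cell reads; only N cells have to be copied.\<close>
    have zero: "mem (initial k n d P0 U) a x = 0" if "N \<le> x" for a x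
      using that by (simp add: initial_def)
    have "refines w (downto0 13 (Seq (Load 16 i 13)
        (Seq (Store (2 * k + 1 + 2 * i) 13 16) (Store (2 * k + 1 + 2 * i + 1) 13 10))))
        (set_reg 13 N s1) (iterate (\<lambda>_. return_pmf) N ())
        (\<lambda>s' t x'. ?J 0 s' x' \<and> regs s' 13 = 0 \<and> regs s' 3 = 1 \<and> t \<le> N * (3 + 2) + 1)"
    proof (rule refines_downto0[where I = ?J])
      have st: "stamped ao \<tau> (set_reg 13 N s1) = stamped ao \<tau> s1"
        by (simp add: stamped_def fun_eq_iff)
      show "?J N (set_reg 13 N s1) ()"
        unfolding st using I zero by (auto simp: keeps_def fun_eq_iff)
    next
      fix j s2 and y :: unit
      assume j: "j < N" and J: "?J (Suc j) s2 y" and "regs s2 3 = 1"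
      let ?v = "mem (initial k n d P0 U) i j"
      let ?s = "set_reg 16 ?v (set_reg 13 j s2)"
      have v: "mem s2 i j = ?v" and r10: "regs s2 10 = \<tau>"
        using J i assms(1,2) by (auto simp: keeps_def base_def)
      have "stamped ao \<tau> ?s = stamped ao \<tau> s2"
        by (simp add: stamped_def fun_eq_iff)
      then have "stamped ao \<tau> (set_mem (ao + 2 * i + 1) j \<tau> (set_mem (ao + 2 * i) j ?v ?s)) =
          (\<lambda>a x. if a < i \<or> a = i \<and> j \<le> x then mem (initial k n d P0 U) a x else 0)"
        unfolding stamped_set_mem using J by (auto simp: fun_eq_iff)
      moreover have "mem (set_mem (ao + 2 * i + 1) j \<tau> (set_mem (ao + 2 * i) j ?v ?s))
          (ao + 2 * a + 1) x \<le> \<tau>" for a x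
      proof -
        have "Suc (2 * a) \<noteq> 2 * i" by presburger
        then show ?thesis using J by auto
      qed
      moreover have "keeps (- {13, 16}) {..<ao} s
          (set_mem (ao + 2 * i + 1) j \<tau> (set_mem (ao + 2 * i) j ?v ?s))"
        using J by (auto simp: keeps_def)
      ultimately show "refines w (Seq (Load 16 i 13)
          (Seq (Store (2 * k + 1 + 2 * i) 13 16) (Store (2 * k + 1 + 2 * i + 1) 13 10)))
          (set_reg 13 j s2) (return_pmf y)
          (\<lambda>s' t x'. ?J j s' x' \<and> regs s' 13 = j \<and> regs s' 3 = 1 \<and> t \<le> 3)"
        using v r10 \<open>regs s2 3 = 1\<close> by simp
    qed (use I bounds(5) assms(1) in \<open>auto simp: keeps_def base_def\<close>)
    moreover have "regs s1 11 = N"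
      using I assms(1) by (simp add: keeps_def base_def)
    moreover have "(a < i \<or> a = i) = (a < Suc i)" for a by auto
    ultimately have "refines w (copy_input k i) s1 (return_pmf ())
        (\<lambda>s' t x'. ?J 0 s' x' \<and> t \<le> 5 * N + 2)"
      unfolding copy_input_def by (auto simp: algebra_simps elim!: refines_mono)
    then show "refines w (copy_input k i) s1 (return_pmf x)
        (\<lambda>s' t x'. ?I (Suc i) s' x' \<and> t \<le> 5 * N + 2)"
      unfolding unit_eq[of x] by (rule refines_mono) (auto simp: less_Suc_eq)
  qed
  moreover have "stamped ao \<tau> s' = mem (initial k n d P0 U)"
    if "stamped ao \<tau> s' = (\<lambda>a x. if a < k then mem (initial k n d P0 U) a x else 0)" for s'
    unfolding that by (auto simp: initial_def fun_eq_iff)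
  ultimately show ?thesis
    by (auto elim!: refines_mono)
qed

lemma refines_resample:
  assumes "base s" "regs s 10 = \<tau>" "stamped ao \<tau> s = mem (initial k n d P0 U)" "l < k"
    and "\<And>a x. mem s (ao + 2 * a + 1) x \<le> \<tau>" "\<And>i. i < n \<Longrightarrow> mem s (2 * k) i = of_bool (S i)"
  shows "refines w (resample k l) s (Pi_pmf {..<N} False (\<lambda>_. bernoulli_pmf (real P / 2 ^ w)))
    (\<lambda>s' t W. keeps (- {13, 14, 15, 16, 17}) {..<ao} s s' \<and>
       stamped ao \<tau> s' = mem (initial k n d P0 (replace_rows n d l S W U)) \<and>
       (\<forall>a x. mem s' (ao + 2 * a + 1) x \<le> \<tau>) \<and> t \<le> N * (5 * w + 11) + 2)"
proof -
  let ?q = "bernoulli_pmf (real P / 2 ^ w)"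
  let ?V = "\<lambda>j W a x. if a = l \<and> j \<le> x \<and> x < N \<and> S (x div d) then of_bool (W x)
     else mem (initial k n d P0 U) a x"
  let ?I = "\<lambda>j s' W. keeps (- {13, 14, 15, 16, 17}) {..<ao} s s' \<and>
       stamped ao \<tau> s' = ?V j W \<and> (\<forall>a x. mem s' (ao + 2 * a + 1) x \<le> \<tau>)"
  let ?store = "Seq (Binop Div 17 13 1) (Seq (Load 17 (2 * k) 17)
     (If 17 (Seq (Store (ao + 2 * l) 13 16) (Store (ao + 2 * l + 1) 13 10)) (Const 17 0)))"
  have "refines w (downto0 13 (Seq sample_bit ?store)) (set_reg 13 N s)
      (iterate (\<lambda>j g. map_pmf (\<lambda>b. g(j := b)) ?q) N (\<lambda>_. False))
      (\<lambda>s' t x'. ?I 0 s' x' \<and> regs s' 13 = 0 \<and> regs s' 3 = 1 \<and> t \<le> N * (5 * w + 9 + 2) + 1)"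
  proof (rule refines_downto0[where I = ?I])
    have "stamped ao \<tau> (set_reg 13 N s) = stamped ao \<tau> s"
      by (simp add: stamped_def fun_eq_iff)
    then show "?I N (set_reg 13 N s) (\<lambda>_. False)"
      using assms(3,5) by (auto simp: keeps_def fun_eq_iff)
  next
    fix j s1 W
    assume j: "j < N" and I: "?I (Suc j) s1 W" and r3: "regs s1 3 = 1"
    let ?s = "set_reg 13 j s1"
    have "j div d < n" using j by (simp add: less_mult_imp_div_less)
    have st: "stamped ao \<tau> s2 = stamped ao \<tau> s1" if "mem s2 = mem s1" for s2
      using that by (simp add: stamped_def fun_eq_iff)
    have "refines w sample_bit ?s ?q
        (\<lambda>s' t b. keeps (- {14, 15, 16}) UNIV ?s s' \<and> regs s' 16 = of_bool b \<and> t \<le> 5 * w + 4)"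
      using I assms(1) bounds(4)
      by (intro refines_sample_bit) (auto simp: base_def keeps_def)
    then show "refines w (Seq sample_bit ?store) (set_reg 13 j s1) (map_pmf (\<lambda>b. W(j := b)) ?q)
         (\<lambda>s' t x'. ?I j s' x' \<and> regs s' 13 = j \<and> regs s' 3 = 1 \<and> t \<le> 5 * w + 9)"
      unfolding map_pmf_def
    proof (rule refines_Seq)
      fix s2 t2 b
      assume s2: "keeps (- {14, 15, 16}) UNIV ?s s2 \<and> regs s2 16 = of_bool b \<and> t2 \<le> 5 * w + 4"
      then have "mem s2 = mem s1" by (simp add: keeps_def fun_eq_iff)
      define s3 where "s3 = set_reg 17 (of_bool (S (j div d))) s2"
      have "mem s3 = mem s1" by (simp add: s3_def \<open>mem s2 = mem s1\<close>)
      have S: "mem s2 (2 * k) (j div d) = of_bool (S (j div d))"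
        using assms(6)[OF \<open>j div d < n\<close>] I \<open>mem s2 = mem s1\<close> by (simp add: keeps_def)
      have regs: "regs s2 13 = j" "regs s2 1 = d" "regs s3 13 = j" "regs s3 10 = \<tau>"
          "regs s3 16 = of_bool b" "regs s3 3 = 1"
        using s2 I assms(1,2) r3 by (auto simp: keeps_def base_def s3_def)
      have keep: "keeps (- {13, 14, 15, 16, 17}) {..<ao} s s3"
        using s2 I by (auto simp: keeps_def s3_def)
      \<comment> \<open>Lowering the bound from \<open>Suc j\<close> to \<open>j\<close> affects the
        single cell j of array l, and only if its row belongs to S.\<close>
      have cell: "?V j (W(j := b)) =
          (if S (j div d) then (?V (Suc j) W)(l := (?V (Suc j) W l)(j := of_bool b)) else ?V (Suc j) W)"
        using j by (auto simp: fun_eq_iff le_eq_less_or_eq not_less_eq Suc_le_eq)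
      have upd: "stamped ao \<tau> (set_mem (ao + 2 * l + 1) j \<tau> (set_mem (ao + 2 * l) j (of_bool b) s3)) =
         (?V (Suc j) W)(l := (?V (Suc j) W l)(j := of_bool b))"
        unfolding stamped_set_mem st[OF \<open>mem s3 = mem s1\<close>] using I by simp
      have stamps: "mem (set_mem (ao + 2 * l + 1) j \<tau> (set_mem (ao + 2 * l) j (of_bool b) s3))
          (ao + 2 * a + 1) x \<le> \<tau>" for a x
      proof -
        have "Suc (2 * a) \<noteq> 2 * l" by presburger
        then show ?thesis using I \<open>mem s3 = mem s1\<close> by auto
      qed
      have "refines w (If 17 (Seq (Store (ao + 2 * l) 13 16) (Store (ao + 2 * l + 1) 13 10)) (Const 17 0))
          s3 (return_pmf (W(j := b)))
          (\<lambda>s' t x'. ?I j s' x' \<and> regs s' 13 = j \<and> regs s' 3 = 1 \<and> t \<le> 3)"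
      proof (cases "S (j div d)")
        case True
        define v :: nat where "v = of_bool b"
        define s4 where "s4 = set_mem (ao + 2 * l + 1) j \<tau> (set_mem (ao + 2 * l) j v s3)"
        have "keeps (- {13, 14, 15, 16, 17}) {..<ao} s s4"
          using keep by (auto simp: keeps_def s4_def)
        moreover have "stamped ao \<tau> s4 = ?V j (W(j := b))"
          unfolding cell s4_def v_def upd using True by simp
        moreover have "mem s4 (ao + 2 * a + 1) x \<le> \<tau>" for a x
          using stamps unfolding s4_def v_def by blast
        ultimately have "?I j s4 (W(j := b)) \<and> regs s4 13 = j \<and> regs s4 3 = 1"
          using regs by (simp add: s4_def)
        then have "refines w (Seq (Store (ao + 2 * l) 13 16) (Store (ao + 2 * l + 1) 13 10))
            s3 (return_pmf (W(j := b)))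
            (\<lambda>s' t x'. ?I j s' x' \<and> regs s' 13 = j \<and> regs s' 3 = 1 \<and> Suc t \<le> 3)"
          unfolding refines_Seq_basic refines_basic regs_set_mem regs v_def[symmetric] s4_def[symmetric]
            set_return_pmf
          by (intro ballI) (simp only: singleton_iff, simp)
        moreover have "regs s3 17 \<noteq> 0" using True by (simp add: s3_def)
        ultimately show ?thesis
          unfolding refines_If by simp
      next
        case False
        define s4 where "s4 = set_reg 17 0 s3"
        have "stamped ao \<tau> s4 = ?V j (W(j := b))"
          unfolding cell using st[of s4] I \<open>mem s3 = mem s1\<close> False by (simp add: s4_def)
        then have "?I j s4 (W(j := b)) \<and> regs s4 13 = j \<and> regs s4 3 = 1"
          using regs keep I \<open>mem s3 = mem s1\<close> by (auto simp: s4_def keeps_def)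
        then have "refines w (Const 17 0) s3 (return_pmf (W(j := b)))
            (\<lambda>s' t x'. ?I j s' x' \<and> regs s' 13 = j \<and> regs s' 3 = 1 \<and> Suc t \<le> 3)"
          unfolding refines_basic take_bit_of_0 s4_def[symmetric] set_return_pmf
          by (intro ballI) (simp only: singleton_iff, simp)
        moreover have "regs s3 17 = 0" using False by (simp add: s3_def)
        ultimately show ?thesis
          unfolding refines_If by simp
      qed
      moreover have "set_reg 17 (of_bool (S (j div d))) (set_reg 17 (j div d) s2) = s3"
        by (simp add: s3_def set_reg_def)
      ultimately show "refines w ?store s2 (return_pmf (W(j := b)))
          (\<lambda>s' t x'. ?I j s' x' \<and> regs s' 13 = j \<and> regs s' 3 = 1 \<and> t2 + t \<le> 5 * w + 9)"
        using S regs s2 by (auto elim!: refines_mono)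
    qed
  qed (use assms(1) bounds(5) in \<open>simp_all add: base_def\<close>)
  moreover have "?V 0 W = mem (initial k n d P0 (replace_rows n d l S W U))" for W
  proof -
    have "x div d < n" "0 < d" if "x < N" for x
      using that by (auto simp: less_mult_imp_div_less intro: gr0I)
    then show ?thesis using assms(4)
      by (auto simp: initial_def replace_rows_def fun_eq_iff)
  qed
  moreover have "regs s 11 = N" using assms(1) by (simp add: base_def)
  ultimately show ?thesis
    unfolding resample_def Pi_pmf_iterate by (auto simp: add_ac elim!: refines_mono)
qed

lemma refines_reset_regs:
  assumes "base s"
  shows "refines w (reset_regs k R) s (return_pmf ())
    (\<lambda>s' t _. keeps ({..<ro} - {16}) UNIV s s' \<and>
       (\<forall>r<R. regs s' (ro + r) = regs (initial k n d P0 U) r) \<and> t \<le> R + 4)"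
proof -
  let ?I = "\<lambda>i s' (_ :: unit). keeps ({..<ro} - {16}) UNIV s s' \<and> (\<forall>r<i. regs s' (ro + r) = 0)"
  have "refines w (seqs (\<lambda>r. Const (ro + r) 0) R) s (iterate_up (\<lambda>_. return_pmf) R ())
      (\<lambda>s' t x'. ?I R s' x' \<and> t \<le> R * 1 + 1)"
    by (rule refines_seqs[where I = ?I]) (auto simp: keeps_def less_Suc_eq)
  then have "refines w (seqs (\<lambda>r. Const (ro + r) 0) R) s (return_pmf ())
      (\<lambda>s' t x'. ?I R s' x' \<and> t \<le> R + 1)" by simp
  then show ?thesis unfolding reset_regs_def
  proof (rule refines_Seq_return)
    fix s1 t1 assume s1: "?I R s1 () \<and> t1 \<le> R + 1"
    define s' where "s' = set_reg (ro + 2) P0 (set_reg (ro + 1) d (set_reg ro n s1))"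
    have "regs s1 0 = n" "regs s1 1 = d" "regs s1 7 = P0"
      using s1 assms by (auto simp: keeps_def base_def)
    moreover have "keeps ({..<ro} - {16}) UNIV s s'"
      using s1 by (auto simp: keeps_def s'_def)
    moreover have "\<forall>r<R. regs s' (ro + r) = regs (initial k n d P0 U) r"
      using s1 by (auto simp: s'_def initial_def)
    ultimately show "refines w (Seq (copy ro 0) (Seq (copy (ro + 1) 1) (copy (ro + 2) 7))) s1
        (return_pmf ()) (\<lambda>s2 t2 x2. keeps ({..<ro} - {16}) UNIV s s2 \<and>
          (\<forall>r<R. regs s2 (ro + r) = regs (initial k n d P0 U) r) \<and> t1 + t2 \<le> R + 4)"
      using s1 by (simp add: s'_def)
  qed
qed

text \<open>Losslessness makes the answer a genuine random bit. Every nonzero word in register 0 is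
  read as 1.\<close>

definition answer :: "ov_instance \<Rightarrow> bool pmf" where
  "answer V = map_pmf (\<lambda>x. case x of Some (s, _) \<Rightarrow> regs s 0 \<noteq> 0 | None \<Rightarrow> False)
     (exec w0 A (initial k n d P0 V))"

lemma spmf_of_pmf_answer:
  "spmf_of_pmf (answer V) = map_spmf (\<lambda>(s, _). regs s 0 \<noteq> 0) (exec w0 A (initial k n d P0 V))"
proof -
  obtain D where D: "exec w0 A (initial k n d P0 V) = spmf_of_pmf D"
    using lossless[of V] by (auto simp: lossless_spmf_conv_spmf_of_pmf)
  have "answer V = map_pmf (\<lambda>(s, _). regs s 0 \<noteq> 0) D"
    by (simp add: answer_def D spmf_of_pmf_def map_pmf_comp)
  then show ?thesis by (simp add: D)
qed

lemma initial_less: "regs (initial k n d P0 V) r < 2 ^ w0" "mem (initial k n d P0 V) a x < 2 ^ w0"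
  using bounds one_less_power[of "2::nat" w0] w0 by (auto simp: initial_def)

lemma refines_embed:
  assumes "base s" "regs s 10 = \<tau>" "stamped ao \<tau> s = mem (initial k n d P0 V)"
    and "\<And>a x. mem s (ao + 2 * a + 1) x \<le> \<tau>"
    and "\<And>r. r < R \<Longrightarrow> regs s (ro + r) = regs (initial k n d P0 V) r"
  shows "refines w (embed ro ao A) s (answer V)
    (\<lambda>s' t b. keeps ({..<ro} - {18}) {..<ao} s s' \<and> (regs s' ro \<noteq> 0) = b \<and>
       (\<forall>a x. mem s' (ao + 2 * a + 1) x \<le> \<tau>) \<and> t \<le> 4 * T)"
proof -
  have "simulates R ro ao w0 s (initial k n d P0 V) s"
    using assms initial_less unfolding simulates_def by auto
  then have "rel_spmf (\<lambda>(s1, t) (s1', t'). simulates R ro ao w0 s s1 s1' \<and> t' \<le> 4 * t)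
     (exec w0 A (initial k n d P0 V)) (exec w (embed ro ao A) s)"
    using w0 R lossless time assms(1) by (intro exec_embed[where T = T]) (auto simp: base_def)
  then have "rel_spmf (\<lambda>(s1, t) (s1', t'). simulates R ro ao w0 s s1 s1' \<and> t' \<le> 4 * T)
     (exec w0 A (initial k n d P0 V)) (exec w (embed ro ao A) s)"
    by (rule rel_spmf_mono_strong) (use time in fastforce)
  then have "rel_spmf (\<lambda>(s1', t') (s1, t). simulates R ro ao w0 s s1 s1' \<and> t' \<le> 4 * T)
     (exec w (embed ro ao A) s) (exec w0 A (initial k n d P0 V))"
    by (subst (asm) conversep_iff[symmetric], subst (asm) spmf_rel_conversep[symmetric])
      (auto elim!: rel_spmf_mono)
  then show ?thesis
    unfolding refines_def spmf_of_pmf_answer spmf_rel_map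
  proof (rule rel_spmf_mono)
    fix x y
    assume *: "(case x of (s1', t') \<Rightarrow> \<lambda>(s1, t). simulates R ro ao w0 s s1 s1' \<and> t' \<le> 4 * T) y"
    obtain s1' t' s1 t where xy: "x = (s1', t')" "y = (s1, t)" by (cases x, cases y)
    have "simulates R ro ao w0 s s1 s1'" "t' \<le> 4 * T" using * by (simp_all add: xy)
    moreover from this have "regs s1' (ro + 0) = regs s1 0"
      using R(1) by (intro simulates_reg) auto
    ultimately show "(case x of (s', t) \<Rightarrow> \<lambda>b. keeps ({..<ro} - {18}) {..<ao} s s' \<and>
        (regs s' ro \<noteq> 0) = b \<and> (\<forall>a x. mem s' (ao + 2 * a + 1) x \<le> \<tau>) \<and> t \<le> 4 * T)
        (case y of (s, _) \<Rightarrow> regs s 0 \<noteq> 0)"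
      using assms(2) by (simp add: xy simulates_def keeps_def)
  qed
qed

definition bump :: "(nat \<Rightarrow> bool) \<Rightarrow> bool \<Rightarrow> (nat \<Rightarrow> nat) \<Rightarrow> nat \<Rightarrow> nat" where
  "bump S b c = (\<lambda>i. if S i \<noteq> b then Suc (c i) else c i)"

lemma refines_count:
  assumes "base s" "regs s 19 = of_bool b" "l < k"
    and "\<And>i. i < n \<Longrightarrow> mem s (2 * k) i = of_bool (S i)"
    and "\<And>i. i < n \<Longrightarrow> mem s (k + l) i = c i" "\<And>i. i < n \<Longrightarrow> c i < m"
  shows "refines w (count k l) s (return_pmf ())
    (\<lambda>s' t _. keeps (- {13, 16, 17}) (- {k + l}) s s' \<and>
       (\<forall>i<n. mem s' (k + l) i = bump S b c i) \<and> t \<le> 8 * n + 2)"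
proof -
  let ?I = "\<lambda>j s' (_ :: unit). keeps (- {13, 16, 17}) (- {k + l}) s s' \<and>
       (\<forall>i<n. mem s' (k + l) i = (if j \<le> i then bump S b c i else c i))"
  let ?body = "Seq (Load 16 (2 * k) 13) (Seq (Binop Equal 16 16 19)
     (If 16 (Const 17 0)
       (Seq (Load 16 (k + l) 13) (Seq (Binop Add 16 16 3) (Store (k + l) 13 16)))))"
  have "refines w (downto0 13 ?body) (set_reg 13 n s) (iterate (\<lambda>_. return_pmf) n ())
      (\<lambda>s' t x'. ?I 0 s' x' \<and> regs s' 13 = 0 \<and> regs s' 3 = 1 \<and> t \<le> n * (6 + 2) + 1)"
  proof (rule refines_downto0[where I = ?I])
    fix j s1 and x :: unit
    assume j: "j < n" and I: "?I (Suc j) s1 x" and r3: "regs s1 3 = 1"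
    have [simp]: "mem s1 (2 * k) j = of_bool (S j)" "regs s1 19 = of_bool b" "mem s1 (k + l) j = c j"
      using I assms(2-4) j by (auto simp: keeps_def)
    have "Suc (c j) < 2 ^ w" using assms(6)[OF j] m_less by simp
    then have [simp]: "take_bit w (Suc (c j)) = Suc (c j)" by (rule take_bit_nat_eq_self)
    show "refines w ?body (set_reg 13 j s1) (return_pmf x)
         (\<lambda>s' t x'. ?I j s' x' \<and> regs s' 13 = j \<and> regs s' 3 = 1 \<and> t \<le> 6)"
    proof (cases "S j = b")
      case True
      then have "bump S b c j = c j" by (simp add: bump_def)
      then have "(if j \<le> i then bump S b c i else c i) = (if Suc j \<le> i then bump S b c i else c i)" for i
        by (cases "i = j") auto
      then show ?thesis using I r3 True by (simp add: refines_If keeps_def)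
    next
      case False
      then have "bump S b c j = Suc (c j)" by (simp add: bump_def)
      then have "(if j \<le> i then bump S b c i else c i) =
          (if i = j then Suc (c j) else if Suc j \<le> i then bump S b c i else c i)" for i
        by auto
      then show ?thesis using I r3 False by (simp add: refines_If keeps_def)
    qed
  qed (use assms n_less in \<open>auto simp: keeps_def base_def\<close>)
  moreover have "regs s 0 = n" using assms(1) by (simp add: base_def)
  ultimately show ?thesis
    unfolding count_def by (auto simp: add_ac elim!: refines_mono)
qed

text \<open>A result is prescribed only if exactly one row reaches the threshold. All other outcomes
  are charged to the failure probability.\<close>

definition selects :: "(nat \<Rightarrow> nat) \<Rightarrow> nat \<Rightarrow> bool" where
  "selects c r \<longleftrightarrow> (\<forall>i<n. (\<forall>i'<n. thr \<le> c i' \<longleftrightarrow> i' = i) \<longrightarrow> r = i)"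

lemma refines_select:
  assumes "base s" "\<And>i. i < n \<Longrightarrow> mem s (k + l) i = c i"
  shows "refines w (select k l) s (return_pmf ())
    (\<lambda>s' t _. keeps (- {13, 16, 17, 30 + l}) UNIV s s' \<and> selects c (regs s' (30 + l)) \<and> t \<le> 6 * n + 2)"
proof -
  let ?I = "\<lambda>j s' (_ :: unit). keeps (- {13, 16, 17, 30 + l}) UNIV s s' \<and>
     ((\<exists>i. j \<le> i \<and> i < n \<and> thr \<le> c i) \<longrightarrow> regs s' (30 + l) < n \<and> thr \<le> c (regs s' (30 + l)))"
  let ?body = "Seq (Load 16 (k + l) 13) (Seq (Binop Less 16 16 9)
     (If 16 (Const 17 0) (copy (30 + l) 13)))"
  have "refines w (downto0 13 ?body) (set_reg 13 n s) (iterate (\<lambda>_. return_pmf) n ())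
      (\<lambda>s' t x'. ?I 0 s' x' \<and> regs s' 13 = 0 \<and> regs s' 3 = 1 \<and> t \<le> n * (4 + 2) + 1)"
  proof (rule refines_downto0[where I = ?I])
    fix j s1 and x :: unit
    assume j: "j < n" and I: "?I (Suc j) s1 x" and r3: "regs s1 3 = 1"
    have [simp]: "mem s1 (k + l) j = c j" "mem s (k + l) j = c j" "regs s1 9 = thr"
      using I assms j by (auto simp: keeps_def base_def)
    show "refines w ?body (set_reg 13 j s1) (return_pmf x)
         (\<lambda>s' t x'. ?I j s' x' \<and> regs s' 13 = j \<and> regs s' 3 = 1 \<and> t \<le> 4)"
    proof (cases "c j < thr")
      case True
      then have "(\<exists>i. j \<le> i \<and> i < n \<and> thr \<le> c i) \<longleftrightarrow> (\<exists>i. Suc j \<le> i \<and> i < n \<and> thr \<le> c i)"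
        by (metis Suc_leD le_eq_less_or_eq not_le Suc_le_eq)
      then show ?thesis using I r3 True by (simp add: refines_If keeps_def)
    next
      case False
      then show ?thesis using I r3 j by (simp add: refines_If keeps_def)
    qed
  qed (use assms n_less in \<open>auto simp: keeps_def base_def\<close>)
  moreover have "selects c (regs s' (30 + l))" if "?I 0 s' ()" for s'
    using that by (auto simp: selects_def)
  moreover have "regs s 0 = n" using assms(1) by (simp add: base_def)
  ultimately show ?thesis
    unfolding select_def by (auto simp: add_ac elim!: refines_mono)
qed

end

subsection \<open>The search program\<close>

lemma take_bit_add_diff:
  assumes "y \<le> x" "x < 2 ^ w"
  shows "take_bit w (x + 2 ^ w - y) = (x - y :: nat)"
proof -
  have "take_bit w (x + 2 ^ w - y) = (x - y + 2 ^ w) mod 2 ^ w"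
    unfolding take_bit_eq_mod Nat.add_diff_assoc2[OF assms(1), symmetric] ..
  also have "\<dots> = x - y" using assms(2) by simp
  finally show ?thesis .
qed

definition round :: "nat \<Rightarrow> nat \<Rightarrow> com \<Rightarrow> nat \<Rightarrow> com" where
  "round k R A l = Seq (Binop Add 10 10 3) (Seq (choose_rows k) (Seq (seqs (copy_input k) k)
     (Seq (resample k l) (Seq (reset_regs k R) (Seq (embed (30 + k) (2 * k + 1) A)
       (Seq (If (30 + k) (Const 19 1) (Const 19 0)) (count k l)))))))"

definition phase :: "nat \<Rightarrow> nat \<Rightarrow> com \<Rightarrow> nat \<Rightarrow> com" where
  "phase k R A l = Seq (copy 12 8) (Seq (downto0 12 (round k R A l)) (select k l))"

text \<open>Both word sizes, the number of rounds and the threshold are constant multiples of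
  \<open>floorlog 2 n\<close>, obtained in register 4 by repeated halving of n. Of the host's digits
  of p the decider gets the leading ones, hence a right shift by the difference of the word
  sizes.\<close>

definition init :: "nat \<Rightarrow> nat \<Rightarrow> nat \<Rightarrow> com" where
  "init c c' C = Seq (Const 3 1) (Seq (copy 13 0)
     (Seq (While 13 (Seq (Binop ShiftR 13 13 3) (Binop Add 4 4 3)))
     (Seq (Const 16 c') (Seq (Binop Mul 5 4 16)
     (Seq (Const 16 c) (Seq (Binop Mul 17 4 16)
     (Seq (Binop ShiftL 6 3 17) (Seq (Binop Sub 6 6 3)
     (Seq (Binop Sub 16 5 17) (Seq (Binop ShiftR 7 2 16)
     (Seq (Const 16 C) (Seq (Binop Mul 16 4 16)
     (Seq (Const 17 3) (Seq (Binop Mul 9 16 17)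
     (Seq (Const 17 4) (Seq (Binop Mul 8 16 17) (Binop Mul 11 0 1)))))))))))))))))"

definition search_loop :: "nat \<Rightarrow> nat \<Rightarrow> com \<Rightarrow> com" where
  "search_loop k R A = Seq (seqs (phase k R A) k) (seqs (\<lambda>l. copy l (30 + l)) k)"

section \<open>Outcome distribution and running time of the search program\<close>

context search_reduction
begin

definition round_dist :: "nat \<Rightarrow> ((nat \<Rightarrow> bool) \<times> bool) pmf" where
  "round_dist l =
     bind_pmf (Pi_pmf {..<n} False (\<lambda>_. bernoulli_pmf (1/2))) (\<lambda>S.
     bind_pmf (Pi_pmf {..<N} False (\<lambda>_. bernoulli_pmf (real P / 2 ^ w))) (\<lambda>W.
     bind_pmf (answer (replace_rows n d l S W U)) (\<lambda>b. return_pmf (S, b))))"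

text \<open>The m rounds work on the same \<open>U\<close> with fresh S, fresh bits and fresh coins
  of the decider; given \<open>U\<close>, their contributions to the counters are independent and
  identically distributed.\<close>

definition phase_dist :: "nat \<Rightarrow> (nat \<Rightarrow> nat) pmf" where
  "phase_dist l = iterate (\<lambda>_ c. map_pmf (\<lambda>(S, b). bump S b c) (round_dist l)) m (\<lambda>_. 0)"

definition search_dist :: "(nat \<Rightarrow> nat \<Rightarrow> nat) pmf" where
  "search_dist = iterate_up (\<lambda>l C. map_pmf (\<lambda>c. C(l := c)) (phase_dist l)) k (\<lambda>_ _. 0)"

definition round_time :: nat where
  "round_time = 13 * n + k * (5 * N + 2) + N * (5 * w + 11) + R + 4 * T + 20"

definition phase_time :: nat where
  "phase_time = m * (round_time + 2) + 6 * n + 5"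

lemma base_keeps_round:
  assumes "base s" "keeps ({..<ro} - {10, 12, 13, 14, 15, 16, 17, 18, 19}) ({..<2 * k} - {k + l}) s s'"
  shows "base s'"
  using assms by (rule base_keeps) auto

lemma refines_round:
  assumes "base s" "l < k" "\<And>a x. mem s (ao + 2 * a + 1) x \<le> regs s 10"
    and "Suc (regs s 10) < 2 ^ w"
    and "\<And>i. i < n \<Longrightarrow> mem s (k + l) i = c i" "\<And>i. i < n \<Longrightarrow> c i < m"
  shows "refines w (round k R A l) s (map_pmf (\<lambda>(S, b). bump S b c) (round_dist l))
    (\<lambda>s' t c'. keeps ({..<ro} - {10, 13, 14, 15, 16, 17, 18, 19}) ({..<2 * k} - {k + l}) s s' \<and>
       regs s' 10 = Suc (regs s 10) \<and> (\<forall>a x. mem s' (ao + 2 * a + 1) x \<le> regs s' 10) \<and>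
       (\<forall>i<n. mem s' (k + l) i = c' i \<and> c' i \<le> Suc (c i)) \<and> t \<le> round_time)"
proof -
  let ?\<tau> = "Suc (regs s 10)"
  let ?K = "keeps ({..<ro} - {10, 13, 14, 15, 16, 17, 18, 19}) ({..<2 * k} - {k + l}) s"
  have base: "base s'" if "?K s'" for s'
    by (rule base_keeps_round[of s l], rule assms(1), rule keeps_subset[OF that]) auto
  define s1 where "s1 = set_reg 10 ?\<tau> s"
  have "take_bit w ?\<tau> = ?\<tau>" using assms(4) by (rule take_bit_nat_eq_self)
  then have s1: "set_reg 10 (eval_binop w Add (regs s 10) (regs s 3)) s = s1"
    using assms(1) by (simp add: s1_def base_def)
  have K1: "?K s1" "mem s1 = mem s" "regs s1 10 = ?\<tau>"
    by (auto simp: s1_def keeps_def)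
  have D: "map_pmf (\<lambda>(S, b). bump S b c) (round_dist l) =
     bind_pmf (Pi_pmf {..<n} False (\<lambda>_. bernoulli_pmf (1/2))) (\<lambda>S.
     bind_pmf (Pi_pmf {..<N} False (\<lambda>_. bernoulli_pmf (real P / 2 ^ w))) (\<lambda>W.
     bind_pmf (answer (replace_rows n d l S W U)) (\<lambda>b. return_pmf (bump S b c))))"
    by (simp add: round_dist_def map_bind_pmf)
  show ?thesis
    unfolding round_def D refines_Seq_basic s1
  proof (rule refines_Seq[OF refines_choose_rows[OF base[OF K1(1)]]])
    fix s2 t2 S
    assume s2: "keeps (- {13, 16}) (- {2 * k}) s1 s2 \<and>
       (\<forall>i<n. mem s2 (2 * k) i = of_bool (S i)) \<and> t2 \<le> 4 * n + 2"
    \<comment> \<open>No stamp exceeded the former value of register 10, so after the increment all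
      of them are strictly outdated.\<close>
    have K2: "?K s2" "regs s2 10 = ?\<tau>" "mem s2 (k + l) = mem s (k + l)"
        "mem s2 (ao + 2 * a + 1) x < ?\<tau>" for a x
      using s2 K1 assms(2,3) by (auto simp: keeps_def less_Suc_eq_le)
    have "refines w (seqs (copy_input k) k) s2 (return_pmf ())
      (\<lambda>s' t _. keeps (- {13, 16}) {..<ao} s2 s' \<and>
       stamped ao ?\<tau> s' = mem (initial k n d P0 U) \<and>
       (\<forall>a x. mem s' (ao + 2 * a + 1) x \<le> ?\<tau>) \<and> t \<le> k * (5 * N + 2) + 1)"
      by (rule refines_copy_inputs[OF base]) (use K2 in auto)
    then show "refines w (Seq (seqs (copy_input k) k) (Seq (resample k l) (Seq (reset_regs k R)
        (Seq (embed ro ao A) (Seq (If ro (Const 19 1) (Const 19 0)) (count k l)))))) s2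
        (bind_pmf (Pi_pmf {..<N} False (\<lambda>_. bernoulli_pmf (real P / 2 ^ w))) (\<lambda>W.
          bind_pmf (answer (replace_rows n d l S W U)) (\<lambda>b. return_pmf (bump S b c))))
        (\<lambda>s' t c'. ?K s' \<and> regs s' 10 = ?\<tau> \<and> (\<forall>a x. mem s' (ao + 2 * a + 1) x \<le> regs s' 10) \<and>
          (\<forall>i<n. mem s' (k + l) i = c' i \<and> c' i \<le> Suc (c i)) \<and> Suc (t2 + t) \<le> round_time)"
    proof (rule refines_Seq_return)
      fix s3 t3
      assume s3: "keeps (- {13, 16}) {..<ao} s2 s3 \<and>
       stamped ao ?\<tau> s3 = mem (initial k n d P0 U) \<and>
       (\<forall>a x. mem s3 (ao + 2 * a + 1) x \<le> ?\<tau>) \<and> t3 \<le> k * (5 * N + 2) + 1"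
      have K3: "?K s3" "regs s3 10 = ?\<tau>" "mem s3 (k + l) = mem s (k + l)"
          "\<And>i. i < n \<Longrightarrow> mem s3 (2 * k) i = of_bool (S i)"
        using s2 s3 K2 assms(2) by (auto simp: keeps_def)
      show "refines w (Seq (resample k l) (Seq (reset_regs k R)
        (Seq (embed ro ao A) (Seq (If ro (Const 19 1) (Const 19 0)) (count k l))))) s3
        (bind_pmf (Pi_pmf {..<N} False (\<lambda>_. bernoulli_pmf (real P / 2 ^ w))) (\<lambda>W.
          bind_pmf (answer (replace_rows n d l S W U)) (\<lambda>b. return_pmf (bump S b c))))
        (\<lambda>s' t c'. ?K s' \<and> regs s' 10 = ?\<tau> \<and> (\<forall>a x. mem s' (ao + 2 * a + 1) x \<le> regs s' 10) \<and>
          (\<forall>i<n. mem s' (k + l) i = c' i \<and> c' i \<le> Suc (c i)) \<and> Suc (t2 + (t3 + t)) \<le> round_time)"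
      proof (rule refines_Seq[OF refines_resample[OF base[OF K3(1)] K3(2)]])
        fix s4 t4 W
        let ?V = "replace_rows n d l S W U"
        assume s4: "keeps (- {13, 14, 15, 16, 17}) {..<ao} s3 s4 \<and>
          stamped ao ?\<tau> s4 = mem (initial k n d P0 ?V) \<and>
          (\<forall>a x. mem s4 (ao + 2 * a + 1) x \<le> ?\<tau>) \<and> t4 \<le> N * (5 * w + 11) + 2"
        have K4: "?K s4" "regs s4 10 = ?\<tau>" "mem s4 (k + l) = mem s (k + l)"
            "\<And>i. i < n \<Longrightarrow> mem s4 (2 * k) i = of_bool (S i)"
          using s4 K3 assms(2) by (auto simp: keeps_def)
        show "refines w (Seq (reset_regs k R)
            (Seq (embed ro ao A) (Seq (If ro (Const 19 1) (Const 19 0)) (count k l)))) s4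
            (bind_pmf (answer ?V) (\<lambda>b. return_pmf (bump S b c)))
            (\<lambda>s' t c'. ?K s' \<and> regs s' 10 = ?\<tau> \<and> (\<forall>a x. mem s' (ao + 2 * a + 1) x \<le> regs s' 10) \<and>
              (\<forall>i<n. mem s' (k + l) i = c' i \<and> c' i \<le> Suc (c i)) \<and>
              Suc (t2 + (t3 + (t4 + t))) \<le> round_time)"
        proof (rule refines_Seq_return[OF refines_reset_regs[OF base[OF K4(1)]]])
          fix s5 t5
          assume s5: "keeps ({..<ro} - {16}) UNIV s4 s5 \<and>
            (\<forall>r<R. regs s5 (ro + r) = regs (initial k n d P0 U) r) \<and> t5 \<le> R + 4"
          have K5: "?K s5" "regs s5 10 = ?\<tau>" "mem s5 = mem s4"
            using s5 K4 by (auto simp: keeps_def fun_eq_iff)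
          have "refines w (embed ro ao A) s5 (answer ?V)
              (\<lambda>s' t b. keeps ({..<ro} - {18}) {..<ao} s5 s' \<and> (regs s' ro \<noteq> 0) = b \<and>
                (\<forall>a x. mem s' (ao + 2 * a + 1) x \<le> ?\<tau>) \<and> t \<le> 4 * T)"
          proof (rule refines_embed[OF base[OF K5(1)] K5(2)])
            show "stamped ao ?\<tau> s5 = mem (initial k n d P0 ?V)"
              using s4 stamped_cong[OF K5(3)] by simp
            show "mem s5 (ao + 2 * a + 1) x \<le> ?\<tau>" for a x
              using s4 K5(3) by simp
            show "regs s5 (ro + r) = regs (initial k n d P0 ?V) r" if "r < R" for r
              using s5 that by (simp add: initial_def)
          qed
          then show "refines w
            (Seq (embed ro ao A) (Seq (If ro (Const 19 1) (Const 19 0)) (count k l))) s5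
            (bind_pmf (answer ?V) (\<lambda>b. return_pmf (bump S b c)))
            (\<lambda>s' t c'. ?K s' \<and> regs s' 10 = ?\<tau> \<and> (\<forall>a x. mem s' (ao + 2 * a + 1) x \<le> regs s' 10) \<and>
              (\<forall>i<n. mem s' (k + l) i = c' i \<and> c' i \<le> Suc (c i)) \<and>
              Suc (t2 + (t3 + (t4 + (t5 + t)))) \<le> round_time)"
          proof (rule refines_Seq)
            fix s6 t6 b
            assume s6: "keeps ({..<ro} - {18}) {..<ao} s5 s6 \<and> (regs s6 ro \<noteq> 0) = b \<and>
                (\<forall>a x. mem s6 (ao + 2 * a + 1) x \<le> ?\<tau>) \<and> t6 \<le> 4 * T"
            have K6: "?K s6" "regs s6 10 = ?\<tau>" "mem s6 (k + l) = mem s (k + l)"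
                "\<And>i. i < n \<Longrightarrow> mem s6 (2 * k) i = of_bool (S i)"
              using s6 K4 K5 assms(2) by (auto simp: keeps_def)
            define s7 where "s7 = set_reg 19 (of_bool b) s6"
            have K7: "?K s7" using K6(1) by (auto simp: s7_def keeps_def)
            have "(1::nat) < 2 ^ w" using one_less_power[of "2::nat" w] w0 by simp
            then have t: "take_bit w (1::nat) = 1" by (rule take_bit_nat_eq_self)
            have "refines w (count k l) s7 (return_pmf ())
              (\<lambda>s' t _. keeps (- {13, 16, 17}) (- {k + l}) s7 s' \<and>
                (\<forall>i<n. mem s' (k + l) i = bump S b c i) \<and> t \<le> 8 * n + 2)"
              by (rule refines_count[OF base[OF K7]])
                 (use K6 assms(2,5,6) in \<open>auto simp: s7_def\<close>)
            then have "refines w (Seq (Const 19 (of_bool b)) (count k l)) s6 (return_pmf ())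
              (\<lambda>s' t _. keeps (- {13, 16, 17}) (- {k + l}) s7 s' \<and>
                (\<forall>i<n. mem s' (k + l) i = bump S b c i) \<and> t \<le> 8 * n + 3)"
              using t by (cases b) (auto simp: s7_def elim!: refines_mono)
            then have 8: "refines w (Seq (If ro (Const 19 1) (Const 19 0)) (count k l)) s6 (return_pmf ())
              (\<lambda>s' t _. keeps (- {13, 16, 17}) (- {k + l}) s7 s' \<and>
                (\<forall>i<n. mem s' (k + l) i = bump S b c i) \<and> t \<le> 8 * n + 4)"
              using s6 unfolding refines_Seq_If by (cases b) (auto elim!: refines_mono)
            have 9: "?K s'" "regs s' 10 = ?\<tau>" "mem s' (ao + 2 * a + 1) x \<le> ?\<tau>"
              if "keeps (- {13, 16, 17}) (- {k + l}) s7 s'" for s' a x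
              using that K6 s6 assms(2) by (auto simp: keeps_def s7_def)
            show "refines w (Seq (If ro (Const 19 1) (Const 19 0)) (count k l)) s6
              (return_pmf (bump S b c))
              (\<lambda>s' t c'. ?K s' \<and> regs s' 10 = ?\<tau> \<and> (\<forall>a x. mem s' (ao + 2 * a + 1) x \<le> regs s' 10) \<and>
                (\<forall>i<n. mem s' (k + l) i = c' i \<and> c' i \<le> Suc (c i)) \<and>
                Suc (t2 + (t3 + (t4 + (t5 + (t6 + t))))) \<le> round_time)"
              unfolding refines_return[of _ _ _ "bump S b c" _ "()"]
              by (rule refines_mono[OF 8])
                 (use 9 s2 s3 s4 s5 s6 in \<open>auto simp: round_time_def bump_def\<close>)
          qed
        qed
      qed (use s3 K3 assms(2) in auto)
    qed
  qed
qed

lemma refines_phase: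
  assumes "base s" "l < k" "\<And>a x. mem s (ao + 2 * a + 1) x \<le> regs s 10" "regs s 10 = l * m"
    and "\<And>i. i < n \<Longrightarrow> mem s (k + l) i = 0"
  shows "refines w (phase k R A l) s (phase_dist l)
    (\<lambda>s' t c. keeps ({..<ro} - {10, 12, 13, 14, 15, 16, 17, 18, 19, 30 + l}) ({..<2 * k} - {k + l}) s s' \<and>
       regs s' 10 = Suc l * m \<and> (\<forall>a x. mem s' (ao + 2 * a + 1) x \<le> regs s' 10) \<and>
       selects c (regs s' (30 + l)) \<and> t \<le> phase_time)"
proof -
  let ?K = "keeps ({..<ro} - {10, 12, 13, 14, 15, 16, 17, 18, 19}) ({..<2 * k} - {k + l}) s"
  \<comment> \<open>The stamp continues from the earlier phases, so no value is ever used twice. A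
    counter is at most the number of rounds done so far, which keeps it within a word.\<close>
  let ?I = "\<lambda>j s' c. ?K s' \<and> regs s' 10 = l * m + (m - j) \<and>
     (\<forall>a x. mem s' (ao + 2 * a + 1) x \<le> regs s' 10) \<and> (\<forall>i<n. mem s' (k + l) i = c i \<and> c i + j \<le> m)"
  have base: "base s'" if "?K s'" for s'
    by (rule base_keeps_round[OF assms(1) that])
  have "Suc l * m \<le> k * m" using assms(2) by (intro mult_right_mono) auto
  then have le: "Suc l * m < 2 ^ w" using bounds(6) by simp
  have loop: "refines w (downto0 12 (round k R A l)) (set_reg 12 m s) (phase_dist l)
      (\<lambda>s' t x'. ?I 0 s' x' \<and> regs s' 12 = 0 \<and> regs s' 3 = 1 \<and> t \<le> m * (round_time + 2) + 1)"
    unfolding phase_dist_def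
  proof (rule refines_downto0[where I = ?I])
    fix j s1 c
    assume j: "j < m" and I: "?I (Suc j) s1 c" and r3: "regs s1 3 = 1"
    let ?s = "set_reg 12 j s1"
    have K: "?K ?s" using I by (auto simp: keeps_def)
    have "refines w (round k R A l) ?s (map_pmf (\<lambda>(S, b). bump S b c) (round_dist l))
      (\<lambda>s' t c'. keeps ({..<ro} - {10, 13, 14, 15, 16, 17, 18, 19}) ({..<2 * k} - {k + l}) ?s s' \<and>
        regs s' 10 = Suc (regs ?s 10) \<and> (\<forall>a x. mem s' (ao + 2 * a + 1) x \<le> regs s' 10) \<and>
        (\<forall>i<n. mem s' (k + l) i = c' i \<and> c' i \<le> Suc (c i)) \<and> t \<le> round_time)"
    proof (rule refines_round[OF base[OF K] assms(2)])
      show "Suc (regs ?s 10) < 2 ^ w" using I le j by simp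
      show "mem ?s (ao + 2 * a + 1) x \<le> regs ?s 10" for a x
      proof -
        have "mem s1 (ao + 2 * a + 1) x \<le> regs s1 10" using I by blast
        then show ?thesis by simp
      qed
      show "mem ?s (k + l) i = c i" if "i < n" for i using I that by simp
      show "c i < m" if "i < n" for i using I that by (auto simp: Suc_le_eq dest!: spec[of _ i])
    qed
    then show "refines w (round k R A l) (set_reg 12 j s1)
        (map_pmf (\<lambda>(S, b). bump S b c) (round_dist l))
        (\<lambda>s' t x'. ?I j s' x' \<and> regs s' 12 = j \<and> regs s' 3 = 1 \<and> t \<le> round_time)"
    proof (rule refines_mono)
      fix s' t c'
      assume *: "keeps ({..<ro} - {10, 13, 14, 15, 16, 17, 18, 19}) ({..<2 * k} - {k + l}) ?s s' \<and>
        regs s' 10 = Suc (regs ?s 10) \<and> (\<forall>a x. mem s' (ao + 2 * a + 1) x \<le> regs s' 10) \<and>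
        (\<forall>i<n. mem s' (k + l) i = c' i \<and> c' i \<le> Suc (c i)) \<and> t \<le> round_time"
      have "?K s'" "regs s' 12 = j" "regs s' 3 = 1"
        using * K r3 by (auto simp: keeps_def)
      moreover have "c' i + j \<le> m" if "i < n" for i
      proof -
        have "c i + Suc j \<le> m" "c' i \<le> Suc (c i)" using I * that by auto
        then show ?thesis by simp
      qed
      ultimately show "?I j s' c' \<and> regs s' 12 = j \<and> regs s' 3 = 1 \<and> t \<le> round_time"
        using * I j by auto
    qed
  qed (use assms m_less in \<open>auto simp: base_def keeps_def\<close>)
  have "refines w (Seq (downto0 12 (round k R A l)) (select k l)) (set_reg 12 m s)
      (bind_pmf (phase_dist l) return_pmf)
      (\<lambda>s' t c. keeps ({..<ro} - {10, 12, 13, 14, 15, 16, 17, 18, 19, 30 + l}) ({..<2 * k} - {k + l}) s s' \<and>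
       regs s' 10 = Suc l * m \<and> (\<forall>a x. mem s' (ao + 2 * a + 1) x \<le> regs s' 10) \<and>
       selects c (regs s' (30 + l)) \<and> Suc t \<le> phase_time)"
  proof (rule refines_Seq[OF loop])
    fix s1 t1 c
    assume *: "?I 0 s1 c \<and> regs s1 12 = 0 \<and> regs s1 3 = 1 \<and> t1 \<le> m * (round_time + 2) + 1"
    have "refines w (select k l) s1 (return_pmf ())
      (\<lambda>s' t _. keeps (- {13, 16, 17, 30 + l}) UNIV s1 s' \<and> selects c (regs s' (30 + l)) \<and> t \<le> 6 * n + 2)"
      using * by (intro refines_select base) auto
    then show "refines w (select k l) s1 (return_pmf c)
      (\<lambda>s' t c. keeps ({..<ro} - {10, 12, 13, 14, 15, 16, 17, 18, 19, 30 + l}) ({..<2 * k} - {k + l}) s s' \<and>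
       regs s' 10 = Suc l * m \<and> (\<forall>a x. mem s' (ao + 2 * a + 1) x \<le> regs s' 10) \<and>
       selects c (regs s' (30 + l)) \<and> Suc (t1 + t) \<le> phase_time)"
      unfolding refines_return[of _ _ _ c _ "()"]
    proof (rule refines_mono)
      fix s' t
      assume **: "keeps (- {13, 16, 17, 30 + l}) UNIV s1 s' \<and> selects c (regs s' (30 + l)) \<and> t \<le> 6 * n + 2"
      then have "keeps ({..<ro} - {10, 12, 13, 14, 15, 16, 17, 18, 19, 30 + l}) ({..<2 * k} - {k + l}) s s'"
        using * by (auto simp: keeps_def)
      moreover have "regs s' 10 = Suc l * m" "\<forall>a x. mem s' (ao + 2 * a + 1) x \<le> regs s' 10"
        using * ** by (auto simp: keeps_def)
      ultimately show "keeps ({..<ro} - {10, 12, 13, 14, 15, 16, 17, 18, 19, 30 + l}) ({..<2 * k} - {k + l}) s s' \<and>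
       regs s' 10 = Suc l * m \<and> (\<forall>a x. mem s' (ao + 2 * a + 1) x \<le> regs s' 10) \<and>
       selects c (regs s' (30 + l)) \<and> Suc (t1 + t) \<le> phase_time"
        using * ** by (simp add: phase_time_def)
    qed
  qed
  moreover have "regs s 8 = m" using assms(1) by (simp add: base_def)
  ultimately show ?thesis
    unfolding phase_def by (simp add: bind_return_pmf')
qed

lemma refines_search_loop:
  assumes "base s" "regs s 10 = 0" "\<And>a x. k \<le> a \<Longrightarrow> mem s a x = 0"
  shows "refines w (search_loop k R A) s search_dist
    (\<lambda>s' t C. (\<forall>l<k. selects (C l) (regs s' l)) \<and> t \<le> k * phase_time + k + 2)"
proof -
  let ?I = "\<lambda>i s' C. base s' \<and> regs s' 10 = i * m \<and> (\<forall>a x. mem s' (ao + 2 * a + 1) x \<le> regs s' 10) \<and>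
    (\<forall>l<k. i \<le> l \<longrightarrow> mem s' (k + l) = (\<lambda>_. 0)) \<and> (\<forall>l<i. selects (C l) (regs s' (30 + l)))"
  have "refines w (seqs (phase k R A) k) s search_dist
      (\<lambda>s' t C. ?I k s' C \<and> t \<le> k * phase_time + 1)"
    unfolding search_dist_def
  proof (rule refines_seqs[where I = ?I])
    have "base (set_reg 16 0 s)"
      by (rule base_keeps[OF assms(1), of "- {16}" UNIV]) (auto simp: keeps_def)
    then show "?I 0 (set_reg 16 0 s) (\<lambda>_ _. 0)"
      using assms by auto
  next
    fix i s1 C
    assume i: "i < k" and I: "?I i s1 C"
    have "refines w (phase k R A i) s1 (phase_dist i)
      (\<lambda>s' t c. keeps ({..<ro} - {10, 12, 13, 14, 15, 16, 17, 18, 19, 30 + i}) ({..<2 * k} - {k + i}) s1 s' \<and>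
       regs s' 10 = Suc i * m \<and> (\<forall>a x. mem s' (ao + 2 * a + 1) x \<le> regs s' 10) \<and>
       selects c (regs s' (30 + i)) \<and> t \<le> phase_time)"
      using I i by (intro refines_phase) auto
    then have "refines w (phase k R A i) s1 (phase_dist i)
      (\<lambda>s' t c. ?I (Suc i) s' (C(i := c)) \<and> t \<le> phase_time)"
    proof (rule refines_mono)
      fix s' t c
      assume *: "keeps ({..<ro} - {10, 12, 13, 14, 15, 16, 17, 18, 19, 30 + i}) ({..<2 * k} - {k + i}) s1 s' \<and>
       regs s' 10 = Suc i * m \<and> (\<forall>a x. mem s' (ao + 2 * a + 1) x \<le> regs s' 10) \<and>
       selects c (regs s' (30 + i)) \<and> t \<le> phase_time"
      have "base s'"
        by (rule base_keeps[of s1]) (use * I in auto)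
      moreover have "mem s' (k + l) = (\<lambda>_. 0)" if "l < k" "Suc i \<le> l" for l
        using * I that by (auto simp: keeps_def)
      moreover have "selects ((C(i := c)) l) (regs s' (30 + l))" if "l < Suc i" for l
        using * I that i by (cases "l = i") (auto simp: keeps_def)
      ultimately show "?I (Suc i) s' (C(i := c)) \<and> t \<le> phase_time"
        using * by auto
    qed
    then show "refines w (phase k R A i) s1 (map_pmf (\<lambda>c. C(i := c)) (phase_dist i))
        (\<lambda>s' t x'. ?I (Suc i) s' x' \<and> t \<le> phase_time)"
      unfolding refines_map_pmf .
  qed
  then have "refines w (search_loop k R A) s (bind_pmf search_dist return_pmf)
    (\<lambda>s' t C. (\<forall>l<k. selects (C l) (regs s' l)) \<and> t \<le> k * phase_time + k + 2)"
    unfolding search_loop_def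
  proof (rule refines_Seq)
    fix s1 t1 C
    assume *: "?I k s1 C \<and> t1 \<le> k * phase_time + 1"
    \<comment> \<open>For k above 30 the source and target ranges overlap; copying upwards reads
      register \<open>30 + l\<close> before it is overwritten. Register 16 is excepted because the
      empty sequence clears it.\<close>
    let ?J = "\<lambda>i s' (_ :: unit). (\<forall>l<i. regs s' l = regs s1 (30 + l)) \<and>
       (\<forall>r\<ge>i. r \<noteq> 16 \<longrightarrow> regs s' r = regs s1 r)"
    have "refines w (seqs (\<lambda>l. copy l (30 + l)) k) s1 (iterate_up (\<lambda>_. return_pmf) k ())
        (\<lambda>s' t x. ?J k s' x \<and> t \<le> k * 1 + 1)"
      by (rule refines_seqs[where I = ?J]) (auto simp: less_Suc_eq)
    then show "refines w (seqs (\<lambda>l. copy l (30 + l)) k) s1 (return_pmf C)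
       (\<lambda>s' t C. (\<forall>l<k. selects (C l) (regs s' l)) \<and> t1 + t \<le> k * phase_time + k + 2)"
      unfolding refines_return[of _ _ _ C _ "()"]
      using * by (auto elim!: refines_mono)
  qed
  then show ?thesis by (simp add: bind_return_pmf')
qed

lemma refines_floorlog:
  assumes "regs s 3 = 1" "regs s 4 + floorlog 2 (regs s 13) < 2 ^ w"
  shows "refines w (While 13 (Seq (Binop ShiftR 13 13 3) (Binop Add 4 4 3))) s (return_pmf ())
    (\<lambda>s' t _. keeps (- {4, 13}) UNIV s s' \<and> regs s' 4 = regs s 4 + floorlog 2 (regs s 13) \<and>
       t \<le> 3 * floorlog 2 (regs s 13) + 1)"
  using assms
proof (induction "regs s 13" arbitrary: s rule: less_induct)
  case less
  show ?case
  proof (cases "regs s 13 = 0")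
    case True
    then show ?thesis
      by (intro refines_While_0) (auto simp: keeps_def floorlog_eq_zero_iff)
  next
    case False
    let ?x = "regs s 13"
    have fl: "floorlog 2 ?x = Suc (floorlog 2 (?x div 2))"
      using False by (subst compute_floorlog) simp
    let ?s = "set_reg 4 (Suc (regs s 4)) (set_reg 13 (?x div 2) s)"
    have "Suc (regs s 4) < 2 ^ w" using less.prems(2) fl by simp
    then have t: "take_bit w (Suc (regs s 4)) = Suc (regs s 4)" by (rule take_bit_nat_eq_self)
    have "refines w (While 13 (Seq (Binop ShiftR 13 13 3) (Binop Add 4 4 3))) ?s (return_pmf ())
      (\<lambda>s' t _. keeps (- {4, 13}) UNIV ?s s' \<and> regs s' 4 = regs ?s 4 + floorlog 2 (regs ?s 13) \<and>
         t \<le> 3 * floorlog 2 (regs ?s 13) + 1)"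
      using False less.prems fl by (intro less.hyps) auto
    then show ?thesis
      using False less.prems(1) t fl
      by (intro refines_While_Suc)
        (auto simp: drop_bit_eq_div keeps_def elim!: refines_mono)
  qed
qed

lemma refines_init:
  assumes "w = c' * floorlog 2 n" "w0 = c * floorlog 2 n" "w0 < w"
    and "m = 4 * (C * floorlog 2 n)" "thr = 3 * (C * floorlog 2 n)" "P0 = P div 2 ^ (w - w0)"
    and "c < 2 ^ w" "c' < 2 ^ w" "C < 2 ^ w" "(4::nat) < 2 ^ w"
  shows "refines w (init c c' C) (initial k n d P U) (return_pmf ())
    (\<lambda>s' t _. base s' \<and> regs s' 10 = 0 \<and> mem s' = mem (initial k n d P U) \<and>
      t \<le> 3 * floorlog 2 n + 20)"
proof -
  define F where "F = floorlog 2 n"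
  have tb: "take_bit w x = x" if "x < 2 ^ w" for x :: nat
    using that by (rule take_bit_nat_eq_self)
  have w: "w = F * c'" "w0 = F * c"
    using assms(1,2) by (simp_all only: F_def mult.commute)
  have Fc: "F * c' < 2 ^ w" "F * c < 2 ^ w" "F * c \<le> F * c'"
    unfolding w[symmetric] using assms(3) less_trans[OF assms(3) less_exp] by auto
  have "c' \<noteq> 0" using assms(1,3) by (intro notI) simp
  then have "F \<le> F * c'" by (cases c') auto
  then have F: "F < 2 ^ w" using Fc(1) by (rule le_less_trans)
  have CF: "F * C < 2 ^ w" "F * C * 3 < 2 ^ w" "F * C * 4 < 2 ^ w"
    using m_less assms(4) by (simp_all add: F_def mult.commute)
  have pw: "push_bit (F * c) (1::nat) = 2 ^ w0" "(2::nat) ^ w0 < 2 ^ w"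
    using assms(3) by (simp_all add: w(2))
  have mask: "take_bit w (push_bit (F * c) 1) = (2 ^ w0 :: nat)"
      "take_bit w (2 ^ w0 + 2 ^ w - 1) = (2 ^ w0 - 1 :: nat)"
    unfolding pw(1) by (rule tb[OF pw(2)], rule take_bit_add_diff[OF one_le_power pw(2)]) simp
  have small: "take_bit w 3 = (3::nat)" "take_bit w 4 = (4::nat)" "take_bit w 1 = (1::nat)"
    by (rule tb, use assms(10) in linarith)+
  note tbs = small tb[OF Fc(1)] tb[OF Fc(2)] tb[OF CF(1)] tb[OF CF(2)] tb[OF CF(3)]
    tb[OF assms(7)] tb[OF assms(8)] tb[OF assms(9)] tb[OF bounds(5)] mask take_bit_add_diff[OF Fc(3,1)]
  have norm: "take_bit w w = w" "take_bit w (w + 2 ^ w - F * c) = w - F * c" "F * c < w"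
      "take_bit w (2 ^ (F * c) + 2 ^ w - 1) = (2 ^ (F * c) - 1 :: nat)"
      "(2::nat) ^ w0 = 2 ^ (F * c)"
    using tb[OF less_exp] take_bit_add_diff[of "F * c" w w] mask(2) assms(3) less_exp[of w]
    by (simp_all add: w(2))
  let ?s = "set_reg 13 n (set_reg 3 1 (initial k n d P U))"
  have "refines w (While 13 (Seq (Binop ShiftR 13 13 3) (Binop Add 4 4 3))) ?s (return_pmf ())
      (\<lambda>s' t _. keeps (- {4, 13}) UNIV ?s s' \<and> regs s' 4 = regs ?s 4 + floorlog 2 (regs ?s 13) \<and>
         t \<le> 3 * floorlog 2 (regs ?s 13) + 1)"
    using F by (intro refines_floorlog) (auto simp: initial_def F_def)
  then have "refines w (Seq (While 13 (Seq (Binop ShiftR 13 13 3) (Binop Add 4 4 3)))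
     (Seq (Const 16 c') (Seq (Binop Mul 5 4 16)
     (Seq (Const 16 c) (Seq (Binop Mul 17 4 16)
     (Seq (Binop ShiftL 6 3 17) (Seq (Binop Sub 6 6 3)
     (Seq (Binop Sub 16 5 17) (Seq (Binop ShiftR 7 2 16)
     (Seq (Const 16 C) (Seq (Binop Mul 16 4 16)
     (Seq (Const 17 3) (Seq (Binop Mul 9 16 17)
     (Seq (Const 17 4) (Seq (Binop Mul 8 16 17) (Binop Mul 11 0 1)))))))))))))))) ?s (return_pmf ())
    (\<lambda>s' t _. base s' \<and> regs s' 10 = 0 \<and> mem s' = mem (initial k n d P U) \<and>
      Suc (Suc t) \<le> 3 * floorlog 2 n + 20)"
  proof (rule refines_Seq_return)
    fix s1 t1
    assume "keeps (- {4, 13}) UNIV ?s s1 \<and> regs s1 4 = regs ?s 4 + floorlog 2 (regs ?s 13) \<and>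
         t1 \<le> 3 * floorlog 2 (regs ?s 13) + 1"
    then have s1: "regs s1 0 = n" "regs s1 1 = d" "regs s1 2 = P" "regs s1 3 = 1" "regs s1 4 = F"
        "regs s1 10 = 0" "mem s1 = mem (initial k n d P U)" "t1 \<le> 3 * F + 1"
      by (auto simp: keeps_def initial_def F_def)
    have eqs: "m = F * C * 4" "thr = F * C * 3"
      using assms(4,5) by (simp_all add: F_def)
    have P0: "P0 = drop_bit (F * c' - F * c) P"
      using assms(6) w by (simp add: drop_bit_eq_div)
    have mem: "mem (initial k n d P0 U) = mem (initial k n d P U)"
      by (simp add: initial_def)
    show "refines w
     (Seq (Const 16 c') (Seq (Binop Mul 5 4 16)
     (Seq (Const 16 c) (Seq (Binop Mul 17 4 16)
     (Seq (Binop ShiftL 6 3 17) (Seq (Binop Sub 6 6 3)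
     (Seq (Binop Sub 16 5 17) (Seq (Binop ShiftR 7 2 16)
     (Seq (Const 16 C) (Seq (Binop Mul 16 4 16)
     (Seq (Const 17 3) (Seq (Binop Mul 9 16 17)
     (Seq (Const 17 4) (Seq (Binop Mul 8 16 17) (Binop Mul 11 0 1))))))))))))))) s1 (return_pmf ())
    (\<lambda>s' t _. base s' \<and> regs s' 10 = 0 \<and> mem s' = mem (initial k n d P U) \<and>
      Suc (Suc (t1 + t)) \<le> 3 * floorlog 2 n + 20)"
      using s1(8) unfolding base_def unfolding mem eqs P0
      by (simp add: s1(1-7) tbs norm F_def[symmetric] w(1)[symmetric] del: One_nat_def)
        (simp add: initial_def)
  qed
  moreover have "set_reg 13 (regs (set_reg 3 (take_bit w 1) (initial k n d P U)) 0)
      (set_reg 3 (take_bit w 1) (initial k n d P U)) = ?s"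
    using small by (simp add: initial_def)
  ultimately show ?thesis
    unfolding init_def by (simp del: One_nat_def)
qed

lemma refines_search:
  assumes "w = c' * floorlog 2 n" "w0 = c * floorlog 2 n" "w0 < w"
    and "m = 4 * (C * floorlog 2 n)" "thr = 3 * (C * floorlog 2 n)" "P0 = P div 2 ^ (w - w0)"
    and "c < 2 ^ w" "c' < 2 ^ w" "C < 2 ^ w" "(4::nat) < 2 ^ w"
  shows "refines w (Seq (init c c' C) (search_loop k R A)) (initial k n d P U) search_dist
    (\<lambda>s' t C. (\<forall>l<k. selects (C l) (regs s' l)) \<and>
       t \<le> 3 * floorlog 2 n + 20 + k * phase_time + k + 2)"
proof (rule refines_Seq_return[OF refines_init[OF assms]])
  fix s t
  assume *: "base s \<and> regs s 10 = 0 \<and> mem s = mem (initial k n d P U) \<and> t \<le> 3 * floorlog 2 n + 20"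
  then have "mem s a x = 0" if "k \<le> a" for a x
    using that by (simp add: initial_def)
  then have "refines w (search_loop k R A) s search_dist
    (\<lambda>s' t C. (\<forall>l<k. selects (C l) (regs s' l)) \<and> t \<le> k * phase_time + k + 2)"
    using * by (intro refines_search_loop) auto
  then show "refines w (search_loop k R A) s search_dist
    (\<lambda>s' t' C. (\<forall>l<k. selects (C l) (regs s' l)) \<and>
       t + t' \<le> 3 * floorlog 2 n + 20 + k * phase_time + k + 2)"
    using * by (auto elim!: refines_mono)
qed

end

subsection \<open>Resampling rows of a planted instance\<close>

text \<open>The coordinates in K are independent of the others and get discarded, so independent
  replacements of the same law restore the product. The injection g allows the replacements to be
  indexed differently, for instance by array positions.\<close>

lemma Pi_pmf_resample:
  fixes g :: "'a \<Rightarrow> nat"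
  assumes "finite I" "finite J" "K \<subseteq> I" "inj_on g K" "g ` K \<subseteq> J"
  shows "bind_pmf (Pi_pmf I dflt (\<lambda>_. q)) (\<lambda>U.
      map_pmf (\<lambda>W x. if x \<in> K then W (g x) else U x) (Pi_pmf J dflt (\<lambda>_. q))) =
    Pi_pmf I dflt (\<lambda>_. q)"
proof -
  have finK: "finite K" using assms(1,3) by (rule rev_finite_subset)
  \<comment> \<open>Coordinates outside K are sent to a point b off the image of g, where the
    reindexed product takes the default value.\<close>
  obtain b where b: "b \<notin> g ` K" using ex_new_if_finite[of "g ` K"] finK by auto
  let ?h = "\<lambda>x. if x \<in> K then g x else b"
  have union: "K \<union> (I - K) = I" using assms(3) by auto
  have split: "Pi_pmf I dflt (\<lambda>_. q) = map_pmf (\<lambda>(f, g) x. if x \<in> K then f x else g x)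
      (pair_pmf (Pi_pmf K dflt (\<lambda>_. q)) (Pi_pmf (I - K) dflt (\<lambda>_. q)))"
    using Pi_pmf_union[of K "I - K" dflt "\<lambda>_. q"] finK assms(1) union by simp
  have "Pi_pmf K dflt (\<lambda>_. q) = map_pmf (\<lambda>W. W \<circ> ?h) (Pi_pmf (g ` K) dflt (\<lambda>_. q))"
    by (rule Pi_pmf_bij_betw) (use finK assms(4) b in \<open>auto simp: bij_betw_def inj_on_def\<close>)
  also have "\<dots> = map_pmf (\<lambda>W x. if x \<in> K then W (g x) else dflt) (Pi_pmf J dflt (\<lambda>_. q))"
    unfolding Pi_pmf_subset[OF assms(2,5), of dflt] map_pmf_comp
    by (intro map_pmf_cong refl) (use b in \<open>auto simp: fun_eq_iff\<close>)
  finally have K: "Pi_pmf K dflt (\<lambda>_. q) =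
      map_pmf (\<lambda>W x. if x \<in> K then W (g x) else dflt) (Pi_pmf J dflt (\<lambda>_. q))" .
  have "bind_pmf (Pi_pmf I dflt (\<lambda>_. q)) (\<lambda>U.
      map_pmf (\<lambda>W x. if x \<in> K then W (g x) else U x) (Pi_pmf J dflt (\<lambda>_. q))) =
    bind_pmf (Pi_pmf (I - K) dflt (\<lambda>_. q)) (\<lambda>U.
      map_pmf (\<lambda>W x. if x \<in> K then W (g x) else U x) (Pi_pmf J dflt (\<lambda>_. q)))"
    unfolding split pair_pmf_def
    by (simp add: bind_map_pmf bind_assoc_pmf bind_return_pmf cong: if_cong)
  also have "\<dots> = bind_pmf (Pi_pmf J dflt (\<lambda>_. q)) (\<lambda>W. map_pmf
      (\<lambda>U x. if x \<in> K then W (g x) else U x) (Pi_pmf (I - K) dflt (\<lambda>_. q)))"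
    unfolding map_pmf_def by (rule bind_commute_pmf)
  also have "\<dots> = Pi_pmf I dflt (\<lambda>_. q)"
    unfolding split K pair_pmf_def
    by (simp add: map_pmf_def bind_assoc_pmf bind_return_pmf cong: if_cong)
  finally show ?thesis .
qed

definition set_row :: "nat \<Rightarrow> nat \<Rightarrow> nat \<Rightarrow> (nat \<Rightarrow> bool) \<Rightarrow> ov_instance \<Rightarrow> ov_instance" where
  "set_row l i d X U = (\<lambda>(l', i', j). if l' = l \<and> i' = i \<and> j < d then X j else U (l', i', j))"

lemma Pi_pmf_set_row:
  assumes "l < k" "i < n"
  shows "bind_pmf (Pi_pmf ({..<k} \<times> {..<n} \<times> {..<d}) False (\<lambda>_. q)) (\<lambda>U.
      map_pmf (\<lambda>X. set_row l i d X U) (Pi_pmf {..<d} False (\<lambda>_. q))) =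
    Pi_pmf ({..<k} \<times> {..<n} \<times> {..<d}) False (\<lambda>_. q)"
proof -
  let ?K = "{l} \<times> {i} \<times> {..<d}"
  have eq: "set_row l i d X U = (\<lambda>x. if x \<in> ?K then X ((\<lambda>(_, _, j). j) x) else U x)" for X U
    by (auto simp: set_row_def fun_eq_iff)
  show ?thesis
    unfolding eq using assms by (intro Pi_pmf_resample) (auto simp: inj_on_def)
qed

text \<open>Row-major indexing is injective, so every resampled cell receives a bit of its
  own.\<close>

lemma Pi_pmf_replace_rows:
  assumes "l < k"
  shows "bind_pmf (Pi_pmf ({..<k} \<times> {..<n} \<times> {..<d}) False (\<lambda>_. q)) (\<lambda>U.
      map_pmf (\<lambda>W. replace_rows n d l S W U) (Pi_pmf {..<n * d} False (\<lambda>_. q))) =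
    Pi_pmf ({..<k} \<times> {..<n} \<times> {..<d}) False (\<lambda>_. q)"
proof -
  let ?K = "{l} \<times> {i. i < n \<and> S i} \<times> {..<d}"
  let ?g = "\<lambda>(_ :: nat, i, j). i * d + j"
  have eq: "replace_rows n d l S W U = (\<lambda>x. if x \<in> ?K then W (?g x) else U x)" for W U
    by (auto simp: replace_rows_def fun_eq_iff)
  have inj: "i = i' \<and> j = j'" if "i * d + j = i' * d + j'" "j < d" "j' < d" for i j i' j'
  proof -
    have "(i * d + j) div d = i" "(i' * d + j') div d = i'" using that(2,3) by simp_all
    then have "i = i'" using that(1) by metis
    with that(1) show ?thesis by simp
  qed
  have "inj_on ?g ?K"
  proof (rule inj_onI)
    fix x y assume xy: "x \<in> ?K" "y \<in> ?K" "?g x = ?g y"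
    then obtain i j i' j' where "x = (l, i, j)" "y = (l, i', j')" "j < d" "j' < d" by blast
    with xy(3) inj[of i j i' j'] show "x = y" by simp
  qed
  moreover have "?g ` ?K \<subseteq> {..<n * d}"
  proof clarify
    fix i j :: nat assume "i < n" "j < d"
    then have "i * d + j < Suc i * d" by simp
    also have "\<dots> \<le> n * d" using \<open>i < n\<close> by (intro mult_right_mono) auto
    finally show "i * d + j < n * d" .
  qed
  moreover have "?K \<subseteq> {..<k} \<times> {..<n} \<times> {..<d}" using assms by auto
  ultimately show ?thesis
    unfolding eq by (intro Pi_pmf_resample) auto
qed

text \<open>\<open>z\<close> is the number of zeros in the planted column, written k - m in the
  definition of planting.\<close>

definition flip_dist :: "real \<Rightarrow> nat \<Rightarrow> bool pmf" where
  "flip_dist p z = (if even z then bernoulli_pmf ((p / (1 - p)) ^ z) else return_pmf False)"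

text \<open>
  A flip of the last entry y removes as much mass from y = 1 as it adds, as soon as a second
  entry x is averaged out.
\<close>

lemma flip_bernoulli:
  fixes p :: real
  assumes "0 \<le> p" "p \<le> 1/2"
  shows "bind_pmf (bernoulli_pmf p) (\<lambda>x. bind_pmf (bernoulli_pmf p) (\<lambda>y.
      bind_pmf (flip_dist p (z + of_bool (\<not> x) + of_bool (\<not> y))) (\<lambda>f. return_pmf (y \<noteq> f)))) =
    bernoulli_pmf p" (is "?D = _")
proof -
  define q where "q = p / (1 - p)"
  have q: "0 \<le> q ^ i" "q ^ i \<le> 1" for i
    using assms by (auto simp: q_def intro!: power_le_one)
  have qp: "q * (1 - p) = p" using assms by (simp add: q_def)
  have p: "p \<le> 1" using assms by simp
  have "measure_pmf.prob ?D {True} = p"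
  proof (cases "even z")
    case True
    \<comment> \<open>For x = 1 only y = 1 can flip, with probability q^z; for x = 0 only y = 0 can
      flip, with probability q^(z+2). The moved masses p^2 q^z and (1-p)^2 q^(z+2) are equal because
      q(1-p) = p.\<close>
    then have "measure_pmf.prob ?D {True} =
        p * (p * (1 - q ^ z)) + (1 - p) * (p + (1 - p) * q ^ (z + 2))"
      using assms(1) p q by (simp add: prob_bind_bernoulli flip_dist_def q_def[symmetric] bind_return_pmf
        del: power_Suc)
    also have "\<dots> = p * p + (1 - p) * p + q ^ z * ((q * (1 - p)) ^ 2 - p ^ 2)"
      by (simp add: power2_eq_square algebra_simps power_add)
    also have "\<dots> = p" unfolding qp by (simp add: algebra_simps)
    finally show ?thesis .
  next
    case False
    \<comment> \<open>For odd z the flips occur at (x, y) = (1, 0) and (0, 1), both with probability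
      q^(z+1) and with equal prior mass p(1-p).\<close>
    then have "measure_pmf.prob ?D {True} =
        p * (p + (1 - p) * q ^ (z + 1)) + (1 - p) * (p * (1 - q ^ (z + 1)))"
      using assms(1) p q by (simp add: prob_bind_bernoulli flip_dist_def q_def[symmetric] bind_return_pmf
        del: power_Suc)
    then show ?thesis by (simp add: algebra_simps)
  qed
  moreover have "{x. id x} = {True}" by auto
  ultimately have "measure_pmf.prob ?D {x. id x} = p" by (simp only:)
  then show ?thesis
    using map_pmf_bool[of id ?D] by (simp only: pmf.map_id)
qed

text \<open>The coordinates are independent, so the single-bit statement applies to each. X is the
  row that gets averaged out, Y the last row, and \<open>z\<close> counts the zeros of the remaining
  k - 2 rows.\<close>

lemma flip_row:
  fixes z :: "nat \<Rightarrow> nat"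
  assumes "0 \<le> p" "p \<le> 1/2"
  shows "bind_pmf (Pi_pmf {..<d} False (\<lambda>_. bernoulli_pmf p)) (\<lambda>X.
      bind_pmf (Pi_pmf {..<d} False (\<lambda>_. bernoulli_pmf p)) (\<lambda>Y.
      map_pmf (\<lambda>F j. if j < d then Y j \<noteq> F j else False)
        (Pi_pmf {..<d} False (\<lambda>j. flip_dist p (z j + of_bool (\<not> X j) + of_bool (\<not> Y j)))))) =
    Pi_pmf {..<d} False (\<lambda>_. bernoulli_pmf p)"
proof -
  have "Pi_pmf {..<d} False (\<lambda>_. bernoulli_pmf p) =
      Pi_pmf {..<d} False (\<lambda>j. bind_pmf (bernoulli_pmf p) (\<lambda>x. bind_pmf (bernoulli_pmf p) (\<lambda>y.
        bind_pmf (flip_dist p (z j + of_bool (\<not> x) + of_bool (\<not> y))) (\<lambda>f. return_pmf (y \<noteq> f)))))"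
    by (simp only: flip_bernoulli[OF assms])
  also have "\<dots> = bind_pmf (Pi_pmf {..<d} False (\<lambda>_. bernoulli_pmf p)) (\<lambda>X.
      bind_pmf (Pi_pmf {..<d} False (\<lambda>_. bernoulli_pmf p)) (\<lambda>Y.
      bind_pmf (Pi_pmf {..<d} False (\<lambda>j. flip_dist p (z j + of_bool (\<not> X j) + of_bool (\<not> Y j)))) (\<lambda>F.
      Pi_pmf {..<d} False (\<lambda>j. return_pmf (Y j \<noteq> F j)))))"
    by (subst Pi_pmf_bind[of _ _ _ _ False], simp)+ simp
  also have "\<dots> = bind_pmf (Pi_pmf {..<d} False (\<lambda>_. bernoulli_pmf p)) (\<lambda>X.
      bind_pmf (Pi_pmf {..<d} False (\<lambda>_. bernoulli_pmf p)) (\<lambda>Y.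
      map_pmf (\<lambda>F j. if j < d then Y j \<noteq> F j else False)
        (Pi_pmf {..<d} False (\<lambda>j. flip_dist p (z j + of_bool (\<not> X j) + of_bool (\<not> Y j))))))"
    by (simp add: map_pmf_def)
  finally show ?thesis ..
qed

lemma diff_card_eq: "k - card {l \<in> {..<k}. Q l} = card {l \<in> {..<k}. \<not> Q l}"
proof -
  have "card ({..<k} - {l \<in> {..<k}. Q l}) = card {..<k} - card {l \<in> {..<k}. Q l}"
    by (rule card_Diff_subset) auto
  moreover have "{..<k} - {l \<in> {..<k}. Q l} = {l \<in> {..<k}. \<not> Q l}" by auto
  ultimately show ?thesis by simp
qed

lemma plant_eq:
  "plant k d p U s = map_pmf (\<lambda>F. set_row (k - 1) (s (k - 1)) d (\<lambda>j. U (k - 1, s (k - 1), j) \<noteq> F j) U)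
     (Pi_pmf {..<d} False (\<lambda>j. flip_dist p (card {l \<in> {..<k}. \<not> U (l, s l, j)})))"
  unfolding plant_def Let_def diff_card_eq flip_dist_def
  by (intro map_pmf_cong refl) (auto simp: set_row_def fun_eq_iff)

text \<open>Refreshing any one of the k planted rows undoes the planting. For the last matrix this
  row is the only one that planting changed. Otherwise the refreshed row influences the instance
  only through the flip probabilities, and averaging over it makes the flipped last row
  fresh.\<close>

lemma plant_set_row:
  fixes p :: real and d n :: nat
  assumes "0 \<le> p" "p \<le> 1/2" "l < k" "\<And>l. l < k \<Longrightarrow> s l < n"
  defines "M \<equiv> Pi_pmf ({..<k} \<times> {..<n} \<times> {..<d}) False (\<lambda>_. bernoulli_pmf p)"
    and "B \<equiv> Pi_pmf {..<d} False (\<lambda>_. bernoulli_pmf p)"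
  shows "bind_pmf M (\<lambda>U. bind_pmf (plant k d p U s) (\<lambda>V. map_pmf (\<lambda>X. set_row l (s l) d X V) B)) = M"
proof (cases "l = k - 1")
  case True
  have "set_row (k - 1) i d X (set_row (k - 1) i d Y U) = set_row (k - 1) i d X U" for i X Y U
    by (auto simp: set_row_def fun_eq_iff)
  then show ?thesis
    using Pi_pmf_set_row[of l k "s l" n d "bernoulli_pmf p"] assms(3,4)
    unfolding M_def B_def True plant_eq by (simp add: bind_map_pmf)
next
  case False
  let ?m = "k - 1"
  have m: "?m < k" "l < ?m" using assms(3) False by auto
  note M = Pi_pmf_set_row[of _ k _ n d "bernoulli_pmf p", folded M_def B_def]
  define z where "z U j = card {l' \<in> {..<k}. l' \<noteq> l \<and> l' \<noteq> ?m \<and> \<not> U (l', s l', j)}"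
    for U :: ov_instance and j
  let ?U = "\<lambda>X Y U. set_row ?m (s ?m) d Y (set_row l (s l) d X U)"
  \<comment> \<open>Resampling the rows of the matrix l and of the last matrix leaves the model
    unchanged and exposes them as independent variables X and Y.\<close>
  have M2: "M = bind_pmf M (\<lambda>U. bind_pmf B (\<lambda>X. bind_pmf B (\<lambda>Y. return_pmf (?U X Y U))))"
  proof -
    have "M = bind_pmf (bind_pmf M (\<lambda>U. map_pmf (\<lambda>X. set_row l (s l) d X U) B)) (\<lambda>U.
        map_pmf (\<lambda>Y. set_row ?m (s ?m) d Y U) B)"
      unfolding M[OF assms(3) assms(4)[OF assms(3)]] M[OF m(1) assms(4)[OF m(1)]] ..
    also have "\<dots> = bind_pmf M (\<lambda>U. bind_pmf B (\<lambda>X. bind_pmf B (\<lambda>Y. return_pmf (?U X Y U))))"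
      by (simp add: bind_assoc_pmf bind_map_pmf map_pmf_def bind_return_pmf)
    finally show ?thesis .
  qed
  have card: "card {l' \<in> {..<k}. \<not> ?U X Y U (l', s l', j)} = z U j + of_bool (\<not> X j) + of_bool (\<not> Y j)"
    if "j < d" for X Y U j
  proof -
    have "{l' \<in> {..<k}. \<not> ?U X Y U (l', s l', j)} =
        {l' \<in> {..<k}. l' \<noteq> l \<and> l' \<noteq> ?m \<and> \<not> U (l', s l', j)} \<union>
          ((if X j then {} else {l}) \<union> (if Y j then {} else {?m}))"
      using m that by (auto simp: set_row_def)
    also have "card \<dots> = z U j + card ((if X j then {} else {l}) \<union> (if Y j then {} else {?m}))"
      unfolding z_def by (subst card_Un_disjoint) auto
    also have "card ((if X j then {} else {l}) \<union> (if Y j then {} else {?m})) =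
        of_bool (\<not> X j) + of_bool (\<not> Y j)"
      using m by auto
    finally show ?thesis by simp
  qed
  have cards: "Pi_pmf {..<d} False (\<lambda>j. flip_dist p (card {l' \<in> {..<k}. \<not> ?U X Y U (l', s l', j)})) =
      Pi_pmf {..<d} False (\<lambda>j. flip_dist p (z U j + of_bool (\<not> X j) + of_bool (\<not> Y j)))" for X Y U
  proof (rule Pi_pmf_cong)
    fix j assume "j \<in> {..<d}"
    then have "j < d" by simp
    show "flip_dist p (card {l' \<in> {..<k}. \<not> ?U X Y U (l', s l', j)}) =
        flip_dist p (z U j + of_bool (\<not> X j) + of_bool (\<not> Y j))"
      unfolding card[OF \<open>j < d\<close>] ..
  qed (rule refl)+
  have "plant k d p (?U X Y U) s = map_pmf (\<lambda>F. ?U X (\<lambda>j. if j < d then Y j \<noteq> F j else False) U)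
     (Pi_pmf {..<d} False (\<lambda>j. flip_dist p (z U j + of_bool (\<not> X j) + of_bool (\<not> Y j))))" for X Y U
    unfolding plant_eq cards
    by (intro map_pmf_cong refl) (auto simp: set_row_def fun_eq_iff)
  moreover have "set_row l (s l) d X' (?U X Y U) = ?U X' Y U" for X X' Y U
    using m by (auto simp: set_row_def fun_eq_iff)
  ultimately have "bind_pmf (plant k d p (?U X Y U) s) (\<lambda>V. map_pmf (\<lambda>X'. set_row l (s l) d X' V) B) =
      bind_pmf (map_pmf (\<lambda>F j. if j < d then Y j \<noteq> F j else False)
        (Pi_pmf {..<d} False (\<lambda>j. flip_dist p (z U j + of_bool (\<not> X j) + of_bool (\<not> Y j)))))
        (\<lambda>Y. map_pmf (\<lambda>X'. ?U X' Y U) B)" for X Y U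
    by (simp add: bind_map_pmf)
  then have "bind_pmf M (\<lambda>U. bind_pmf (plant k d p U s) (\<lambda>V. map_pmf (\<lambda>X. set_row l (s l) d X V) B)) =
      bind_pmf M (\<lambda>U. bind_pmf (bind_pmf B (\<lambda>X. bind_pmf B (\<lambda>Y.
        map_pmf (\<lambda>F j. if j < d then Y j \<noteq> F j else False)
        (Pi_pmf {..<d} False (\<lambda>j. flip_dist p (z U j + of_bool (\<not> X j) + of_bool (\<not> Y j)))))))
        (\<lambda>Y. map_pmf (\<lambda>X'. ?U X' Y U) B))"
    by (subst M2) (simp add: bind_assoc_pmf bind_return_pmf)
  \<comment> \<open>The old row X survives only in the flip probabilities, so averaging over it
    returns a fresh last row.\<close>
  also have "\<dots> = bind_pmf M (\<lambda>U. bind_pmf B (\<lambda>Y. map_pmf (\<lambda>X'. ?U X' Y U) B))"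
    unfolding B_def flip_row[OF assms(1,2)] ..
  also have "\<dots> = bind_pmf M (\<lambda>U. bind_pmf B (\<lambda>X. bind_pmf B (\<lambda>Y. return_pmf (?U X Y U))))"
    unfolding map_pmf_def by (rule bind_pmf_cong[OF refl], rule bind_commute_pmf)
  also have "\<dots> = M" by (rule M2[symmetric])
  finally show ?thesis .
qed

lemma bind_map_commute:
  "bind_pmf (map_pmf g P) (\<lambda>V. map_pmf (\<lambda>W. r W V) Q) =
    bind_pmf Q (\<lambda>W. map_pmf (\<lambda>F. r W (g F)) P)"
  unfolding bind_map_pmf unfolding map_pmf_def by (rule bind_commute_pmf)

text \<open>If the planted row belongs to S, it may be refreshed beforehand since it is overwritten
  anyway; after that refresh the instance already has the model distribution. If it lies outside S,
  resampling touches none of the rows that planting reads or changes, so the two operations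
  commute.\<close>

lemma plant_replace_rows:
  fixes p :: real and d n :: nat
  assumes "0 \<le> p" "p \<le> 1/2" "l < k" "\<And>l. l < k \<Longrightarrow> s l < n"
  defines "M \<equiv> Pi_pmf ({..<k} \<times> {..<n} \<times> {..<d}) False (\<lambda>_. bernoulli_pmf p)"
    and "Q \<equiv> Pi_pmf {..<n * d} False (\<lambda>_. bernoulli_pmf p)"
  shows "bind_pmf M (\<lambda>U. bind_pmf (plant k d p U s) (\<lambda>V. map_pmf (\<lambda>W. replace_rows n d l S W V) Q)) =
    (if S (s l) then M else bind_pmf M (\<lambda>U. plant k d p U s))"
proof (cases "S (s l)")
  case True
  let ?B = "Pi_pmf {..<d} False (\<lambda>_. bernoulli_pmf p)"
  have "replace_rows n d l S W V = replace_rows n d l S W (set_row l (s l) d X V)" for W V X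
    using True assms(3,4) by (auto simp: replace_rows_def set_row_def fun_eq_iff)
  note row = this
  have "bind_pmf M (\<lambda>U. bind_pmf (plant k d p U s) (\<lambda>V. map_pmf (\<lambda>W. replace_rows n d l S W V) Q)) =
    bind_pmf M (\<lambda>U. bind_pmf (plant k d p U s) (\<lambda>V. bind_pmf ?B (\<lambda>X.
      map_pmf (\<lambda>W. replace_rows n d l S W (set_row l (s l) d X V)) Q)))"
    unfolding row[symmetric] by simp
  also have "\<dots> = bind_pmf (bind_pmf M (\<lambda>U. bind_pmf (plant k d p U s) (\<lambda>V.
      map_pmf (\<lambda>X. set_row l (s l) d X V) ?B))) (\<lambda>V. map_pmf (\<lambda>W. replace_rows n d l S W V) Q)"
    by (simp add: bind_assoc_pmf bind_map_pmf)
  also have "\<dots> = bind_pmf M (\<lambda>V. map_pmf (\<lambda>W. replace_rows n d l S W V) Q)"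
    using plant_set_row[where s = s and n = n and d = d, OF assms(1-4)] by (simp only: M_def)
  also have "\<dots> = M"
    using Pi_pmf_replace_rows[OF assms(3)] by (simp add: M_def Q_def)
  finally show ?thesis using True by simp
next
  case False
  let ?F = "\<lambda>U. Pi_pmf {..<d} False (\<lambda>j. flip_dist p (card {l \<in> {..<k}. \<not> U (l, s l, j)}))"
  have rows: "replace_rows n d l S W U (l', s l', j) = U (l', s l', j)" for W U l' j
    using False by (auto simp: replace_rows_def)
  have "set_row (k - 1) (s (k - 1)) d (\<lambda>j. replace_rows n d l S W U (k - 1, s (k - 1), j) \<noteq> F j)
        (replace_rows n d l S W U) =
      replace_rows n d l S W (set_row (k - 1) (s (k - 1)) d (\<lambda>j. U (k - 1, s (k - 1), j) \<noteq> F j) U)"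
    for F W U
    unfolding rows using False by (auto simp: replace_rows_def set_row_def fun_eq_iff)
  then have plant_replace: "plant k d p (replace_rows n d l S W U) s =
      map_pmf (\<lambda>F. replace_rows n d l S W
        (set_row (k - 1) (s (k - 1)) d (\<lambda>j. U (k - 1, s (k - 1), j) \<noteq> F j) U)) (?F U)" for W U
    unfolding plant_eq rows by (rule arg_cong2[where f = map_pmf, OF ext refl])
  have "bind_pmf M (\<lambda>U. bind_pmf (plant k d p U s) (\<lambda>V. map_pmf (\<lambda>W. replace_rows n d l S W V) Q)) =
      bind_pmf M (\<lambda>U. bind_pmf Q (\<lambda>W. plant k d p (replace_rows n d l S W U) s))"
    unfolding plant_replace unfolding plant_eq[of k d p _ s] bind_map_commute ..
  also have "\<dots> = bind_pmf (bind_pmf M (\<lambda>U. map_pmf (\<lambda>W. replace_rows n d l S W U) Q))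
      (\<lambda>U. plant k d p U s)"
    by (simp add: bind_assoc_pmf bind_map_pmf)
  also have "\<dots> = bind_pmf M (\<lambda>U. plant k d p U s)"
    using Pi_pmf_replace_rows[OF assms(3)] by (simp add: M_def Q_def)
  finally show ?thesis using False by simp
qed

subsection \<open>Amplification\<close>

text \<open>Hybrid argument: changing the bias of one coordinate changes the probability of any
  event by at most the difference of the biases, and the coordinates are changed one after
  another.\<close>

lemma prob_Pi_pmf_bernoulli_le:
  fixes p q :: real
  assumes "finite A" "0 \<le> p" "p \<le> 1" "0 \<le> q" "q \<le> 1"
  shows "measure_pmf.prob (bind_pmf (Pi_pmf A False (\<lambda>_. bernoulli_pmf q)) K) X \<le>
    measure_pmf.prob (bind_pmf (Pi_pmf A False (\<lambda>_. bernoulli_pmf p)) K) X + card A * \<bar>p - q\<bar>"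
  using assms(1)
proof (induction A arbitrary: K)
  case empty
  then show ?case by simp
next
  case (insert x A)
  let ?pr = "\<lambda>r y. measure_pmf.prob (bind_pmf (Pi_pmf A False (\<lambda>_. bernoulli_pmf r))
    (\<lambda>f. K (f(x := y)))) X"
  have eq: "measure_pmf.prob (bind_pmf (Pi_pmf (insert x A) False (\<lambda>_. bernoulli_pmf r)) K) X =
      r * ?pr r True + (1 - r) * ?pr r False" if "0 \<le> r" "r \<le> 1" for r
    using insert.hyps that
    by (simp add: Pi_pmf_insert' bind_assoc_pmf bind_return_pmf prob_bind_bernoulli)
  let ?e = "card A * \<bar>p - q\<bar>"
  have "q * ?pr q True + (1 - q) * ?pr q False \<le> q * (?pr p True + ?e) + (1 - q) * (?pr p False + ?e)"
    using assms(4,5) by (intro add_mono mult_left_mono insert.IH) auto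
  also have "\<dots> = p * ?pr p True + (1 - p) * ?pr p False + (q - p) * (?pr p True - ?pr p False) + ?e"
    by (simp add: algebra_simps)
  also have "(q - p) * (?pr p True - ?pr p False) \<le> \<bar>p - q\<bar>"
  proof -
    have bounds: "0 \<le> ?pr p y \<and> ?pr p y \<le> 1" for y by simp
    have "\<bar>?pr p True - ?pr p False\<bar> \<le> 1"
      using bounds[of True] bounds[of False] by linarith
    then have "\<bar>(q - p) * (?pr p True - ?pr p False)\<bar> \<le> \<bar>q - p\<bar> * 1"
      unfolding abs_mult by (rule mult_left_mono) simp
    then show ?thesis by (simp add: abs_minus_commute)
  qed
  finally show ?case
    unfolding eq[OF assms(4,5)] eq[OF assms(2,3)]
    using insert.hyps by (simp add: algebra_simps del: fun_upd_apply)
qed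

text \<open>Markov's inequality for a weight v that is at least 1/a on the event. It serves the
  exponential tail bounds as well as the passage to a fixed instance.\<close>

lemma prob_le_nn_integral:
  assumes "\<And>x. x \<in> E \<Longrightarrow> 1 \<le> a * v x" "\<And>x. 0 \<le> v x" "0 \<le> a" "0 \<le> b"
    and "(\<integral>\<^sup>+x. ennreal (v x) \<partial>measure_pmf D) \<le> ennreal b"
  shows "measure_pmf.prob D E \<le> a * b"
proof -
  have "emeasure (measure_pmf D) E = (\<integral>\<^sup>+x. indicator E x \<partial>measure_pmf D)"
    by simp
  also have "\<dots> \<le> (\<integral>\<^sup>+x. ennreal a * ennreal (v x) \<partial>measure_pmf D)"
    using assms(1-3) by (intro nn_integral_mono)
      (auto simp: indicator_def ennreal_mult[symmetric] simp flip: ennreal_1 intro!: ennreal_leI)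
  also have "\<dots> = ennreal a * (\<integral>\<^sup>+x. ennreal (v x) \<partial>measure_pmf D)"
    by (rule nn_integral_cmult) simp
  also have "\<dots> \<le> ennreal a * ennreal b"
    by (intro mult_left_mono assms(5)) simp
  finally show ?thesis
    using assms(3,4) by (simp add: measure_pmf.emeasure_eq_measure ennreal_mult[symmetric])
qed

lemma nn_integral_power_of_bool:
  assumes "0 < z"
  shows "(\<integral>\<^sup>+x. ennreal (z ^ of_bool (Z x)) \<partial>measure_pmf D) =
    ennreal (1 + (z - 1) * measure_pmf.prob D {x. Z x})"
proof -
  let ?p = "measure_pmf.prob D {x. Z x}"
  have "(\<integral>\<^sup>+x. ennreal (z ^ of_bool (Z x)) \<partial>measure_pmf D) =
      (\<integral>\<^sup>+b. ennreal (z ^ of_bool b) \<partial>measure_pmf (map_pmf Z D))" by simp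
  also have "\<dots> = ennreal z * ennreal ?p + ennreal (1 - ?p)"
    unfolding map_pmf_bool by (subst nn_integral_bernoulli_pmf) simp_all
  also have "\<dots> = ennreal (z * ?p + (1 - ?p))"
    using assms by (simp add: ennreal_mult[symmetric] ennreal_plus[symmetric] del: ennreal_plus)
  finally show ?thesis by (simp add: algebra_simps)
qed

text \<open>The exponential moment grows by a factor of at most \<kappa> in each round, whatever the
  counters are. Upper tails take z > 1, lower tails z < 1.\<close>

lemma nn_integral_iterate_le:
  assumes "0 < z" "0 \<le> \<kappa>"
    and step: "\<And>x. (\<integral>\<^sup>+y. ennreal (z ^ v y) \<partial>measure_pmf (f x)) \<le> ennreal (\<kappa> * z ^ v x)"
  shows "(\<integral>\<^sup>+y. ennreal (z ^ v y) \<partial>measure_pmf (iterate (\<lambda>_. f) m x)) \<le> ennreal (\<kappa> ^ m * z ^ v x)"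
proof (induction m arbitrary: x)
  case 0
  then show ?case by simp
next
  case (Suc m)
  have "(\<integral>\<^sup>+y. ennreal (z ^ v y) \<partial>measure_pmf (iterate (\<lambda>_. f) (Suc m) x)) =
      (\<integral>\<^sup>+x'. \<integral>\<^sup>+y. ennreal (z ^ v y) \<partial>measure_pmf (iterate (\<lambda>_. f) m x') \<partial>measure_pmf (f x))"
    by (simp add: nn_integral_bind_pmf)
  also have "\<dots> \<le> (\<integral>\<^sup>+x'. ennreal (\<kappa> ^ m) * ennreal (z ^ v x') \<partial>measure_pmf (f x))"
    using Suc.IH assms(1,2) by (intro nn_integral_mono) (simp add: ennreal_mult[symmetric])
  also have "\<dots> = ennreal (\<kappa> ^ m) * (\<integral>\<^sup>+x'. ennreal (z ^ v x') \<partial>measure_pmf (f x))"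
    by (rule nn_integral_cmult) simp
  also have "\<dots> \<le> ennreal (\<kappa> ^ m) * ennreal (\<kappa> * z ^ v x)"
    by (intro mult_left_mono step) simp
  also have "\<dots> = ennreal (\<kappa> ^ Suc m * z ^ v x)"
    using assms(1,2) by (simp add: ennreal_mult[symmetric] mult_ac)
  finally show ?case .
qed

text \<open>Union bound over the phases. A phase draws its counters independently and leaves those
  of the earlier phases alone.\<close>

lemma prob_iterate_up_le:
  "measure_pmf.prob (iterate_up (\<lambda>l C. map_pmf (\<lambda>c. C(l := c)) (D l)) L C0) {C. \<exists>l<L. C l \<in> B l} \<le>
    (\<Sum>l<L. measure_pmf.prob (D l) (B l))"
proof (induction L)
  case 0
  then show ?case by simp
next
  case (Suc L)
  let ?I = "iterate_up (\<lambda>l C. map_pmf (\<lambda>c. C(l := c)) (D l)) L C0"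
  let ?P = "pair_pmf ?I (D L)"
  have "iterate_up (\<lambda>l C. map_pmf (\<lambda>c. C(l := c)) (D l)) (Suc L) C0 = map_pmf (\<lambda>(C, c). C(L := c)) ?P"
    by (simp add: pair_pmf_def map_bind_pmf map_pmf_def bind_assoc_pmf bind_return_pmf)
  then have "measure_pmf.prob (iterate_up (\<lambda>l C. map_pmf (\<lambda>c. C(l := c)) (D l)) (Suc L) C0)
      {C. \<exists>l<Suc L. C l \<in> B l} = measure_pmf.prob ?P {x. \<exists>l<Suc L. (\<lambda>(C, c). C(L := c)) x l \<in> B l}"
    by (simp add: vimage_def)
  also have "\<dots> \<le> measure_pmf.prob ?P (fst -` {C. \<exists>l<L. C l \<in> B l} \<union> snd -` B L)"
    by (rule measure_pmf.finite_measure_mono) (auto simp: less_Suc_eq split: if_splits)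
  also have "\<dots> \<le> measure_pmf.prob ?P (fst -` {C. \<exists>l<L. C l \<in> B l}) + measure_pmf.prob ?P (snd -` B L)"
    by (rule measure_Un_le) auto
  also have "\<dots> = measure_pmf.prob ?I {C. \<exists>l<L. C l \<in> B l} + measure_pmf.prob (D L) (B L)"
    by (simp only: measure_map_pmf[symmetric] map_fst_pair_pmf map_snd_pair_pmf)
  finally show ?case using Suc.IH unfolding sum.lessThan_Suc by linarith
qed

lemma prob_Pi_pmf_eq:
  fixes i j n :: nat
  assumes "i < n" "j < n" "i \<noteq> j"
  shows "measure_pmf.prob (Pi_pmf {..<n} False (\<lambda>_. bernoulli_pmf (1/2))) {S. S i = S j} = 1/2"
proof -
  have eq: "insert i ({..<n} - {i}) = {..<n}" using assms(1) by auto
  have "Pi_pmf {..<n} False (\<lambda>_. bernoulli_pmf (1/2)) =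
      bind_pmf (bernoulli_pmf (1/2)) (\<lambda>y. map_pmf (\<lambda>f. f(i := y))
        (Pi_pmf ({..<n} - {i}) False (\<lambda>_. bernoulli_pmf (1/2))))"
    unfolding map_pmf_def by (rule Pi_pmf_insert'[of "{..<n} - {i}" i, unfolded eq]) auto
  moreover have "measure_pmf.prob D {f. f j} + measure_pmf.prob D {f. \<not> f j} = 1"
    for D :: "(nat \<Rightarrow> bool) pmf"
    using measure_pmf.prob_compl[of "{f. f j}" D] by (simp add: Collect_neg_eq Compl_eq_Diff_UNIV)
  ultimately show ?thesis
    using assms by (simp add: prob_bind_bernoulli vimage_def field_simps)
qed


text \<open>The probability that the answer is wrong for the fixed instance U if row i of the matrix
  l is the planted one: wrong means \<open>S i = b\<close>. Entries are resampled with the exact p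
  here, unlike in the program.\<close>

definition row_error ::
  "nat \<Rightarrow> nat \<Rightarrow> (ov_instance \<Rightarrow> bool pmf) \<Rightarrow> real \<Rightarrow> nat \<Rightarrow> nat \<Rightarrow> ov_instance \<Rightarrow> real" where
  "row_error n d ans p l i U =
     measure_pmf.prob (bind_pmf (Pi_pmf {..<n} False (\<lambda>_. bernoulli_pmf (1/2))) (\<lambda>S.
       bind_pmf (Pi_pmf {..<n * d} False (\<lambda>_. bernoulli_pmf p)) (\<lambda>W.
       map_pmf (\<lambda>b. S i = b) (ans (replace_rows n d l S W U))))) {True}"

section \<open>Concentration of the counters\<close>

context search_reduction
begin

lemma map_fst_round_dist: "map_pmf fst (round_dist l) = Pi_pmf {..<n} False (\<lambda>_. bernoulli_pmf (1/2))"
  by (simp add: round_dist_def map_bind_pmf bind_return_pmf')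

lemma nn_integral_bump:
  assumes "0 < z" "1 + (z - 1) * measure_pmf.prob (round_dist l) {(S, b). S i \<noteq> b} \<le> \<kappa>"
  shows "(\<integral>\<^sup>+c'. ennreal (z ^ c' i) \<partial>measure_pmf (map_pmf (\<lambda>(S, b). bump S b c) (round_dist l))) \<le>
    ennreal (\<kappa> * z ^ c i)"
proof -
  have "z ^ bump S b c i = z ^ c i * z ^ of_bool (S i \<noteq> b)" for S b
    by (simp add: bump_def)
  then have "(\<integral>\<^sup>+c'. ennreal (z ^ c' i) \<partial>measure_pmf (map_pmf (\<lambda>(S, b). bump S b c) (round_dist l))) =
      (\<integral>\<^sup>+x. ennreal (z ^ c i) * ennreal (z ^ of_bool (case x of (S, b) \<Rightarrow> S i \<noteq> b)) \<partial>measure_pmf (round_dist l))"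
    using assms(1) by (simp add: case_prod_unfold ennreal_mult[symmetric])
  also have "\<dots> = ennreal (z ^ c i) * ennreal (1 + (z - 1) * measure_pmf.prob (round_dist l) {(S, b). S i \<noteq> b})"
    using assms(1) by (subst nn_integral_cmult) (simp_all only: nn_integral_power_of_bool, simp_all)
  also have "\<dots> \<le> ennreal (z ^ c i) * ennreal \<kappa>"
    using assms(2) by (intro mult_left_mono ennreal_leI) simp_all
  also have "\<dots> = ennreal (\<kappa> * z ^ c i)"
    using assms(1) by (simp add: ennreal_mult'' mult.commute)
  finally show ?thesis .
qed

text \<open>Exponential moment at z = 2: each round contributes at most 1 + 3/5 = 8/5. With 4M
  rounds and threshold 3M this gives ((8/5)^4 / 8)^M, and (8/5)^4 / 8 = 0.8192, which is where 41/50
  comes from.\<close>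

lemma phase_dist_count_large:
  assumes "m = 4 * M" "thr = 3 * M"
    and "measure_pmf.prob (round_dist l) {(S, b). S i \<noteq> b} \<le> 3/5"
  shows "measure_pmf.prob (phase_dist l) {c. thr \<le> c i} \<le> (41/50) ^ M"
proof -
  have "measure_pmf.prob (phase_dist l) {c. thr \<le> c i} \<le> (1/2) ^ thr * ((8/5) ^ m * 2 ^ 0)"
  proof (rule prob_le_nn_integral[where v = "\<lambda>c. 2 ^ c i"])
    show "1 \<le> (1/2::real) ^ thr * 2 ^ c i" if "c \<in> {c. thr \<le> c i}" for c
      using that by (simp add: power_divide divide_simps power_increasing)
    show "(\<integral>\<^sup>+c. ennreal (2 ^ c i) \<partial>measure_pmf (phase_dist l)) \<le> ennreal ((8/5) ^ m * 2 ^ 0)"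
      unfolding phase_dist_def
      by (rule nn_integral_iterate_le[where v = "\<lambda>c. c i" and x = "\<lambda>_. 0"], simp, simp,
          rule nn_integral_bump) (use assms(3) in simp_all)
  qed simp_all
  also have "\<dots> = ((8/5) ^ 4 * (1/2) ^ 3) ^ M"
    unfolding assms(1,2) power_mult_distrib power_mult[symmetric]
    by (simp only: power_0 mult_1_right mult.commute)
  also have "\<dots> \<le> (41/50) ^ M"
    by (rule power_mono) (simp_all add: power_divide)
  finally show ?thesis .
qed

text \<open>Exponential moment at z = 1/2: each round contributes at most 1 - 9/20 = 11/20, and 8 *
  (11/20)^4 is about 0.732, below the same 41/50.\<close>

lemma phase_dist_count_small:
  assumes "m = 4 * M" "thr = 3 * M"
    and "measure_pmf.prob (round_dist l) {(S, b). S i \<noteq> b} \<ge> 9/10"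
  shows "measure_pmf.prob (phase_dist l) {c. c i < thr} \<le> (41/50) ^ M"
proof -
  have "measure_pmf.prob (phase_dist l) {c. c i < thr} \<le> 2 ^ thr * ((11/20) ^ m * (1/2) ^ 0)"
  proof (rule prob_le_nn_integral[where v = "\<lambda>c. (1/2) ^ c i"])
    show "1 \<le> (2::real) ^ thr * (1/2) ^ c i" if "c \<in> {c. c i < thr}" for c
      using that by (simp add: power_divide divide_simps power_increasing)
    show "(\<integral>\<^sup>+c. ennreal ((1/2) ^ c i) \<partial>measure_pmf (phase_dist l)) \<le> ennreal ((11/20) ^ m * (1/2) ^ 0)"
      unfolding phase_dist_def
      by (rule nn_integral_iterate_le[where v = "\<lambda>c. c i" and x = "\<lambda>_. 0"], simp, simp,
          rule nn_integral_bump) (use assms(3) in simp_all)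
  qed simp_all
  also have "\<dots> = ((11/20) ^ 4 * 2 ^ 3) ^ M"
    unfolding assms(1,2) power_mult_distrib power_mult[symmetric]
    by (simp only: power_0 mult_1_right mult.commute)
  also have "\<dots> \<le> (41/50) ^ M"
    by (rule power_mono) (simp_all add: power_divide)
  finally show ?thesis .
qed

lemma phase_dist_selects:
  assumes "m = 4 * M" "thr = 3 * M" "i0 < n"
    and err: "measure_pmf.prob (round_dist l) {(S, b). S i0 = b} \<le> 1/10"
  shows "measure_pmf.prob (phase_dist l) {c. \<not> (\<forall>r. selects c r \<longrightarrow> r = i0)} \<le> n * (41/50) ^ M"
proof -
  let ?B = "\<lambda>i. if i = i0 then {c. c i < thr} else {c. thr \<le> c i}"
  have true: "measure_pmf.prob (round_dist l) {(S, b). S i0 \<noteq> b} \<ge> 9/10"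
  proof -
    have eq: "{(S, b). S i0 \<noteq> b} = UNIV - {(S, b). S i0 = b}" by auto
    show ?thesis
      unfolding eq using err measure_pmf.prob_compl[of "{(S, b). S i0 = b}" "round_dist l"] by simp
  qed
  \<comment> \<open>If row i agrees although the answer is right, then both rows have the same
    membership in S, an event of probability 1/2.\<close>
  have wrong: "measure_pmf.prob (round_dist l) {(S, b). S i \<noteq> b} \<le> 3/5" if "i < n" "i \<noteq> i0" for i
  proof -
    have "measure_pmf.prob (round_dist l) {(S, b). S i \<noteq> b} \<le>
        measure_pmf.prob (round_dist l) ({(S, b). S i0 = b} \<union> fst -` {S. S i = S i0})"
      by (rule measure_pmf.finite_measure_mono) auto
    also have "\<dots> \<le> measure_pmf.prob (round_dist l) {(S, b). S i0 = b} +
        measure_pmf.prob (round_dist l) (fst -` {S. S i = S i0})"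
      by (rule measure_Un_le) auto
    also have "measure_pmf.prob (round_dist l) (fst -` {S. S i = S i0}) = 1/2"
      using prob_Pi_pmf_eq[OF that(1) assms(3) that(2)]
      by (simp only: measure_map_pmf[symmetric] map_fst_round_dist)
    finally show ?thesis using err by simp
  qed
  have "measure_pmf.prob (phase_dist l) {c. \<not> (\<forall>r. selects c r \<longrightarrow> r = i0)} \<le>
      measure_pmf.prob (phase_dist l) (\<Union>i<n. ?B i)"
  proof (rule measure_pmf.finite_measure_mono)
    show "{c. \<not> (\<forall>r. selects c r \<longrightarrow> r = i0)} \<subseteq> (\<Union>i<n. ?B i)"
    proof (rule subsetI, rule ccontr)
      fix c assume c: "c \<in> {c. \<not> (\<forall>r. selects c r \<longrightarrow> r = i0)}" "c \<notin> (\<Union>i<n. ?B i)"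
      then have "\<forall>i<n. thr \<le> c i \<longleftrightarrow> i = i0" by (force simp: not_less)
      then show False using c(1) assms(3) by (auto simp: selects_def)
    qed
  qed simp
  also have "\<dots> \<le> (\<Sum>i<n. measure_pmf.prob (phase_dist l) (?B i))"
    by (rule measure_UNION_le) auto
  also have "\<dots> \<le> (\<Sum>i<n. (41/50) ^ M)"
    using phase_dist_count_large[OF assms(1,2) wrong] phase_dist_count_small[OF assms(1,2) true]
    by (intro sum_mono) auto
  finally show ?thesis by simp
qed

lemma search_dist_selects:
  assumes "m = 4 * M" "thr = 3 * M" "\<And>l. l < k \<Longrightarrow> s l < n"
    and "\<And>l. l < k \<Longrightarrow> measure_pmf.prob (round_dist l) {(S, b). S (s l) = b} \<le> 1/10"
  shows "measure_pmf.prob search_dist {C. \<exists>l<k. \<exists>r. selects (C l) r \<and> r \<noteq> s l} \<le> k * (n * (41/50) ^ M)"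
proof -
  have "measure_pmf.prob search_dist {C. \<exists>l<k. C l \<in> {c. \<not> (\<forall>r. selects c r \<longrightarrow> r = s l)}} \<le>
      (\<Sum>l<k. measure_pmf.prob (phase_dist l) {c. \<not> (\<forall>r. selects c r \<longrightarrow> r = s l)})"
    unfolding search_dist_def by (rule prob_iterate_up_le)
  also have "\<dots> \<le> (\<Sum>l<k. n * (41/50) ^ M)"
    using assms by (intro sum_mono phase_dist_selects) auto
  finally show ?thesis by simp
qed

lemma round_dist_error_le:
  fixes p :: real
  assumes "0 \<le> p" "p \<le> 1"
  shows "measure_pmf.prob (round_dist l) {(S, b). S i = b} \<le>
    row_error n d answer p l i U + N * \<bar>p - real P / 2 ^ w\<bar>"
proof -
  \<comment> \<open>The hybrid bound compares product distributions in the outermost position, so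
    the fresh bits are drawn before S.\<close>
  have commute: "bind_pmf (Pi_pmf {..<n} False (\<lambda>_. bernoulli_pmf (1/2))) (\<lambda>S.
       bind_pmf (Pi_pmf {..<N} False (\<lambda>_. bernoulli_pmf q)) (\<lambda>W.
       map_pmf (\<lambda>b. S i = b) (answer (replace_rows n d l S W U)))) =
     bind_pmf (Pi_pmf {..<N} False (\<lambda>_. bernoulli_pmf q)) (\<lambda>W.
       bind_pmf (Pi_pmf {..<n} False (\<lambda>_. bernoulli_pmf (1/2))) (\<lambda>S.
       map_pmf (\<lambda>b. S i = b) (answer (replace_rows n d l S W U))))" for q
    by (rule bind_commute_pmf)
  have "measure_pmf.prob (round_dist l) {(S, b). S i = b} =
      measure_pmf.prob (map_pmf (\<lambda>(S, b). S i = b) (round_dist l)) {True}"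
    by (simp add: vimage_def case_prod_unfold)
  also have "map_pmf (\<lambda>(S, b). S i = b) (round_dist l) =
     bind_pmf (Pi_pmf {..<N} False (\<lambda>_. bernoulli_pmf (real P / 2 ^ w))) (\<lambda>W.
       bind_pmf (Pi_pmf {..<n} False (\<lambda>_. bernoulli_pmf (1/2))) (\<lambda>S.
       map_pmf (\<lambda>b. S i = b) (answer (replace_rows n d l S W U))))"
    unfolding commute[symmetric] by (simp add: round_dist_def map_bind_pmf map_pmf_def[symmetric] map_pmf_comp)
  also have "measure_pmf.prob \<dots> {True} \<le> row_error n d answer p l i U + card {..<N} * \<bar>p - real P / 2 ^ w\<bar>"
    unfolding row_error_def commute
    by (rule prob_Pi_pmf_bernoulli_le) (use assms bounds(4) in \<open>auto simp: divide_le_eq_1\<close>)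
  finally show ?thesis by simp
qed

end

subsection \<open>Success probability of the search\<close>

lemma prob_bind_pmf_le:
  assumes "\<And>x. x \<in> set_pmf D \<Longrightarrow> x \<notin> B \<Longrightarrow> measure_pmf.prob (K x) X \<le> \<epsilon>" "0 \<le> \<epsilon>"
  shows "measure_pmf.prob (bind_pmf D K) X \<le> measure_pmf.prob D B + \<epsilon>"
proof -
  have int: "integrable (measure_pmf D) (\<lambda>x. measure_pmf.prob (K x) X)"
    by (rule measure_pmf.integrable_const_bound[where B = 1]) auto
  have int2: "integrable (measure_pmf D) (indicator B :: _ \<Rightarrow> real)"
    by (rule measure_pmf.integrable_const_bound[where B = 1]) (auto simp: indicator_def)
  have "measure_pmf.prob (bind_pmf D K) X = measure_pmf.expectation D (\<lambda>x. measure_pmf.prob (K x) X)"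
    by (rule prob_bind_pmf)
  also have "\<dots> \<le> measure_pmf.expectation D (\<lambda>x. indicator B x + \<epsilon>)"
  proof (rule integral_mono_AE[OF int])
    show "AE x in measure_pmf D. measure_pmf.prob (K x) X \<le> indicator B x + \<epsilon>"
      using assms by (intro AE_pmfI) (auto simp: indicator_def add_increasing2)
  qed (use int2 in simp)
  also have "\<dots> = measure_pmf.prob D B + \<epsilon>"
    using int2 by (subst Bochner_Integration.integral_add) auto
  finally show ?thesis .
qed

lemma prob_Markov:
  assumes "\<And>x. 0 \<le> v x" "\<And>x. v x \<le> 1" "0 < a"
  shows "measure_pmf.prob D {x. 1 / a \<le> v x} \<le> a * measure_pmf.expectation D v"
proof (rule prob_le_nn_integral[where v = v])
  have "integrable (measure_pmf D) v"
    by (rule measure_pmf.integrable_const_bound[where B = 1]) (use assms in auto)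
  then show "(\<integral>\<^sup>+x. ennreal (v x) \<partial>measure_pmf D) \<le> ennreal (measure_pmf.expectation D v)"
    using assms by (subst nn_integral_eq_integral) auto
qed (use assms in \<open>auto simp: field_simps intro: Bochner_Integration.integral_nonneg\<close>)

text \<open>The planted instance together with the hidden tuple s; its first component is the
  planted distribution.\<close>

definition planted_pair ::
  "nat \<Rightarrow> nat \<Rightarrow> nat \<Rightarrow> real \<Rightarrow> (ov_instance \<times> (nat \<Rightarrow> nat)) pmf" where
  "planted_pair k n d p =
     bind_pmf (Pi_pmf ({..<k} \<times> {..<n} \<times> {..<d}) False (\<lambda>_. bernoulli_pmf p)) (\<lambda>U.
     bind_pmf (pmf_of_set ({..<k} \<rightarrow>\<^sub>E {..<n})) (\<lambda>s. map_pmf (\<lambda>V. (V, s)) (plant k d p U s)))"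

lemma planted_pair_commute:
  "planted_pair k n d p = bind_pmf (pmf_of_set ({..<k} \<rightarrow>\<^sub>E {..<n})) (\<lambda>s.
     bind_pmf (Pi_pmf ({..<k} \<times> {..<n} \<times> {..<d}) False (\<lambda>_. bernoulli_pmf p)) (\<lambda>U.
     map_pmf (\<lambda>V. (V, s)) (plant k d p U s)))"
  unfolding planted_pair_def by (rule bind_commute_pmf)

text \<open>Membership of the planted row in S is a fair coin that decides whether the decider sees
  a model or a planted instance, so the average error is the mean of its two error probabilities.
  The average extends over s as well, because the decider is only guaranteed to succeed for a random
  s.\<close>

lemma expectation_row_error:
  fixes p :: real and n d k l :: nat
  assumes "0 \<le> p" "p \<le> 1/2" "l < k" "0 < n"
  defines "M \<equiv> Pi_pmf ({..<k} \<times> {..<n} \<times> {..<d}) False (\<lambda>_. bernoulli_pmf p)"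
    and "J \<equiv> planted_pair k n d p"
  assumes "measure_pmf.prob (bind_pmf M ans) {True} \<le> \<delta>"
    and "measure_pmf.prob (bind_pmf (map_pmf fst J) ans) {False} \<le> \<delta>"
  shows "measure_pmf.expectation J (\<lambda>(V, s). row_error n d ans p l (s l) V) \<le> \<delta>"
proof -
  let ?H = "bernoulli_pmf (1/2)"
  let ?S = "Pi_pmf {..<n} False (\<lambda>_. ?H)"
  let ?W = "Pi_pmf {..<n * d} False (\<lambda>_. bernoulli_pmf p)"
  let ?s = "pmf_of_set ({..<k} \<rightarrow>\<^sub>E {..<n})"
  let ?G = "\<lambda>V s. bind_pmf ?S (\<lambda>S. bind_pmf ?W (\<lambda>W. map_pmf (\<lambda>b. S (s l) = b) (ans (replace_rows n d l S W V))))"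
  let ?P = "\<lambda>s. bind_pmf (bind_pmf M (\<lambda>U. plant k d p U s)) ans"
  let ?E = "\<lambda>c s. if c then bind_pmf M ans else map_pmf Not (?P s)"
  have fin: "finite ({..<k} \<rightarrow>\<^sub>E {..<n})" "({..<k} \<rightarrow>\<^sub>E {..<n}) \<noteq> {}"
    using assms(4) by (auto intro!: finite_PiE simp: PiE_eq_empty_iff)
  have inner: "bind_pmf M (\<lambda>U. bind_pmf (plant k d p U s) (\<lambda>V. ?G V s)) =
      bind_pmf ?H (\<lambda>c. ?E c s)" if "s \<in> {..<k} \<rightarrow>\<^sub>E {..<n}" for s
  proof -
    have s: "s l' < n" if "l' < k" for l' using \<open>s \<in> _\<close> that by auto
    have replace: "bind_pmf M (\<lambda>U. bind_pmf (plant k d p U s) (\<lambda>V.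
        map_pmf (\<lambda>W. replace_rows n d l S W V) ?W)) =
      (if S (s l) then M else bind_pmf M (\<lambda>U. plant k d p U s))" for S
      unfolding M_def by (rule plant_replace_rows[OF assms(1-3)]) (rule s)
    have "bind_pmf M (\<lambda>U. bind_pmf (plant k d p U s) (\<lambda>V. ?G V s)) =
        bind_pmf (bind_pmf M (\<lambda>U. plant k d p U s)) (\<lambda>V. ?G V s)"
      by (simp add: bind_assoc_pmf)
    also have "\<dots> = bind_pmf ?S (\<lambda>S. bind_pmf (bind_pmf M (\<lambda>U. plant k d p U s)) (\<lambda>V. bind_pmf ?W
        (\<lambda>W. map_pmf (\<lambda>b. S (s l) = b) (ans (replace_rows n d l S W V)))))"
      by (rule bind_commute_pmf)
    also have "\<dots> =
        bind_pmf ?S (\<lambda>S. bind_pmf (bind_pmf M (\<lambda>U. bind_pmf (plant k d p U s) (\<lambda>V.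
          map_pmf (\<lambda>W. replace_rows n d l S W V) ?W))) (\<lambda>V. map_pmf (\<lambda>b. S (s l) = b) (ans V)))"
      by (simp add: bind_assoc_pmf bind_map_pmf)
    also have "\<dots> = bind_pmf ?S (\<lambda>S. bind_pmf (if S (s l) then M else bind_pmf M (\<lambda>U. plant k d p U s))
        (\<lambda>V. map_pmf (\<lambda>b. S (s l) = b) (ans V)))"
      unfolding replace ..
    also have "\<dots> = bind_pmf ?S (\<lambda>S. ?E (S (s l)) s)"
    proof (rule bind_pmf_cong[OF refl])
      fix S
      have "map_pmf (\<lambda>b. b) D = D" "map_pmf (\<lambda>b. \<not> b) D = map_pmf Not D" for D :: "bool pmf"
        by simp_all
      then show "bind_pmf (if S (s l) then M else bind_pmf M (\<lambda>U. plant k d p U s))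
          (\<lambda>V. map_pmf (\<lambda>b. S (s l) = b) (ans V)) = ?E (S (s l)) s"
        by (cases "S (s l)") (simp_all add: map_bind_pmf)
    qed
    also have "\<dots> = bind_pmf (map_pmf (\<lambda>S. S (s l)) ?S) (\<lambda>c. ?E c s)"
      by (simp add: bind_map_pmf)
    also have "map_pmf (\<lambda>S. S (s l)) ?S = ?H"
      using s[OF assms(3)] by (simp add: Pi_pmf_component)
    finally show ?thesis .
  qed
  have "measure_pmf.expectation J (\<lambda>(V, s). row_error n d ans p l (s l) V) =
      measure_pmf.prob (bind_pmf J (\<lambda>(V, s). ?G V s)) {True}"
    unfolding prob_bind_pmf[of J] row_error_def by (rule Bochner_Integration.integral_cong) auto
  also have "bind_pmf J (\<lambda>(V, s). ?G V s) =
      bind_pmf ?s (\<lambda>s. bind_pmf M (\<lambda>U. bind_pmf (plant k d p U s) (\<lambda>V. ?G V s)))"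
    unfolding J_def planted_pair_commute M_def by (simp add: bind_assoc_pmf bind_map_pmf)
  also have "\<dots> = bind_pmf ?s (\<lambda>s. bind_pmf ?H (\<lambda>c. ?E c s))"
    by (rule bind_pmf_cong[OF refl]) (use fin inner in simp)
  also have "\<dots> = bind_pmf ?H (\<lambda>c. bind_pmf ?s (\<lambda>s. ?E c s))"
    by (rule bind_commute_pmf)
  also have "measure_pmf.prob \<dots> {True} =
      measure_pmf.prob (bind_pmf M ans) {True} / 2 + measure_pmf.prob (bind_pmf ?s ?P) {False} / 2"
  proof -
    have "bind_pmf ?s (\<lambda>s. map_pmf Not (?P s)) = map_pmf Not (bind_pmf ?s ?P)"
      by (simp add: map_bind_pmf)
    moreover have "Not -` {True} = {False}" by auto
    ultimately show ?thesis by (simp add: prob_bind_bernoulli)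
  qed
  also have "bind_pmf ?s ?P = bind_pmf (map_pmf fst J) ans"
    unfolding J_def planted_pair_commute M_def
    by (simp add: bind_assoc_pmf bind_map_pmf map_bind_pmf map_pmf_comp pmf.map_ident)
  finally show ?thesis using assms(7,8) by simp
qed

text \<open>A column of ones has no zero and is flipped with probability 1, the power with exponent
  0. A column with a single zero has odd exponent and is never flipped, so planting cannot create a
  column of ones either.\<close>

lemma orthogonal_planted:
  assumes "(V, s) \<in> set_pmf (planted_pair k n d p)" "0 < k" "0 < n"
  shows "orthogonal_rows k d V s" "\<And>l. l < k \<Longrightarrow> s l < n"
proof -
  have fin: "finite ({..<k} \<rightarrow>\<^sub>E {..<n})" "({..<k} \<rightarrow>\<^sub>E {..<n}) \<noteq> {}"
    using assms(3) by (auto intro!: finite_PiE simp: PiE_eq_empty_iff)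
  then obtain U F where s: "s \<in> {..<k} \<rightarrow>\<^sub>E {..<n}"
    and F: "F \<in> set_pmf (Pi_pmf {..<d} False (\<lambda>j. flip_dist p (card {l \<in> {..<k}. \<not> U (l, s l, j)})))"
    and V: "V = set_row (k - 1) (s (k - 1)) d (\<lambda>j. U (k - 1, s (k - 1), j) \<noteq> F j) U"
    using assms(1) by (auto simp: planted_pair_def plant_eq)
  show "s l < n" if "l < k" for l using s that by auto
  have "\<exists>l<k. \<not> V (l, s l, j)" if j: "j < d" for j
  proof (rule ccontr)
    assume "\<not> ?thesis"
    then have V1: "V (l, s l, j)" if "l < k" for l using that by blast
    have U1: "U (l, s l, j)" if "l < k" "l \<noteq> k - 1" for l
      using V1[OF that(1)] that(2) by (simp add: V set_row_def)
    have last: "U (k - 1, s (k - 1), j) \<noteq> F j"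
      using V1[of "k - 1"] assms(2) j by (simp add: V set_row_def)
    have Fj: "F j \<in> set_pmf (flip_dist p (card {l \<in> {..<k}. \<not> U (l, s l, j)}))"
      using F j by (auto simp: set_Pi_pmf PiE_dflt_def)
    show False
    proof (cases "U (k - 1, s (k - 1), j)")
      case True
      then have "{l \<in> {..<k}. \<not> U (l, s l, j)} = {}" using U1 by fastforce
      then have "F j \<in> set_pmf (flip_dist p 0)" using Fj by (simp only: card.empty)
      then show False using last True by (simp add: flip_dist_def set_pmf_eq)
    next
      case False
      then have "{l \<in> {..<k}. \<not> U (l, s l, j)} = {k - 1}"
        using U1 assms(2) by fastforce
      then have "card {l \<in> {..<k}. \<not> U (l, s l, j)} = 1" by (simp only: card.insert card.empty finite.emptyI) simp
      then have "F j \<in> set_pmf (flip_dist p 1)" using Fj by (simp only:)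
      then show False using last False by (simp add: flip_dist_def)
    qed
  qed
  then show "orthogonal_rows k d V s"
    by (auto simp: orthogonal_rows_def)
qed


lemma rel_spmf_measure_le:
  assumes "rel_spmf R p q" "\<And>x y. R x y \<Longrightarrow> y \<in> B \<Longrightarrow> x \<in> A"
  shows "measure (measure_spmf q) B \<le> measure (measure_spmf p) A"
proof -
  have "rel_spmf R\<inverse>\<inverse> q p" using assms(1) by (simp add: spmf_rel_conversep)
  then have "measure (measure_spmf q) B \<le> measure (measure_spmf p) {y. \<exists>x\<in>B. R\<inverse>\<inverse> x y}"
    by (rule rel_spmf_measureD)
  also have "\<dots> \<le> measure (measure_spmf p) A"
    using assms(2) by (intro measure_spmf.finite_measure_mono) auto
  finally show ?thesis .
qed

lemma search_success:
  fixes p \<delta> :: real and n d k M :: nat and run :: "ov_instance \<Rightarrow> (state \<times> nat) spmf"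
  assumes red: "\<And>U. search_reduction k n d P P0 w w0 m R T A"
    and run: "\<And>U. rel_spmf (\<lambda>(s', t) C. \<forall>l<k. search_reduction.selects n thr (C l) (regs s' l))
       (run U) (spmf_of_pmf (search_reduction.search_dist k n d P P0 w w0 m A U))"
    and M: "m = 4 * M" "thr = 3 * M" "real k * (n * (41/50) ^ M) \<le> 1 / real n ^ k"
    and p: "0 \<le> p" "p \<le> 1/2" "n * d * \<bar>p - real P / 2 ^ w\<bar> \<le> 1/50" "0 < n"
    and ans: "measure_pmf.prob (bind_pmf (Pi_pmf ({..<k} \<times> {..<n} \<times> {..<d}) False (\<lambda>_. bernoulli_pmf p))
        (search_reduction.answer k n d P0 w0 A)) {True} \<le> \<delta>"
      "measure_pmf.prob (bind_pmf (map_pmf fst (planted_pair k n d p))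
        (search_reduction.answer k n d P0 w0 A)) {False} \<le> \<delta>"
  shows "1 - 13 * real k * \<delta> - 1 / real n ^ k \<le>
    measure (measure_spmf (bind_spmf (spmf_of_pmf (map_pmf fst (planted_pair k n d p)))
       (\<lambda>U. map_spmf (\<lambda>(s, t). (U, s)) (run U))))
      {(U, s). (\<forall>l<k. regs s l < n) \<and> orthogonal_rows k d U (regs s)}"
proof -
  let ?J = "planted_pair k n d p"
  let ?ans = "search_reduction.answer k n d P0 w0 A"
  let ?sd = "search_reduction.search_dist k n d P P0 w w0 m A"
  let ?sel = "search_reduction.selects n thr"
  let ?e = "\<lambda>l (V, s). row_error n d ?ans p l (s l) V"
  \<comment> \<open>The bad instances, for which some matrix has a conditional error of 1/13 or
    more; by Markov's inequality each matrix costs 13 * \<delta>.\<close>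
  let ?B = "\<Union>l<k. {x. 1 / 13 \<le> ?e l x}"
  let ?Bad = "{(V, s, C). \<exists>l<k. \<exists>r. ?sel (C l) r \<and> r \<noteq> s l}"
  let ?Y = "bind_pmf ?J (\<lambda>(V, s). map_pmf (\<lambda>C. (V, s, C)) (?sd V))"
  have "0 < k" using red by (simp add: search_reduction_def)
  have "measure_pmf.prob ?J ?B \<le> (\<Sum>l<k. measure_pmf.prob ?J {x. 1 / 13 \<le> ?e l x})"
    by (rule measure_UNION_le) auto
  also have "\<dots> \<le> (\<Sum>l<k. 13 * \<delta>)"
  proof (rule sum_mono)
    fix l assume "l \<in> {..<k}"
    then have "measure_pmf.expectation ?J (?e l) \<le> \<delta>"
      using expectation_row_error[OF p(1,2) _ p(4) ans] by simp
    moreover have "measure_pmf.prob ?J {x. 1 / 13 \<le> ?e l x} \<le> 13 * measure_pmf.expectation ?J (?e l)"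
      by (rule prob_Markov) (auto simp: row_error_def split: prod.split)
    ultimately show "measure_pmf.prob ?J {x. 1 / 13 \<le> ?e l x} \<le> 13 * \<delta>" by simp
  qed
  also have "\<dots> = 13 * real k * \<delta>" by simp
  finally have B: "measure_pmf.prob ?J ?B \<le> 13 * real k * \<delta>" .
  have "measure_pmf.prob ?Y ?Bad \<le> measure_pmf.prob ?J ?B + 1 / real n ^ k"
  proof (rule prob_bind_pmf_le)
    fix x assume x: "x \<in> set_pmf ?J" "x \<notin> ?B"
    obtain V s where Vs: "x = (V, s)" by (cases x)
    have "measure_pmf.prob (search_reduction.round_dist k n d P P0 w w0 A V l) {(S, b). S (s l) = b} \<le> 1/10"
      if "l < k" for l
    proof -
      \<comment> \<open>Together with the truncation error 1/50 of p the sum stays below the 1/10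
        demanded by the amplification.\<close>
      have "row_error n d ?ans p l (s l) V < 1/13"
        using x(2) that by (auto simp: Vs not_le)
      moreover have "p \<le> 1" using p(2) by simp
      ultimately show ?thesis
        using search_reduction.round_dist_error_le[OF red p(1) \<open>p \<le> 1\<close>, of V l "s l"] p(3) by simp
    qed
    moreover have "s l < n" if "l < k" for l
      using orthogonal_planted(2)[OF x(1)[unfolded Vs] \<open>0 < k\<close> p(4) that] .
    ultimately have "measure_pmf.prob (?sd V) {C. \<exists>l<k. \<exists>r. ?sel (C l) r \<and> r \<noteq> s l} \<le> k * (n * (41/50) ^ M)"
      by (intro search_reduction.search_dist_selects[OF red M(1,2)]) auto
    then show "measure_pmf.prob (case x of (V, s) \<Rightarrow> map_pmf (\<lambda>C. (V, s, C)) (?sd V)) ?Bad \<le> 1 / real n ^ k"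
      using M(3) by (simp add: Vs vimage_def)
  qed simp
  then have "1 - 13 * real k * \<delta> - 1 / real n ^ k \<le> 1 - measure_pmf.prob ?Y ?Bad"
    using B by simp
  also have "\<dots> = measure_pmf.prob ?Y (- ?Bad)"
    using measure_pmf.prob_compl[of ?Bad ?Y] by (simp add: Compl_eq_Diff_UNIV)
  also have "\<dots> = measure (measure_spmf (spmf_of_pmf ?Y)) (- ?Bad)"
    by simp
  also have "\<dots> \<le> measure (measure_spmf (bind_spmf (spmf_of_pmf (map_pmf fst ?J))
       (\<lambda>U. map_spmf (\<lambda>(s, t). (U, s)) (run U))))
      {(U, s). (\<forall>l<k. regs s l < n) \<and> orthogonal_rows k d U (regs s)}"
  proof (rule rel_spmf_measure_le)
    \<comment> \<open>The coupling remembers that s was planted in V, so outside \<open>?Bad\<close>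
      the output registers hold an orthogonal tuple.\<close>
    let ?R = "\<lambda>(U, st) (V, s, C). U = V \<and> (V, s) \<in> set_pmf ?J \<and> (\<forall>l<k. ?sel (C l) (regs st l))"
    have "bind_spmf (spmf_of_pmf (map_pmf fst ?J)) (\<lambda>U. map_spmf (\<lambda>(s, t). (U, s)) (run U)) =
        bind_spmf (spmf_of_pmf ?J) (\<lambda>(V, s). map_spmf (\<lambda>(s, t). (V, s)) (run V))"
      by (simp add: bind_map_pmf case_prod_unfold)
    moreover have "spmf_of_pmf ?Y =
        bind_spmf (spmf_of_pmf ?J) (\<lambda>(V, s). spmf_of_pmf (map_pmf (\<lambda>C. (V, s, C)) (?sd V)))"
      by (simp add: spmf_of_pmf_bind case_prod_unfold)
    moreover have "rel_spmf ?R
        (bind_spmf (spmf_of_pmf ?J) (\<lambda>(V, s). map_spmf (\<lambda>(s, t). (V, s)) (run V)))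
        (bind_spmf (spmf_of_pmf ?J) (\<lambda>(V, s). spmf_of_pmf (map_pmf (\<lambda>C. (V, s, C)) (?sd V))))"
    proof (rule rel_spmf_bind_reflI, clarify)
      fix V s assume "(V, s) \<in> set_spmf (spmf_of_pmf ?J)"
      then show "rel_spmf ?R (map_spmf (\<lambda>(s, t). (V, s)) (run V))
          (spmf_of_pmf (map_pmf (\<lambda>C. (V, s, C)) (?sd V)))"
        unfolding map_spmf_of_pmf[symmetric] spmf_rel_map
        by (intro rel_spmf_mono[OF run[of V]]) auto
    qed
    ultimately show "rel_spmf ?R (bind_spmf (spmf_of_pmf (map_pmf fst ?J))
        (\<lambda>U. map_spmf (\<lambda>(s, t). (U, s)) (run U))) (spmf_of_pmf ?Y)"
      by simp
    fix x y assume R: "?R x y" and y: "y \<in> - ?Bad"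
    obtain U st V s C where xy: "x = (U, st)" "y = (V, s, C)" by (cases x, cases y)
    have "regs st l = s l" if "l < k" for l
      using R y that by (auto simp: xy)
    then show "x \<in> {(U, s). (\<forall>l<k. regs s l < n) \<and> orthogonal_rows k d U (regs s)}"
      using orthogonal_planted[of V s k n d p] R \<open>0 < k\<close> p(4)
      by (auto simp: xy orthogonal_rows_def)
  qed
  finally show ?thesis .
qed

subsection \<open>The search problem\<close>

text \<open>The search has a worst-case time bound, which bounds its expected time.\<close>

lemma expected_steps_le:
  assumes "rel_spmf (\<lambda>(s, t) x. Q s t x \<and> t \<le> b) r (spmf_of_pmf D)"
  shows "expected_steps r \<le> ennreal (real b)"
proof -
  have "weight_spmf r = 1" using rel_spmf_weightD[OF assms] by simp
  then have lossless: "lossless_spmf r" by (simp add: lossless_spmf_def)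
  have le: "snd x \<le> b" if "x \<in> set_spmf r" for x
    using assms that by (cases rule: rel_spmfE) (fastforce simp: case_prod_unfold)
  have "(\<integral>\<^sup>+ x. of_nat (snd x) \<partial>measure_spmf r) \<le> (\<integral>\<^sup>+ x. of_nat b \<partial>measure_spmf r)"
    using le by (intro nn_integral_mono_AE) (auto simp: AE_measure_spmf_iff)
  also have "\<dots> = of_nat b * emeasure (measure_spmf r) (space (measure_spmf r))"
    by (rule nn_integral_const)
  also have "\<dots> \<le> of_nat b * 1"
    by (intro mult_left_mono measure_spmf.subprob_emeasure_le_1) simp
  finally show ?thesis using lossless by (simp add: expected_steps_def ennreal_of_nat_eq_real_of_nat)
qed

text \<open>The decider succeeds only with register 0 exactly v, while a wrong answer means a word
  of the opposite zero test. The two events are disjoint, so their probabilities add up to at most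
  1.\<close>

lemma prob_answer_le:
  assumes "\<And>V. spmf_of_pmf (ans V) = map_spmf (\<lambda>(s, _). regs s 0 \<noteq> 0) (run V)"
    and "1 - \<delta> \<le> measure (measure_spmf (bind_spmf (spmf_of_pmf D) run)) {(s, t). regs s 0 = v}"
    and "(v \<noteq> 0) \<noteq> b"
  shows "measure_pmf.prob (bind_pmf D ans) {b} \<le> \<delta>"
proof -
  let ?X = "bind_spmf (spmf_of_pmf D) run"
  have "spmf_of_pmf (bind_pmf D ans) = map_spmf (\<lambda>(s, _). regs s 0 \<noteq> 0) ?X"
    by (simp add: spmf_of_pmf_bind assms(1) map_bind_pmf)
  then have "measure_pmf.prob (bind_pmf D ans) {b} =
      measure (measure_spmf (map_spmf (\<lambda>(s, _). regs s 0 \<noteq> 0) ?X)) {b}"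
    by (metis measure_spmf_spmf_of_pmf)
  also have "\<dots> = measure (measure_spmf ?X) {(s, t). (regs s 0 \<noteq> 0) = b}"
    by (auto simp: measure_map_spmf vimage_def case_prod_unfold)
  finally have 1: "measure_pmf.prob (bind_pmf D ans) {b} =
      measure (measure_spmf ?X) {(s, t). (regs s 0 \<noteq> 0) = b}" .
  have "measure (measure_spmf ?X) {(s, t). (regs s 0 \<noteq> 0) = b} +
      measure (measure_spmf ?X) {(s, t). regs s 0 = v} =
      measure (measure_spmf ?X) ({(s, t). (regs s 0 \<noteq> 0) = b} \<union> {(s, t). regs s 0 = v})"
    using assms(3) by (subst measure_spmf.finite_measure_Union) auto
  also have "\<dots> \<le> 1" by (rule measure_spmf.subprob_measure_le_1)
  finally show ?thesis using 1 assms(2) by simp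
qed

section \<open>Size of the parameters\<close>

lemma ov_prob_bounds:
  assumes "0 < k" "filterlim \<alpha> at_top sequentially"
  shows "\<forall>\<^sub>F n in sequentially. 0 \<le> ov_prob k \<alpha> n \<and> ov_prob k \<alpha> n \<le> 1/2"
proof -
  \<comment> \<open>That p is at most 1/2 amounts to
    \<open>2 powr (- (2 * real k / \<alpha> n))\<close> being at least \<open>1 - (1/2) ^ k\<close>,
    and this power tends to 1 as \<alpha> tends to infinity.\<close>
  have "((\<lambda>n. - (2 * real k / \<alpha> n)) \<longlongrightarrow> - 0) sequentially"
    by (intro tendsto_minus tendsto_divide_0[OF tendsto_const]
        filterlim_mono[OF assms(2) at_top_le_at_infinity order.refl])
  then have "((\<lambda>n. 2 powr (- (2 * real k / \<alpha> n))) \<longlongrightarrow> 2 powr (- 0)) sequentially"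
    by (intro tendsto_powr tendsto_const) auto
  then have "((\<lambda>n. 2 powr (- (2 * real k / \<alpha> n))) \<longlongrightarrow> 1) sequentially" by simp
  moreover have "1 - (1/2::real) ^ k < 1" by simp
  ultimately have "\<forall>\<^sub>F n in sequentially. 1 - (1/2) ^ k < 2 powr (- (2 * real k / \<alpha> n))"
    by (rule order_tendstoD(1))
  moreover have "\<forall>\<^sub>F n in sequentially. 0 < \<alpha> n"
    using assms(2) by (simp add: filterlim_at_top_dense)
  ultimately show ?thesis
  proof eventually_elim
    case (elim n)
    have "- (2 * real k / \<alpha> n) \<le> 0" using elim(2) by simp
    then have "2 powr (- (2 * real k / \<alpha> n)) \<le> 2 powr 0" by (intro powr_mono) auto
    then have "0 \<le> 1 - 2 powr (- (2 * real k / \<alpha> n))" by simp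
    then have "ov_prob k \<alpha> n \<le> ((1/2) ^ k) powr (1 / real k)"
      unfolding ov_prob_def using elim(1) by (intro powr_mono2) auto
    also have "\<dots> = 1/2"
      using assms(1) by (simp add: powr_realpow[symmetric] powr_powr)
    finally show ?case by (simp add: ov_prob_def)
  qed
qed

lemma ov_dim_bigo:
  assumes "\<alpha> \<in> O(\<lambda>n. log 2 (real n) ^ e)"
  obtains K where "0 < K" "\<forall>\<^sub>F n in sequentially. real (ov_dim \<alpha> n) + 1 \<le> K * log 2 (real n) ^ (e + 1)"
proof -
  from assms obtain K where K: "0 < K"
    "\<forall>\<^sub>F n in sequentially. norm (\<alpha> n) \<le> K * norm (log 2 (real n) ^ e)"
    by (elim landau_o.bigE)
  have "\<forall>\<^sub>F n :: nat in sequentially. 1 \<le> log 2 (real n)" by real_asymp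
  with K(2) have "\<forall>\<^sub>F n in sequentially. real (ov_dim \<alpha> n) + 1 \<le> (K + 2) * log 2 (real n) ^ (e + 1)"
  proof eventually_elim
    case (elim n)
    let ?L = "log 2 (real n)"
    have "real (ov_dim \<alpha> n) \<le> \<bar>\<alpha> n\<bar> * ?L + 1"
    proof -
      have "\<alpha> n * ?L \<le> \<bar>\<alpha> n\<bar> * ?L" using elim by (intro mult_right_mono) auto
      moreover have "0 \<le> \<bar>\<alpha> n\<bar> * ?L" using elim by simp
      ultimately show ?thesis unfolding ov_dim_def by linarith
    qed
    also have "\<dots> \<le> K * ?L ^ e * ?L + 1"
      using elim by (intro add_mono mult_right_mono) (auto simp: power_abs)
    finally have "real (ov_dim \<alpha> n) + 1 \<le> K * ?L ^ (e + 1) + 2" by (simp add: mult_ac)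
    moreover have "1 \<le> ?L ^ (e + 1)" using elim by (intro one_le_power) auto
    ultimately show ?case by (simp add: algebra_simps)
  qed
  with K(1) show ?thesis by (intro that[of "K + 2"]) auto
qed

lemma floorlog_le_log: "2 \<le> n \<Longrightarrow> real (floorlog 2 n) \<le> 2 * log 2 (real n)"
proof -
  assume n: "2 \<le> n"
  then have "1 \<le> log 2 (real n)" by (simp add: le_log_iff)
  moreover have "real (floorlog 2 n) \<le> log 2 (real n) + 1"
    using n calculation by (simp add: floorlog_def)
  ultimately show ?thesis by simp
qed

lemma floorlog_le_self: "0 < n \<Longrightarrow> floorlog 2 n \<le> n"
  by (rule floorlog_leI) (auto simp: less_exp)

lemma less_power_floorlog: "0 < n \<Longrightarrow> n < 2 ^ floorlog 2 n"
  using floorlog_bounds[of n 2] by simp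


text \<open>Increasing the factor c to c + 3 gives words of at least 4 F bits, so that n^4 is below
  \<open>2 ^ w\<close>. Then every number up to n^2 fits into a word, and truncating p costs at most
  n^2 / n^4 over all entries.\<close>

lemma word_bounds:
  fixes n d k c :: nat and p :: real
  defines "F \<equiv> floorlog 2 n" and "w0 \<equiv> c * floorlog 2 n" and "w \<equiv> (c + 3) * floorlog 2 n"
  assumes "1 \<le> c" "d \<le> n" "16 * k * (k + 2) + c + 50 \<le> n" "0 < k" "0 \<le> p" "p \<le> 1/2"
  shows "0 < w0" "w0 \<le> w" "w0 < w" "n < 2 ^ w0" "d < 2 ^ w0" "n * d < 2 ^ w"
    and "nat \<lfloor>p * 2 ^ w0\<rfloor> < 2 ^ w0" "nat \<lfloor>p * 2 ^ w\<rfloor> \<le> 2 ^ w"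
    and "k * (4 * (4 * (k + 2) * F)) < 2 ^ w"
    and "nat \<lfloor>p * 2 ^ w0\<rfloor> = nat \<lfloor>p * 2 ^ w\<rfloor> div 2 ^ (w - w0)"
    and "c < 2 ^ w" "c + 3 < 2 ^ w" "4 * (k + 2) < 2 ^ w" "(4::nat) < 2 ^ w"
    and "real (n * d) * \<bar>p - real (nat \<lfloor>p * 2 ^ w\<rfloor>) / 2 ^ w\<bar> \<le> 1/50"
    and "real k * (real n * (41/50) ^ (4 * (k + 2) * F)) \<le> 1 / real n ^ k"
proof -
  have n: "0 < n" "50 \<le> n" "c + 3 \<le> n" using assms(6) by auto
  have nF: "n < 2 ^ F" unfolding F_def by (rule less_power_floorlog[OF n(1)])
  have F: "0 < F" using nF n(1) by (cases F) auto
  have w: "w0 = c * F" "w = (c + 3) * F" by (simp_all add: w0_def w_def F_def)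
  show w0: "0 < w0" "w0 \<le> w" "w0 < w" using F assms(4) by (simp_all add: w)
  have "F \<le> w0" using assms(4) by (simp add: w)
  then have F_w0: "(2::nat) ^ F \<le> 2 ^ w0" by (rule power_increasing) simp
  show nw0: "n < 2 ^ w0" using nF F_w0 by (rule less_le_trans)
  then show "d < 2 ^ w0" using assms(5) by simp
  have "4 * F \<le> w" using assms(4) by (simp add: w)
  then have "(2::nat) ^ (4 * F) \<le> 2 ^ w" by (rule power_increasing) simp
  moreover have "(n * n) * (n * n) < 2 ^ (4 * F)"
  proof -
    have sq: "n * n < 2 ^ F * 2 ^ F" by (rule mult_strict_mono[OF nF nF]) auto
    have "(n * n) * (n * n) < (2 ^ F * 2 ^ F) * (2 ^ F * 2 ^ F)"
      by (rule mult_strict_mono[OF sq sq]) auto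
    moreover have "4 * F = (F + F) + (F + F)" by simp
    ultimately show ?thesis by (simp only: power_add)
  qed
  ultimately have n4: "(n * n) * (n * n) < 2 ^ w" by (rule less_le_trans[rotated])
  have le: "x \<le> n * n \<Longrightarrow> x < 2 ^ w" for x
    using n4 n(1) le_trans[of x "n * n" "(n * n) * (n * n)"] by simp
  show "n * d < 2 ^ w" using assms(5) by (intro le) simp
  have le': "x \<le> n \<Longrightarrow> x < 2 ^ w" for x
    using le[of x] le_trans[of x n "n * n"] by simp
  have "k * (4 * (4 * (k + 2) * F)) = (16 * k * (k + 2)) * F" by (simp add: algebra_simps)
  also have "\<dots> \<le> n * n"
    using assms(6) floorlog_le_self[OF n(1)] by (intro mult_mono) (auto simp: F_def)
  finally show "k * (4 * (4 * (k + 2) * F)) < 2 ^ w" by (rule le)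
  show "c < 2 ^ w" "c + 3 < 2 ^ w" "(4::nat) < 2 ^ w" using n by (auto intro: le')
  have "4 * (k + 2) \<le> 16 * k * (k + 2)" using assms(7) by (cases k) auto
  then show "4 * (k + 2) < 2 ^ w" using assms(6) by (intro le') simp
  have pw: "p * 2 ^ i < 2 ^ i" for i :: nat using assms(9) by simp
  have "\<lfloor>p * 2 ^ w0\<rfloor> < 2 ^ w0" using pw[of w0] by (simp add: floor_less_iff)
  then show "nat \<lfloor>p * 2 ^ w0\<rfloor> < 2 ^ w0" by (simp add: nat_less_iff nat_power_eq)
  have "\<lfloor>p * 2 ^ w\<rfloor> < 2 ^ w" using pw[of w] by (simp add: floor_less_iff)
  then show "nat \<lfloor>p * 2 ^ w\<rfloor> \<le> 2 ^ w" by (simp add: nat_le_iff)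
  \<comment> \<open>Truncating p to w digits and then to w0 digits is the same as truncating it to
    w0 digits at once; hence the shifted word is the one that the decider would be given as
    input.\<close>
  have "(2::real) ^ w = 2 ^ w0 * 2 ^ (w - w0)" using w0(2) by (simp flip: power_add)
  then have "p * 2 ^ w0 = (p * 2 ^ w) / real_of_int (2 ^ (w - w0))" by simp
  then have "\<lfloor>p * 2 ^ w0\<rfloor> = \<lfloor>p * 2 ^ w\<rfloor> div 2 ^ (w - w0)"
    by (simp only: floor_divide_real_eq_div[of "2 ^ (w - w0)" "p * 2 ^ w"] zero_le_power zero_le_numeral)
  then show "nat \<lfloor>p * 2 ^ w0\<rfloor> = nat \<lfloor>p * 2 ^ w\<rfloor> div 2 ^ (w - w0)"
    using assms(8) by (simp add: nat_div_distrib nat_power_eq)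
  have fl: "0 \<le> p * 2 ^ w" using assms(8) by simp
  then have "\<bar>p - real (nat \<lfloor>p * 2 ^ w\<rfloor>) / 2 ^ w\<bar> = (p * 2 ^ w - of_int \<lfloor>p * 2 ^ w\<rfloor>) / 2 ^ w"
    by (simp add: diff_divide_distrib[symmetric] abs_divide field_simps)
  also have "\<dots> \<le> 1 / 2 ^ w"
    by (rule divide_right_mono, linarith, simp)
  finally have "real (n * d) * \<bar>p - real (nat \<lfloor>p * 2 ^ w\<rfloor>) / 2 ^ w\<bar> \<le> real (n * n) * (1 / 2 ^ w)"
    using assms(5) by (intro mult_mono of_nat_mono mult_left_mono) auto
  also have "\<dots> \<le> 1 / real (n * n)"
  proof -
    have "real ((n * n) * (n * n)) \<le> real (2 ^ w)" using n4 by (intro of_nat_mono) simp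
    then show ?thesis using n(1) by (simp add: field_simps)
  qed
  also have "\<dots> \<le> 1 / 50"
  proof -
    have "50 * 1 \<le> n * n" using n by (intro mult_mono) auto
    then have "real 50 \<le> real (n * n)" by (intro of_nat_mono) simp
    then show ?thesis by (intro divide_left_mono) auto
  qed
  finally show "real (n * d) * \<bar>p - real (nat \<lfloor>p * 2 ^ w\<rfloor>) / 2 ^ w\<bar> \<le> 1/50" .
  \<comment> \<open>Since (41/50)^4 is below 1/2 and \<open>2 ^ F\<close> exceeds n, each row fails
    with probability at most n^-(k+2). The union bound over k * n rows costs a factor of at most
    n^2, as k is at most n.\<close>
  have "(41/50 :: real) ^ (4 * (k + 2) * F) = ((41/50) ^ 4) ^ ((k + 2) * F)"
    unfolding power_mult[symmetric] by (simp only: mult.assoc)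
  also have "\<dots> \<le> (1/2) ^ ((k + 2) * F)"
    by (rule power_mono) (simp_all add: power_divide)
  also have "\<dots> = 1 / (2 ^ F) ^ (k + 2)"
    unfolding power_divide power_one power_mult[symmetric] by (simp only: mult.commute)
  also have "\<dots> \<le> 1 / real n ^ (k + 2)"
  proof -
    have "real n \<le> real (2 ^ F)" using nF by (intro of_nat_mono) simp
    then have "real n ^ (k + 2) \<le> (2 ^ F) ^ (k + 2)" by (intro power_mono) auto
    then show ?thesis using n(1) by (intro divide_left_mono) auto
  qed
  finally have "real k * (real n * (41/50) ^ (4 * (k + 2) * F)) \<le> real n * (real n * (1 / real n ^ (k + 2)))"
  proof (intro mult_mono)
    have "k \<le> 16 * k * (k + 2)" by simp
    then show "real k \<le> real n" using assms(6) by simp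
  qed auto
  also have "\<dots> = 1 / real n ^ k" using n(1) by (simp add: power_add power2_eq_square)
  finally show "real k * (real n * (41/50) ^ (4 * (k + 2) * F)) \<le> 1 / real n ^ k" .
qed

section \<open>The reduction at a fixed size n\<close>

definition search_com :: "nat \<Rightarrow> nat \<Rightarrow> nat \<Rightarrow> com \<Rightarrow> com" where
  "search_com k c R A = Seq (init c (c + 3) (4 * (k + 2))) (search_loop k R A)"

text \<open>Step counts are integers, so the real time bound of the decider enters rounded down, as
  a natural number.\<close>

definition search_time :: "nat \<Rightarrow> nat \<Rightarrow> nat \<Rightarrow> nat \<Rightarrow> nat \<Rightarrow> nat \<Rightarrow> nat" where
  "search_time k c R n d T =
     (let F = floorlog 2 n; N = n * d;
        round = 13 * n + k * (5 * N + 2) + N * (5 * ((c + 3) * F) + 11) + R + 4 * T + 20;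
        phase = 4 * (4 * (k + 2) * F) * (round + 2) + 6 * n + 5
      in 3 * F + 20 + k * phase + k + 2)"

text \<open>The inner F pays for the coin tosses of a single entry, the outer F for the number of
  rounds. The summand 1 in d + 1 covers scans over the n rows, whose cost does not involve
  d.\<close>

lemma search_time_le:
  fixes k c R n d T :: nat
  defines "F \<equiv> floorlog 2 n"
  assumes "0 < n"
  shows "search_time k c R n d T \<le>
    (25 + k + k * (16 * (k + 2) * (7 * k + 5 * c + R + 65) + 11)) * ((T + n * ((d + 1) * F)) * F)"
proof -
  have F: "1 \<le> F"
    using less_power_floorlog[OF assms(2)] assms(2) by (cases F) (auto simp: F_def)
  define G where "G = n * ((d + 1) * F)"
  have "n * 1 \<le> n * ((d + 1) * F)" using F by (intro mult_left_mono) auto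
  then have n: "n \<le> G" "1 \<le> G" using assms(2) by (simp_all add: G_def)
  have NF: "n * d * F \<le> G" by (simp add: G_def algebra_simps)
  then have N: "n * d \<le> G" using F by (intro le_trans[OF _ NF]) auto
  have "n * d * (5 * ((c + 3) * F) + 11) = (5 * c + 15) * (n * d * F) + 11 * (n * d)"
    by (simp add: algebra_simps)
  also have "\<dots> \<le> (5 * c + 15) * G + 11 * G"
    using NF N by (intro add_mono mult_left_mono) auto
  finally have 1: "n * d * (5 * ((c + 3) * F) + 11) \<le> (5 * c + 26) * G" by (simp add: algebra_simps)
  have "k * (5 * (n * d) + 2) \<le> k * (7 * G)" using N n by (intro mult_left_mono) auto
  moreover have "R * 1 \<le> R * G" using n by (intro mult_left_mono) auto
  ultimately have "13 * n + k * (5 * (n * d) + 2) + n * d * (5 * ((c + 3) * F) + 11) + R + 4 * T + 20 + 2 \<le>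
      13 * G + k * (7 * G) + (5 * c + 26) * G + R * G + 4 * T + 22 * G"
    using n 1 by linarith
  also have "\<dots> \<le> (7 * k + 5 * c + R + 65) * (T + G)"
    by (simp add: algebra_simps)
  finally have round: "4 * (4 * (k + 2) * F) * (13 * n + k * (5 * (n * d) + 2) + n * d * (5 * ((c + 3) * F) + 11) + R + 4 * T + 20 + 2)
      \<le> 4 * (4 * (k + 2) * F) * ((7 * k + 5 * c + R + 65) * (T + G))"
    by (rule mult_left_mono) simp
  define X where "X = (T + G) * F"
  have "G * 1 \<le> (T + G) * F" using F by (intro mult_mono) auto
  then have X: "G \<le> X" "F \<le> X" using n F by (auto simp: X_def intro: le_trans[OF _ mult_right_mono])
  have "4 * (4 * (k + 2) * F) * ((7 * k + 5 * c + R + 65) * (T + G)) =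
      16 * (k + 2) * (7 * k + 5 * c + R + 65) * X"
    unfolding X_def by (simp add: algebra_simps)
  with round X n have "4 * (4 * (k + 2) * F) * (13 * n + k * (5 * (n * d) + 2) + n * d * (5 * ((c + 3) * F) + 11) + R + 4 * T + 20 + 2)
      + 6 * n + 5 \<le> 16 * (k + 2) * (7 * k + 5 * c + R + 65) * X + 11 * X"
    by linarith
  then have "k * (4 * (4 * (k + 2) * F) * (13 * n + k * (5 * (n * d) + 2) + n * d * (5 * ((c + 3) * F) + 11) + R + 4 * T + 20 + 2)
      + 6 * n + 5) \<le> k * (16 * (k + 2) * (7 * k + 5 * c + R + 65) * X + 11 * X)"
    by (rule mult_left_mono) simp
  also have "\<dots> = k * (16 * (k + 2) * (7 * k + 5 * c + R + 65) + 11) * X"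
    by (simp only: distrib_right mult.assoc)
  finally have "search_time k c R n d T \<le>
      3 * F + 20 + k * (16 * (k + 2) * (7 * k + 5 * c + R + 65) + 11) * X + k + 2"
    unfolding search_time_def Let_def F_def by linarith
  moreover have "k \<le> k * X" using X n by (cases X) auto
  ultimately have "search_time k c R n d T \<le>
      25 * X + k * X + k * (16 * (k + 2) * (7 * k + 5 * c + R + 65) + 11) * X"
    using X n by linarith
  then show ?thesis unfolding X_def G_def by (simp only: distrib_right)
qed

lemma search_com_correct:
  fixes \<alpha> T :: "nat \<Rightarrow> real" and n k c R :: nat and \<delta> :: real
  assumes "1 \<le> c" "ov_dim \<alpha> n \<le> n" "16 * k * (k + 2) + c + 50 \<le> n" "0 < k"
    and p: "0 \<le> ov_prob k \<alpha> n" "ov_prob k \<alpha> n \<le> 1/2"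
    and R: "3 \<le> R" "regs_of A \<subseteq> {..<R}"
    and lossless: "\<And>U. lossless_spmf (run_ov k \<alpha> A c n U)"
    and time: "\<And>U s t. (s, t) \<in> set_spmf (run_ov k \<alpha> A c n U) \<Longrightarrow> real t \<le> T n"
  shows "expected_steps (run_ov k \<alpha> (search_com k c R A) (c + 3) n U) \<le>
      ennreal (real (search_time k c R n (ov_dim \<alpha> n) (nat \<lfloor>T n\<rfloor>)))"
    and "(\<And>b. b \<in> {0, 1} \<Longrightarrow> 1 - \<delta> \<le> measure (measure_spmf
          (bind_spmf (spmf_of_pmf (ov_dist k \<alpha> b n)) (run_ov k \<alpha> A c n))) {(s, t). regs s 0 = b}) \<Longrightarrow>
      1 - 13 * real k * \<delta> - 1 / real n ^ k \<le> measure (measure_spmf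
          (bind_spmf (spmf_of_pmf (ov_dist k \<alpha> 1 n)) (\<lambda>U.
             map_spmf (\<lambda>(s, t). (U, s)) (run_ov k \<alpha> (search_com k c R A) (c + 3) n U))))
          {(U, s). (\<forall>l<k. regs s l < n) \<and> orthogonal_rows k (ov_dim \<alpha> n) U (regs s)}"
proof -
  define d where "d = ov_dim \<alpha> n"
  define p where "p = ov_prob k \<alpha> n"
  define F where "F = floorlog 2 n"
  define w0 where "w0 = c * F"
  define w where "w = (c + 3) * F"
  define P where "P = nat \<lfloor>p * 2 ^ w\<rfloor>"
  define P0 where "P0 = nat \<lfloor>p * 2 ^ w0\<rfloor>"
  define M where "M = 4 * (k + 2) * F"
  note wb = word_bounds[OF assms(1-4) p, folded F_def, folded w0_def w_def d_def p_def, folded P_def P0_def M_def]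
  have n: "0 < n" using assms(3) by simp
  have input: "input_state k \<alpha> w' n U = initial k n d (nat \<lfloor>p * 2 ^ w'\<rfloor>) U" for w' U
    by (simp add: input_state_def initial_def Let_def d_def p_def)
  have run: "run_ov k \<alpha> A c n V = exec w0 A (initial k n d P0 V)" for V
    by (simp add: run_ov_def word_size_def input w0_def F_def P0_def)
  have run': "run_ov k \<alpha> B (c + 3) n V = exec w B (initial k n d P V)" for V B
    by (simp add: run_ov_def word_size_def input w_def F_def P_def)
  have red: "search_reduction k n d P P0 w w0 (4 * M) R (nat \<lfloor>T n\<rfloor>) A"
  proof
    show "t \<le> nat \<lfloor>T n\<rfloor>" if "(s, t) \<in> set_spmf (exec w0 A (initial k n d P0 V))" for V s t
      using time[of s t V] that by (simp add: run le_nat_floor)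
  qed (use wb assms(4) R lossless in \<open>auto simp: run\<close>)
  have refines: "rel_spmf (\<lambda>(s', t) C. (\<forall>l<k. search_reduction.selects n (3 * M) (C l) (regs s' l)) \<and>
       t \<le> search_time k c R n d (nat \<lfloor>T n\<rfloor>))
     (run_ov k \<alpha> (search_com k c R A) (c + 3) n U)
     (spmf_of_pmf (search_reduction.search_dist k n d P P0 w w0 (4 * M) A U))" for U
  proof -
    have "refines w (Seq (init c (c + 3) (4 * (k + 2))) (search_loop k R A)) (initial k n d P U)
      (search_reduction.search_dist k n d P P0 w w0 (4 * M) A U)
      (\<lambda>s' t C. (\<forall>l<k. search_reduction.selects n (3 * M) (C l) (regs s' l)) \<and>
         t \<le> 3 * floorlog 2 n + 20 +
           k * search_reduction.phase_time k n d w (4 * M) R (nat \<lfloor>T n\<rfloor>) + k + 2)"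
    proof (rule search_reduction.refines_search[OF red])
      show "w = (c + 3) * floorlog 2 n" "w0 = c * floorlog 2 n"
        "4 * M = 4 * (4 * (k + 2) * floorlog 2 n)" "3 * M = 3 * (4 * (k + 2) * floorlog 2 n)"
        by (simp_all add: w_def w0_def M_def F_def)
    qed (fact wb)+
    moreover have "3 * floorlog 2 n + 20 +
        k * search_reduction.phase_time k n d w (4 * M) R (nat \<lfloor>T n\<rfloor>) + k + 2 =
      search_time k c R n d (nat \<lfloor>T n\<rfloor>)"
      unfolding search_reduction.phase_time_def[OF red] search_reduction.round_time_def[OF red]
      unfolding search_time_def Let_def w_def M_def F_def ..
    ultimately show ?thesis
      unfolding refines_def run' search_com_def by (simp only:)
  qed
  show "expected_steps (run_ov k \<alpha> (search_com k c R A) (c + 3) n U) \<le>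
      ennreal (real (search_time k c R n (ov_dim \<alpha> n) (nat \<lfloor>T n\<rfloor>)))"
    using expected_steps_le[OF refines] by (simp add: d_def)
  have model: "model_dist k \<alpha> n = Pi_pmf ({..<k} \<times> {..<n} \<times> {..<d}) False (\<lambda>_. bernoulli_pmf p)"
    by (simp add: model_dist_def d_def p_def)
  have planted: "planted_dist k \<alpha> n = map_pmf fst (planted_pair k n d p)"
    by (simp add: planted_dist_def planted_pair_def model map_bind_pmf map_pmf_comp pmf.map_ident
        flip: d_def p_def)
  have ans: "spmf_of_pmf (search_reduction.answer k n d P0 w0 A V) =
      map_spmf (\<lambda>(s, _). regs s 0 \<noteq> 0) (run_ov k \<alpha> A c n V)" for V
    unfolding run by (rule search_reduction.spmf_of_pmf_answer[OF red])
  assume dec: "1 - \<delta> \<le> measure (measure_spmf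
      (bind_spmf (spmf_of_pmf (ov_dist k \<alpha> b n)) (run_ov k \<alpha> A c n))) {(s, t). regs s 0 = b}"
    if "b \<in> {0, 1}" for b
  have "1 - 13 * real k * \<delta> - 1 / real n ^ k \<le> measure (measure_spmf
      (bind_spmf (spmf_of_pmf (map_pmf fst (planted_pair k n d p))) (\<lambda>U.
         map_spmf (\<lambda>(s, t). (U, s)) (run_ov k \<alpha> (search_com k c R A) (c + 3) n U))))
      {(U, s). (\<forall>l<k. regs s l < n) \<and> orthogonal_rows k d U (regs s)}"
  proof (rule search_success[OF red])
    show "rel_spmf (\<lambda>(s', t) C. \<forall>l<k. search_reduction.selects n (3 * M) (C l) (regs s' l))
        (run_ov k \<alpha> (search_com k c R A) (c + 3) n U)
        (spmf_of_pmf (search_reduction.search_dist k n d P P0 w w0 (4 * M) A U))" for U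
      by (rule rel_spmf_mono[OF refines]) auto
    show "measure_pmf.prob (bind_pmf (Pi_pmf ({..<k} \<times> {..<n} \<times> {..<d}) False (\<lambda>_. bernoulli_pmf p))
        (search_reduction.answer k n d P0 w0 A)) {True} \<le> \<delta>"
      by (rule prob_answer_le[OF ans, where v = 0]) (use dec[of 0] in \<open>simp_all add: ov_dist_def model\<close>)
    show "measure_pmf.prob (bind_pmf (map_pmf fst (planted_pair k n d p))
        (search_reduction.answer k n d P0 w0 A)) {False} \<le> \<delta>"
      by (rule prob_answer_le[OF ans, where v = 1]) (use dec[of 1] in \<open>simp_all add: ov_dist_def planted\<close>)
  qed (use wb p n in \<open>simp_all add: p_def\<close>)
  then show "1 - 13 * real k * \<delta> - 1 / real n ^ k \<le> measure (measure_spmf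
          (bind_spmf (spmf_of_pmf (ov_dist k \<alpha> 1 n)) (\<lambda>U.
             map_spmf (\<lambda>(s, t). (U, s)) (run_ov k \<alpha> (search_com k c R A) (c + 3) n U))))
          {(U, s). (\<forall>l<k. regs s l < n) \<and> orthogonal_rows k (ov_dim \<alpha> n) U (regs s)}"
    by (simp add: ov_dist_def planted d_def)
qed


theorem theorem12:
  fixes k :: nat and \<alpha> \<delta> T :: "nat \<Rightarrow> real"
  assumes "k \<ge> 2"
    and "polylog \<alpha>"
    and "filterlim \<alpha> at_top sequentially"
    and "\<forall>\<^sub>F n in sequentially. 0 < \<delta> n \<and> \<delta> n \<le> 1"
    and "\<exists>A c. 1 \<le> c \<and> solves_decision k \<alpha> A c (\<lambda>n. 1 - \<delta> n) \<and> runs_in_time k \<alpha> A c T"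
  shows "\<exists>A c. 1 \<le> c \<and>
           solves_search k \<alpha> A c (\<lambda>n. 1 - 13 * real k * \<delta> n - 1 / real n ^ k) \<and>
           (\<exists>T' g. runs_in_expected_time k \<alpha> A c T' \<and> polylog g \<and>
              T' \<in> O(\<lambda>n. (T n + real n * g n) * log 2 (real n / \<delta> n)))"
proof -
  obtain A c where c: "1 \<le> c" and dec: "solves_decision k \<alpha> A c (\<lambda>n. 1 - \<delta> n)"
    and time: "runs_in_time k \<alpha> A c T"
    using assms(5) by blast
  obtain R0 where "regs_of A \<subseteq> {..<R0}"
    using finite_nat_iff_bounded[of "regs_of A"] finite_regs_of by auto
  \<comment> \<open>At least three registers have to be reset, since the decider expects its
    parameters in registers 0, 1 and 2.\<close>
  then have R: "3 \<le> R0 + 3" "regs_of A \<subseteq> {..<R0 + 3}" by auto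
  define R where "R = R0 + 3"
  let ?B = "search_com k c R A"
  let ?T = "\<lambda>n. real (search_time k c R n (ov_dim \<alpha> n) (nat \<lfloor>T n\<rfloor>))"
  \<comment> \<open>The polylogarithmic cost per row: d + 1 entries, each drawn with a number of
    coins proportional to the length of n.\<close>
  let ?g = "\<lambda>n. (real (ov_dim \<alpha> n) + 1) * real (floorlog 2 n)"
  obtain e where e: "\<alpha> \<in> O(\<lambda>n. log 2 (real n) ^ e)"
    using assms(2) by (auto simp: polylog_def)
  obtain K where K: "0 < K"
    "\<forall>\<^sub>F n in sequentially. real (ov_dim \<alpha> n) + 1 \<le> K * log 2 (real n) ^ (e + 1)"
    by (rule ov_dim_bigo[OF e])
  have "\<forall>\<^sub>F n :: nat in sequentially. K * log 2 (real n) ^ (e + 1) \<le> real n"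
    by real_asymp
  with K(2) have dim: "\<forall>\<^sub>F n in sequentially. ov_dim \<alpha> n \<le> n"
    by eventually_elim linarith
  have large: "\<forall>\<^sub>F n in sequentially. 16 * k * (k + 2) + c + 50 \<le> n"
    by (rule eventually_ge_at_top)
  have k: "0 < k" using assms(1) by simp
  note time' = time[unfolded runs_in_time_def]
  have "\<forall>\<^sub>F n in sequentially. \<forall>b\<in>{0, 1}. 1 - \<delta> n \<le> measure (measure_spmf
          (bind_spmf (spmf_of_pmf (ov_dist k \<alpha> b n)) (run_ov k \<alpha> A c n))) {(s, t). regs s 0 = b}"
    using dec unfolding solves_decision_def by (intro eventually_ball_finite) auto
  then have search: "solves_search k \<alpha> ?B (c + 3) (\<lambda>n. 1 - 13 * real k * \<delta> n - 1 / real n ^ k)"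
    unfolding solves_search_def using dim large time' ov_prob_bounds[OF k assms(3)]
  proof eventually_elim
    case (elim n)
    show ?case
      by (rule search_com_correct(2)[where T = T])
         (use elim c k R in \<open>auto simp: R_def\<close>)
  qed
  have expected: "runs_in_expected_time k \<alpha> ?B (c + 3) ?T"
    unfolding runs_in_expected_time_def using dim large time' ov_prob_bounds[OF k assms(3)]
  proof eventually_elim
    case (elim n)
    show ?case
      by (intro allI search_com_correct(1)[where T = T])
         (use elim c k R in \<open>auto simp: R_def\<close>)
  qed
  have "?g \<in> O(\<lambda>n. log 2 (real n) ^ (e + 2))"
  proof (rule landau_o.bigI[of "K * 2"])
    show "\<forall>\<^sub>F n in sequentially. norm (?g n) \<le> K * 2 * norm (log 2 (real n) ^ (e + 2))"
      using K(2) eventually_ge_at_top[of 2]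
    proof eventually_elim
      case (elim n)
      have "?g n \<le> (K * log 2 (real n) ^ (e + 1)) * (2 * log 2 (real n))"
        using elim floorlog_le_log[of n] by (intro mult_mono) auto
      also have "\<dots> = K * 2 * log 2 (real n) ^ (e + 2)" by simp
      finally show ?case using elim by simp
    qed
  qed (use K(1) in simp)
  then have g: "polylog ?g" unfolding polylog_def by (rule exI)
  let ?C = "25 + k + k * (16 * (k + 2) * (7 * k + 5 * c + R + 65) + 11)"
  have "?T \<in> O(\<lambda>n. (T n + real n * ?g n) * log 2 (real n / \<delta> n))"
  proof (rule landau_o.bigI[of "real ?C * 2"])
    show "\<forall>\<^sub>F n in sequentially. norm (?T n) \<le>
        real ?C * 2 * norm ((T n + real n * ?g n) * log 2 (real n / \<delta> n))"
      using eventually_ge_at_top[of 2] assms(4) time'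
    proof eventually_elim
      case (elim n)
      \<comment> \<open>Some run exists on some instance, and its nonnegative length shows that
        \<open>T n\<close> is nonnegative.\<close>
      obtain s t where "(s, t) \<in> set_spmf (run_ov k \<alpha> A c n (\<lambda>_. False))"
        using lossless_spmf_nonempty elim(3) by (metis surj_pair)
      then have "real t \<le> T n" using elim(3) by blast
      then have T: "real (nat \<lfloor>T n\<rfloor>) \<le> T n" "0 \<le> T n" by auto
      \<comment> \<open>The number of rounds is of order log n, which is at most the claimed log (n
        / \<delta>) because \<delta> is at most 1.\<close>
      have "real n * 1 \<le> real n * (1 / \<delta> n)"
        using elim(2) by (intro mult_left_mono) auto
      then have "log 2 (real n) \<le> log 2 (real n / \<delta> n)"
        using elim(1) by simp
      then have F: "real (floorlog 2 n) \<le> 2 * log 2 (real n / \<delta> n)"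
        using floorlog_le_log[OF elim(1)] by simp
      have "?T n \<le> real (?C * ((nat \<lfloor>T n\<rfloor> + n * ((ov_dim \<alpha> n + 1) * floorlog 2 n)) * floorlog 2 n))"
        using elim(1) by (intro of_nat_mono search_time_le) simp
      also have "\<dots> = real ?C * ((real (nat \<lfloor>T n\<rfloor>) + real n * ?g n) * real (floorlog 2 n))"
        by (simp only: of_nat_mult of_nat_add of_nat_1)
      also have "\<dots> \<le> real ?C * ((T n + real n * ?g n) * (2 * log 2 (real n / \<delta> n)))"
        using T F by (intro mult_left_mono mult_mono add_right_mono) auto
      also have "\<dots> = real ?C * 2 * ((T n + real n * ?g n) * log 2 (real n / \<delta> n))"
        by simp
      also have "\<dots> \<le> real ?C * 2 * norm ((T n + real n * ?g n) * log 2 (real n / \<delta> n))"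
        by (intro mult_left_mono) auto
      finally show ?case by simp
    qed
  next
    have "0 < real ?C" by (subst of_nat_0_less_iff) simp
    then show "0 < real ?C * 2" by (rule mult_pos_pos) simp
  qed
  with search expected g c show ?thesis
    by (intro exI[of _ ?B] exI[of _ "c + 3"] conjI exI[of _ ?T] exI[of _ ?g]) auto
qed

end
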